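(* Let $M$ be a complex manifold, $E$ a holomorphic vector bundle over $M$, and $(M,E,\Sigma,M_j,h,h_{j,s})$ a singular hermitian metric on $E$. Assume that $h$ is singular Nakano semi-positive, i.e. $\Theta_h(E)\ge^s_{Nak}0$. Then $h$ is Griffiths semi-positive.
   Context: A measurable metric on $E$ is a section $h$ of $E^*\otimes\bar E^*$ with measurable coefficients which is almost everywhere a positive definite hermitian form on $E$. A singular hermitian metric on $E$ is a collection of data $(M,E,\Sigma,M_j,h,h_{j,s})$, where $h$ is a measurable metric on $E$, $\Sigma\subset M$ is a closed set of measure zero, $M_1\Subset M_2\Subset\cdots$ is a sequence of relatively compact subsets of $M$ with $\bigcup_jM_j=M$, and for each $j$, $\{h_{j,s}\}_{s\ge1}$ is a sequence of hermitian metrics of class $C^2$ on $E|_{M_j}$ with $\lim_{s\to+\infty}h_{j,s}=h$ pointwise on $M_j\setminus\Sigma$. Singular Nakano semi-positivity: let $\omega$ be a hermitian metric on $M$. One writes $\Theta_h(E)\ge^s_{Nak}0$ if for each $M_j$ there are continuous functions $\lambda_{j,s}$ ($s\ge1$) and $\lambda_j$ on $\overline{M_j}$ such that: (i) $|e_x|_{h_{j,s}}\le|e_x|_{h_{j,s+1}}$ for all $x\in M_j$, $s$, $e_x\in E_x$; (ii) $\Theta_{h_{j,s}}(E)\ge_{Nak}-\lambda_{j,s}\omega\otimes Id_E$ on $M_j$ (inequality of hermitian forms on $TM\otimes E$, i.e. in the sense of Nakano); (iii) $\lambda_{j,s}\to0$ almost everywhere on $M_j$ as $s\to+\infty$; (iv)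 $0\le\lambda_{j,s}\le\lambda_j$ on $M_j$ for all $s$. Griffiths semi-positivity: for a measurable metric $h$ on $E$ which is everywhere a positive definite hermitian form, $h$ is singular Griffiths semi-negative if $|u|^2_h$ is plurisubharmonic for every local holomorphic section $u$ of $E$; $h$ is Griffiths semi-positive if the dual metric $h^*$ is singular Griffiths semi-negative on $E^*$.
   Formalization: Values of h on Σ are disregarded, as they are arbitrary there (h_{j,s}=1, h=1 off 0, h(0)=2 breaks the literal claim): h is positive definite off Σ, and h* off Σ extends to a positive semidefinite form on E* whose squared norms of local holomorphic sections are plurisubharmonic. *)

theory Defs
  imports "HOL-Analysis.Analysis"
begin

section \<open>Functions of several complex variables\<close>

text \<open>Holomorphy on a set that is meant to be open: complex differentiability at every point.\<close>

definition hol_map :: "(complex^'n) set \<Rightarrow> (complex^'n \<Rightarrow> complex^'k) \<Rightarrow> bool" where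
  "hol_map S f \<longleftrightarrow>
     (\<forall>z\<in>S. \<exists>D. (f has_derivative D) (at z) \<and> (\<forall>c v. D (c *s v) = c *s D v))"

text \<open>Real differentiability of class $C^k$ on an open set.\<close>

fun Ck_on :: "nat \<Rightarrow> 'a::real_normed_vector set \<Rightarrow> ('a \<Rightarrow> 'b::real_normed_vector) \<Rightarrow> bool" where
  "Ck_on 0 S f \<longleftrightarrow> continuous_on S f"
| "Ck_on (Suc k) S f \<longleftrightarrow> (\<forall>z\<in>S. f differentiable (at z)) \<and>
     (\<forall>v. Ck_on k S (\<lambda>z. frechet_derivative f (at z) v))"

text \<open>The Wirtinger derivatives with respect to $z_j$ and $\bar z_j$.\<close>

definition d_z :: "'n \<Rightarrow> (complex^'n \<Rightarrow> complex) \<Rightarrow> complex^'n \<Rightarrow> complex" where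
  "d_z j f z = (frechet_derivative f (at z) (axis j 1)
                - \<i> * frechet_derivative f (at z) (axis j \<i>)) / 2"

definition d_zbar :: "'n \<Rightarrow> (complex^'n \<Rightarrow> complex) \<Rightarrow> complex^'n \<Rightarrow> complex" where
  "d_zbar j f z = (frechet_derivative f (at z) (axis j 1)
                + \<i> * frechet_derivative f (at z) (axis j \<i>)) / 2"

text \<open>
  Real-valued plurisubharmonic functions on an open set: upper semicontinuous, with the sub-mean
  value property on closed complex discs.  The value $-\infty$ is not needed, as only squared norms
  occur; a finite value at the centre forces integrability over the circle, which is required
  explicitly because the integral of a non-integrable function is 0.
\<close>

definition psh_on :: "(complex^'n) set \<Rightarrow> (complex^'n \<Rightarrow> real) \<Rightarrow> bool" where
  "psh_on S f \<longleftrightarrow>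
     (\<forall>c. openin (top_of_set S) {z \<in> S. f z < c}) \<and>
     (\<forall>z w. (\<forall>\<zeta>. cmod \<zeta> \<le> 1 \<longrightarrow> z + \<zeta> *s w \<in> S) \<longrightarrow>
        (\<lambda>t. f (z + cis t *s w)) absolutely_integrable_on {0..2*pi} \<and>
        f z \<le> integral {0..2*pi} (\<lambda>t. f (z + cis t *s w)) / (2*pi))"

section \<open>Complex manifolds\<close>

text \<open>
  A manifold is the whole of a (Hausdorff, second countable) type with a holomorphic atlas of
  charts (domain, coordinate map).
\<close>

type_synonym ('m, 'n) chart = "'m set \<times> ('m \<Rightarrow> complex^'n)"

definition complex_manifold ::
  "('m::{t2_space,second_countable_topology}, 'n::finite) chart set \<Rightarrow> bool" where
  "complex_manifold A \<longleftrightarrow>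
     (\<Union>(V, \<phi>)\<in>A. V) = UNIV \<and>
     (\<forall>(V, \<phi>)\<in>A. open V \<and> open (\<phi> ` V) \<and> homeomorphism V (\<phi> ` V) \<phi> (inv_into V \<phi>)) \<and>
     (\<forall>(V, \<phi>)\<in>A. \<forall>(V', \<phi>')\<in>A. hol_map (\<phi> ` (V \<inter> V')) (\<phi>' \<circ> inv_into V \<phi>))"

definition holomorphic_on_mfd ::
  "('m, 'n::finite) chart set \<Rightarrow> 'm set \<Rightarrow> ('m \<Rightarrow> complex^'k) \<Rightarrow> bool" where
  "holomorphic_on_mfd A U f \<longleftrightarrow>
     (\<forall>(V, \<phi>)\<in>A. hol_map (\<phi> ` (U \<inter> V)) (f \<circ> inv_into V \<phi>))"

definition Ck_on_mfd ::
  "nat \<Rightarrow> ('m, 'n::finite) chart set \<Rightarrow> 'm set \<Rightarrow> ('m \<Rightarrow> complex) \<Rightarrow> bool" where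
  "Ck_on_mfd k A U f \<longleftrightarrow>
     (\<forall>(V, \<phi>)\<in>A. Ck_on k (\<phi> ` (U \<inter> V)) (f \<circ> inv_into V \<phi>))"

definition psh_on_mfd :: "('m, 'n::finite) chart set \<Rightarrow> 'm set \<Rightarrow> ('m \<Rightarrow> real) \<Rightarrow> bool" where
  "psh_on_mfd A U f \<longleftrightarrow>
     (\<forall>(V, \<phi>)\<in>A. psh_on (\<phi> ` (U \<inter> V)) (f \<circ> inv_into V \<phi>))"

definition measurable_on_mfd ::
  "('m, 'n::finite) chart set \<Rightarrow> 'm set \<Rightarrow> ('m \<Rightarrow> complex) \<Rightarrow> bool" where
  "measurable_on_mfd A U f \<longleftrightarrow>
     (\<forall>(V, \<phi>)\<in>A. (f \<circ> inv_into V \<phi>) \<in> borel_measurable (lebesgue_on (\<phi> ` (U \<inter> V))))"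

definition measure_zero :: "('m, 'n::finite) chart set \<Rightarrow> 'm set \<Rightarrow> bool" where
  "measure_zero A N \<longleftrightarrow> (\<forall>(V, \<phi>)\<in>A. negligible (\<phi> ` (N \<inter> V)))"

section \<open>Holomorphic vector bundles\<close>

text \<open>
  A bundle is given by its total space (a subset of the type \<^typ>\<open>'e\<close>), the projection, the fibrewise
  vector space operations, and an atlas of local trivialisations.  A trivialisation (U, \<tau>)
  records the second component of $E|_U \to U \times \mathbb{C}^r$.  The topology and the complex
  structure of the total space are those determined by the trivialisations.
\<close>

record ('e, 'm, 'r) vbundle =
  total :: "'e set"
  proj :: "'e \<Rightarrow> 'm"
  vadd :: "'e \<Rightarrow> 'e \<Rightarrow> 'e"
  vscale :: "complex \<Rightarrow> 'e \<Rightarrow> 'e"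
  trivs :: "('m set \<times> ('e \<Rightarrow> complex^'r)) set"

definition fibre :: "('e, 'm, 'r::finite) vbundle \<Rightarrow> 'm \<Rightarrow> 'e set" where
  "fibre E x = {e \<in> total E. proj E e = x}"

definition holomorphic_vector_bundle ::
  "('m::topological_space, 'n::finite) chart set \<Rightarrow> ('e, 'm, 'r::finite) vbundle \<Rightarrow> bool" where
  "holomorphic_vector_bundle A E \<longleftrightarrow>
     (\<Union>(U, \<tau>)\<in>trivs E. U) = UNIV \<and>
     (\<forall>(U, \<tau>)\<in>trivs E. open U \<and>
        (\<forall>x\<in>U. bij_betw \<tau> (fibre E x) UNIV \<and>
          (\<forall>e\<in>fibre E x. \<forall>f\<in>fibre E x.
             vadd E e f \<in> fibre E x \<and> \<tau> (vadd E e f) = \<tau> e + \<tau> f) \<and>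
          (\<forall>c. \<forall>e\<in>fibre E x.
             vscale E c e \<in> fibre E x \<and> \<tau> (vscale E c e) = c *s \<tau> e))) \<and>
     (\<forall>(U, \<tau>)\<in>trivs E. \<forall>(U', \<tau>')\<in>trivs E. \<forall>v.
        holomorphic_on_mfd A (U \<inter> U') (\<lambda>x. \<tau>' (inv_into (fibre E x) \<tau> v)))"

definition holomorphic_section ::
  "('m, 'n::finite) chart set \<Rightarrow> ('e, 'm, 'r::finite) vbundle \<Rightarrow> 'm set \<Rightarrow> ('m \<Rightarrow> 'e) \<Rightarrow> bool" where
  "holomorphic_section A E U u \<longleftrightarrow>
     (\<forall>x\<in>U. u x \<in> fibre E x) \<and>
     (\<forall>(W, \<tau>)\<in>trivs E. holomorphic_on_mfd A (U \<inter> W) (\<tau> \<circ> u))"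

text \<open>The holomorphic frame attached to a local trivialisation.\<close>

definition frame ::
  "('e, 'm, 'r::finite) vbundle \<Rightarrow> ('e \<Rightarrow> complex^'r) \<Rightarrow> 'm \<Rightarrow> 'r \<Rightarrow> 'e" where
  "frame E \<tau> x a = inv_into (fibre E x) \<tau> (axis a 1)"

text \<open>
  The dual bundle: a point over x is a pair of x and a linear functional on the fibre over x.
  Its trivialisations list the values of the functional on the frame, i.e. the dual frames.
\<close>

definition dual_bundle ::
  "('e, 'm, 'r::finite) vbundle \<Rightarrow> ('m \<times> ('e \<Rightarrow> complex), 'm, 'r) vbundle" where
  "dual_bundle E =
     \<lparr> total = {(x, \<xi>). \<xi> \<in> extensional (fibre E x) \<and>
          (\<forall>e\<in>fibre E x. \<forall>f\<in>fibre E x. \<xi> (vadd E e f) = \<xi> e + \<xi> f) \<and>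
          (\<forall>c. \<forall>e\<in>fibre E x. \<xi> (vscale E c e) = c * \<xi> e)},
       proj = fst,
       vadd = (\<lambda>(x, \<xi>) (y, \<eta>). (x, restrict (\<lambda>e. \<xi> e + \<eta> e) (fibre E x))),
       vscale = (\<lambda>c (x, \<xi>). (x, restrict (\<lambda>e. c * \<xi> e) (fibre E x))),
       trivs = (\<lambda>(U, \<tau>). (U, \<lambda>(x, \<xi>). \<chi> a. \<xi> (frame E \<tau> x a))) ` trivs E \<rparr>"

text \<open>
  The holomorphic tangent bundle: a tangent vector at x is its family of components in all the
  charts around x (and 0 in the other charts), related by the Jacobians of the coordinate changes.
  In the trivialisation attached to a chart the frame is $\partial/\partial z_j$.
\<close>

definition chart_triv ::
  "('m, 'n::finite) chart \<Rightarrow> 'm \<times> (('m, 'n) chart \<Rightarrow> complex^'n) \<Rightarrow> complex^'n" where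
  "chart_triv c p = snd p c"

definition tangent_bundle ::
  "('m, 'n::finite) chart set \<Rightarrow>
     ('m \<times> (('m, 'n) chart \<Rightarrow> complex^'n), 'm, 'n) vbundle" where
  "tangent_bundle A =
     \<lparr> total = {(x, v).
          (\<forall>c. c \<notin> A \<or> x \<notin> fst c \<longrightarrow> v c = 0) \<and>
          (\<forall>c\<in>A. \<forall>c'\<in>A. x \<in> fst c \<inter> fst c' \<longrightarrow>
             v c' = frechet_derivative (snd c' \<circ> inv_into (fst c) (snd c)) (at (snd c x)) (v c))},
       proj = fst,
       vadd = (\<lambda>(x, v) (y, w). (x, \<lambda>c. v c + w c)),
       vscale = (\<lambda>a (x, v). (x, \<lambda>c. a *s v c)),
       trivs = (\<lambda>c. (fst c, chart_triv c)) ` A \<rparr>"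

section \<open>Hermitian forms and metrics\<close>

text \<open>
  A section h of $E^* \otimes \bar E^*$ is a function of two points of the same fibre, linear in
  the first and antilinear in the second.
\<close>

definition sesquilinear_at ::
  "('e, 'm, 'r::finite) vbundle \<Rightarrow> 'm \<Rightarrow> ('e \<Rightarrow> 'e \<Rightarrow> complex) \<Rightarrow> bool" where
  "sesquilinear_at E x h \<longleftrightarrow>
     (\<forall>e\<in>fibre E x. \<forall>f\<in>fibre E x. \<forall>g\<in>fibre E x.
        h (vadd E e f) g = h e g + h f g \<and> h g (vadd E e f) = h g e + h g f) \<and>
     (\<forall>c. \<forall>e\<in>fibre E x. \<forall>f\<in>fibre E x.
        h (vscale E c e) f = c * h e f \<and> h e (vscale E c f) = cnj c * h e f)"

definition hermitian_at ::
  "('e, 'm, 'r::finite) vbundle \<Rightarrow> 'm \<Rightarrow> ('e \<Rightarrow> 'e \<Rightarrow> complex) \<Rightarrow> bool" where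
  "hermitian_at E x h \<longleftrightarrow>
     sesquilinear_at E x h \<and> (\<forall>e\<in>fibre E x. \<forall>f\<in>fibre E x. h f e = cnj (h e f))"

definition pos_semidef_at ::
  "('e, 'm, 'r::finite) vbundle \<Rightarrow> 'm \<Rightarrow> ('e \<Rightarrow> 'e \<Rightarrow> complex) \<Rightarrow> bool" where
  "pos_semidef_at E x h \<longleftrightarrow> hermitian_at E x h \<and> (\<forall>e\<in>fibre E x. 0 \<le> Re (h e e))"

definition pos_def_at ::
  "('e, 'm, 'r::finite) vbundle \<Rightarrow> 'm \<Rightarrow> ('e \<Rightarrow> 'e \<Rightarrow> complex) \<Rightarrow> bool" where
  "pos_def_at E x h \<longleftrightarrow>
     hermitian_at E x h \<and> (\<forall>e\<in>fibre E x. e \<noteq> vscale E 0 e \<longrightarrow> 0 < Re (h e e))"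

definition hnorm :: "('e \<Rightarrow> 'e \<Rightarrow> complex) \<Rightarrow> 'e \<Rightarrow> real" where
  "hnorm h e = sqrt (Re (h e e))"

definition gram ::
  "('e, 'm, 'r::finite) vbundle \<Rightarrow> ('e \<Rightarrow> 'e \<Rightarrow> complex) \<Rightarrow> ('e \<Rightarrow> complex^'r) \<Rightarrow> 'm \<Rightarrow> complex^'r^'r"
where
  "gram E h \<tau> x = (\<chi> a b. h (frame E \<tau> x a) (frame E \<tau> x b))"

definition measurable_metric ::
  "('m, 'n::finite) chart set \<Rightarrow> ('e, 'm, 'r::finite) vbundle \<Rightarrow> ('e \<Rightarrow> 'e \<Rightarrow> complex) \<Rightarrow> bool" where
  "measurable_metric A E h \<longleftrightarrow>
     (\<forall>x. sesquilinear_at E x h) \<and>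
     (\<forall>(U, \<tau>)\<in>trivs E. \<forall>a b. measurable_on_mfd A U (\<lambda>x. gram E h \<tau> x $ a $ b)) \<and>
     measure_zero A {x. \<not> pos_def_at E x h}"

text \<open>Hermitian metrics of class $C^k$ on the restriction of E to an open set S.\<close>

definition Ck_metric ::
  "nat \<Rightarrow> ('m, 'n::finite) chart set \<Rightarrow> ('e, 'm, 'r::finite) vbundle \<Rightarrow> 'm set \<Rightarrow>
     ('e \<Rightarrow> 'e \<Rightarrow> complex) \<Rightarrow> bool" where
  "Ck_metric k A E S h \<longleftrightarrow>
     (\<forall>x\<in>S. pos_def_at E x h) \<and>
     (\<forall>(U, \<tau>)\<in>trivs E. \<forall>a b. Ck_on_mfd k A (S \<inter> U) (\<lambda>x. gram E h \<tau> x $ a $ b))"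

definition hermitian_metric_on_manifold ::
  "('m, 'n::finite) chart set \<Rightarrow>
     ('m \<times> (('m, 'n) chart \<Rightarrow> complex^'n) \<Rightarrow> 'm \<times> (('m, 'n) chart \<Rightarrow> complex^'n) \<Rightarrow> complex) \<Rightarrow> bool"
where
  "hermitian_metric_on_manifold A \<omega> \<longleftrightarrow> (\<forall>k. Ck_metric k A (tangent_bundle A) UNIV \<omega>)"

text \<open>
  The dual metric: if $\xi = h(\cdot, e)$ and $\eta = h(\cdot, f)$ then $h^*(\xi,\eta) = h(f, e)$.
  It is meaningful at the points where h is positive definite.
\<close>

definition riesz ::
  "('e, 'm, 'r::finite) vbundle \<Rightarrow> ('e \<Rightarrow> 'e \<Rightarrow> complex) \<Rightarrow> 'm \<times> ('e \<Rightarrow> complex) \<Rightarrow> 'e" where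
  "riesz E h p = (THE e. e \<in> fibre E (fst p) \<and> (\<forall>f\<in>fibre E (fst p). snd p f = h f e))"

definition dual_metric ::
  "('e, 'm, 'r::finite) vbundle \<Rightarrow> ('e \<Rightarrow> 'e \<Rightarrow> complex) \<Rightarrow>
     'm \<times> ('e \<Rightarrow> complex) \<Rightarrow> 'm \<times> ('e \<Rightarrow> complex) \<Rightarrow> complex" where
  "dual_metric E h p q = h (riesz E h q) (riesz E h p)"

section \<open>Chern curvature and Nakano positivity\<close>

text \<open>
  For the Gram matrix $H_{ab} = h(e_a, e_b)$ of a holomorphic frame, the Chern connection is
  $D' e_a = \sum_{j,c} (\partial_j H\, H^{-1})_{ac}\, dz_j \otimes e_c$ and its curvature is
  $\Theta = \bar\partial(\partial H\, H^{-1})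
    = \sum_{j,k} -\partial_{\bar k}(\partial_j H\, H^{-1})\, dz_j \wedge d\bar z_k$.
\<close>

definition chern_connection ::
  "(complex^'n \<Rightarrow> complex^'r^'r) \<Rightarrow> 'n \<Rightarrow> complex^'n \<Rightarrow> complex^'r^'r" where
  "chern_connection H j z = (\<chi> a b. d_z j (\<lambda>w. H w $ a $ b) z) ** matrix_inv (H z)"

definition chern_curvature ::
  "(complex^'n \<Rightarrow> complex^'r^'r) \<Rightarrow> 'n \<Rightarrow> 'n \<Rightarrow> complex^'n \<Rightarrow> complex^'r^'r" where
  "chern_curvature H j k z = (\<chi> a b. - d_zbar k (\<lambda>w. chern_connection H j w $ a $ b) z)"

text \<open>
  The inequality $\Theta_h(E) \ge_{Nak} \mu\, \omega \otimes Id_E$ on S, as an inequality between the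
  values of the two hermitian forms on $t = \sum_{j,a} t_{ja}\, \partial/\partial z_j \otimes e_a$.
  The form of $\Theta_h(E)$ has coefficients $h(\Theta_{jk} e_a, e_b) = (\Theta_{jk} H)_{ab}$.
\<close>

definition nakano_ge ::
  "('m, 'n::finite) chart set \<Rightarrow> ('e, 'm, 'r::finite) vbundle \<Rightarrow> 'm set \<Rightarrow>
     ('e \<Rightarrow> 'e \<Rightarrow> complex) \<Rightarrow> ('m \<Rightarrow> real) \<Rightarrow>
     ('m \<times> (('m, 'n) chart \<Rightarrow> complex^'n) \<Rightarrow> 'm \<times> (('m, 'n) chart \<Rightarrow> complex^'n) \<Rightarrow> complex) \<Rightarrow> bool"
where
  "nakano_ge A E S h \<mu> \<omega> \<longleftrightarrow>
     (\<forall>(V, \<phi>)\<in>A. \<forall>(U, \<tau>)\<in>trivs E. \<forall>x\<in>S \<inter> U \<inter> V. \<forall>t :: complex^'r^'n.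
        let H = gram E h \<tau> \<circ> inv_into V \<phi>;
            W = gram (tangent_bundle A) \<omega> (chart_triv (V, \<phi>)) x
        in Re (\<Sum>j\<in>UNIV. \<Sum>k\<in>UNIV. \<Sum>a\<in>UNIV. \<Sum>b\<in>UNIV.
                 (chern_curvature H j k (\<phi> x) ** H (\<phi> x)) $ a $ b * t $ j $ a * cnj (t $ k $ b))
           \<ge> \<mu> x * Re (\<Sum>j\<in>UNIV. \<Sum>k\<in>UNIV. \<Sum>a\<in>UNIV. \<Sum>b\<in>UNIV.
                 W $ j $ k * H (\<phi> x) $ a $ b * t $ j $ a * cnj (t $ k $ b)))"

section \<open>Singular hermitian metrics\<close>

text \<open>
  The sequences are indexed from 0.  $M_j \Subset M_{j+1}$ is read as: open, with compact closure
  contained in $M_{j+1}$.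
\<close>

definition singular_hermitian_metric ::
  "('m::{t2_space,second_countable_topology}, 'n::finite) chart set \<Rightarrow>
     ('e, 'm, 'r::finite) vbundle \<Rightarrow> 'm set \<Rightarrow> (nat \<Rightarrow> 'm set) \<Rightarrow>
     ('e \<Rightarrow> 'e \<Rightarrow> complex) \<Rightarrow> (nat \<Rightarrow> nat \<Rightarrow> 'e \<Rightarrow> 'e \<Rightarrow> complex) \<Rightarrow> bool" where
  "singular_hermitian_metric A E S Mj h hs \<longleftrightarrow>
     measurable_metric A E h \<and>
     closed S \<and> measure_zero A S \<and>
     (\<forall>j. open (Mj j) \<and> compact (closure (Mj j)) \<and> closure (Mj j) \<subseteq> Mj (Suc j)) \<and>
     (\<Union>j. Mj j) = UNIV \<and>
     (\<forall>j s. Ck_metric 2 A E (Mj j) (hs j s)) \<and>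
     (\<forall>j. \<forall>x\<in>Mj j - S. \<forall>e\<in>fibre E x. \<forall>f\<in>fibre E x. (\<lambda>s. hs j s e f) \<longlonglongrightarrow> h e f)"

definition singular_nakano_semipositive ::
  "('m::{t2_space,second_countable_topology}, 'n::finite) chart set \<Rightarrow>
     ('e, 'm, 'r::finite) vbundle \<Rightarrow> (nat \<Rightarrow> 'm set) \<Rightarrow>
     (nat \<Rightarrow> nat \<Rightarrow> 'e \<Rightarrow> 'e \<Rightarrow> complex) \<Rightarrow>
     ('m \<times> (('m, 'n) chart \<Rightarrow> complex^'n) \<Rightarrow> 'm \<times> (('m, 'n) chart \<Rightarrow> complex^'n) \<Rightarrow> complex) \<Rightarrow> bool"
where
  "singular_nakano_semipositive A E Mj hs \<omega> \<longleftrightarrow>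
     (\<forall>j. \<exists>(ls :: nat \<Rightarrow> 'm \<Rightarrow> real) (l :: 'm \<Rightarrow> real).
        (\<forall>s. continuous_on (closure (Mj j)) (ls s)) \<and> continuous_on (closure (Mj j)) l \<and>
        (\<forall>x\<in>Mj j. \<forall>s. \<forall>e\<in>fibre E x. hnorm (hs j s) e \<le> hnorm (hs j (Suc s)) e) \<and>
        (\<forall>s. nakano_ge A E (Mj j) (hs j s) (\<lambda>x. - ls s x) \<omega>) \<and>
        measure_zero A {x \<in> Mj j. \<not> (\<lambda>s. ls s x) \<longlonglongrightarrow> 0} \<and>
        (\<forall>x\<in>Mj j. \<forall>s. 0 \<le> ls s x \<and> ls s x \<le> l x))"

section \<open>Griffiths semi-positivity\<close>

definition singular_griffiths_seminegative ::
  "('m::topological_space, 'n::finite) chart set \<Rightarrow> ('e, 'm, 'r::finite) vbundle \<Rightarrow>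
     ('e \<Rightarrow> 'e \<Rightarrow> complex) \<Rightarrow> bool" where
  "singular_griffiths_seminegative A E h \<longleftrightarrow>
     (\<forall>U u. open U \<longrightarrow> holomorphic_section A E U u \<longrightarrow> psh_on_mfd A U (\<lambda>x. (hnorm h (u x))\<^sup>2))"

definition griffiths_semipositive ::
  "('m::topological_space, 'n::finite) chart set \<Rightarrow> ('e, 'm, 'r::finite) vbundle \<Rightarrow>
     ('e \<Rightarrow> 'e \<Rightarrow> complex) \<Rightarrow> bool" where
  "griffiths_semipositive A E h \<longleftrightarrow>
     measurable_metric A E h \<and> (\<forall>x. pos_def_at E x h) \<and>
     singular_griffiths_seminegative A (dual_bundle E) (dual_metric E h)"

text \<open>
  For a singular hermitian metric the values of h on the null set S are not constrained by the
  data (changing h on S arbitrarily gives another singular hermitian metric with the same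
  approximating metrics, and h may have to be infinite there, as for $|z|^{-2}$), whereas
  plurisubharmonicity is sensitive to every single value.  The notion is therefore applied to h with
  its values on the exceptional null set N disregarded: h is positive definite off N, and $h^*$,
  given off N, is completed on N by positive semidefinite hermitian forms to an everywhere defined
  form g on $E^*$ such that $|u|^2_g$ is plurisubharmonic for every local holomorphic section u.
\<close>

definition griffiths_semipositive_off ::
  "('m::topological_space, 'n::finite) chart set \<Rightarrow> ('e, 'm, 'r::finite) vbundle \<Rightarrow> 'm set \<Rightarrow>
     ('e \<Rightarrow> 'e \<Rightarrow> complex) \<Rightarrow> bool" where
  "griffiths_semipositive_off A E N h \<longleftrightarrow>
     measure_zero A N \<and> measurable_metric A E h \<and> (\<forall>x. x \<notin> N \<longrightarrow> pos_def_at E x h) \<and>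
     (\<exists>g. (\<forall>x. pos_semidef_at (dual_bundle E) x g) \<and>
          (\<forall>x. x \<notin> N \<longrightarrow> (\<forall>p\<in>fibre (dual_bundle E) x. \<forall>q\<in>fibre (dual_bundle E) x.
              g p q = dual_metric E h p q)) \<and>
          singular_griffiths_seminegative A (dual_bundle E) g)"

lemma psh_on_cong_imp:
  assumes eq: "\<And>z. z \<in> S \<Longrightarrow> f z = g z" and f: "psh_on S f"
  shows "psh_on S g"
  unfolding psh_on_def
proof (intro conjI allI impI)
  fix c
  have "{z \<in> S. g z < c} = {z \<in> S. f z < c}"
    using eq by auto
  then show "openin (top_of_set S) {z \<in> S. g z < c}"
    using f unfolding psh_on_def by simp
next
  fix z w
  assume disc: "\<forall>\<zeta>. cmod \<zeta> \<le> 1 \<longrightarrow> z + \<zeta> *s w \<in> S"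
  have circ: "(\<lambda>t. f (z + cis t *s w)) = (\<lambda>t. g (z + cis t *s w))"
    by (rule ext, rule eq) (use disc norm_cis in auto)
  have "z \<in> S"
    using disc[rule_format, of 0] by simp
  then have "f z = g z" by (rule eq)
  moreover have "(\<lambda>t. f (z + cis t *s w)) absolutely_integrable_on {0..2*pi} \<and>
      f z \<le> integral {0..2*pi} (\<lambda>t. f (z + cis t *s w)) / (2*pi)"
    using f disc unfolding psh_on_def by blast
  ultimately show "(\<lambda>t. g (z + cis t *s w)) absolutely_integrable_on {0..2*pi}"
    and "g z \<le> integral {0..2*pi} (\<lambda>t. g (z + cis t *s w)) / (2*pi)"
    unfolding circ by auto
qed

lemma psh_on_mfd_cong:
  assumes eq: "\<And>x. x \<in> U \<Longrightarrow> f x = g x"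
    and inj: "\<And>V \<phi>. (V, \<phi>) \<in> A \<Longrightarrow> inj_on \<phi> V"
    and f: "psh_on_mfd A U f"
  shows "psh_on_mfd A U g"
  unfolding psh_on_mfd_def
proof (clarify)
  fix V \<phi>
  assume c: "(V, \<phi>) \<in> A"
  have "(f \<circ> inv_into V \<phi>) z = (g \<circ> inv_into V \<phi>) z" if "z \<in> \<phi> ` (U \<inter> V)" for z
    using that eq inj[OF c] by (auto simp: inv_into_f_f)
  moreover have "psh_on (\<phi> ` (U \<inter> V)) (f \<circ> inv_into V \<phi>)"
    using f c unfolding psh_on_mfd_def by blast
  ultimately show "psh_on (\<phi> ` (U \<inter> V)) (g \<circ> inv_into V \<phi>)"
    by (rule psh_on_cong_imp)
qed

text \<open>With an empty exceptional set nothing is disregarded.\<close>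

lemma griffiths_semipositive_off_empty:
  assumes "complex_manifold A" and "griffiths_semipositive_off A E {} h"
  shows "griffiths_semipositive A E h"
proof -
  obtain g where g: "\<forall>x. x \<notin> {} \<longrightarrow> (\<forall>p\<in>fibre (dual_bundle E) x. \<forall>q\<in>fibre (dual_bundle E) x.
        g p q = dual_metric E h p q)"
    and neg: "singular_griffiths_seminegative A (dual_bundle E) g"
    using assms(2) unfolding griffiths_semipositive_off_def by blast
  have inj: "inj_on \<phi> V" if "(V, \<phi>) \<in> A" for V \<phi>
  proof -
    have "\<forall>(V, \<phi>)\<in>A. open V \<and> open (\<phi> ` V) \<and> homeomorphism V (\<phi> ` V) \<phi> (inv_into V \<phi>)"
      using assms(1) unfolding complex_manifold_def by (elim conjE)
    from bspec[OF this that] have "homeomorphism V (\<phi> ` V) \<phi> (inv_into V \<phi>)"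
      by simp
    then show ?thesis
      by (intro inj_on_inverseI) (rule homeomorphism_apply1)
  qed
  have "psh_on_mfd A U (\<lambda>x. (hnorm (dual_metric E h) (u x))\<^sup>2)"
    if "open U" "holomorphic_section A (dual_bundle E) U u" for U u
  proof -
    note sec = that
    have eq: "(hnorm g (u x))\<^sup>2 = (hnorm (dual_metric E h) (u x))\<^sup>2" if "x \<in> U" for x
    proof -
      have "u x \<in> fibre (dual_bundle E) x"
        using sec(2) that
        unfolding holomorphic_section_def by blast
      then have "g (u x) (u x) = dual_metric E h (u x) (u x)"
        using g by blast
      then show ?thesis by (simp add: hnorm_def)
    qed
    have "psh_on_mfd A U (\<lambda>x. (hnorm g (u x))\<^sup>2)"
      using neg sec unfolding singular_griffiths_seminegative_def by blast
    with eq inj show ?thesis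
      by (rule psh_on_mfd_cong)
  qed
  then have "singular_griffiths_seminegative A (dual_bundle E) (dual_metric E h)"
    unfolding singular_griffiths_seminegative_def by simp
  moreover have "measurable_metric A E h" "\<forall>x. pos_def_at E x h"
    using assms(2) unfolding griffiths_semipositive_off_def by simp_all
  ultimately show ?thesis
    unfolding griffiths_semipositive_def by simp
qed

end

theory Submission
  imports Defs "HOL-Complex_Analysis.Cauchy_Integral_Formula"
begin

text \<open>
  Why the theorem is true.  On $M_j$ the metrics $h_{j,s}$ increase with $s$, so the dual norms
  decrease and have a limit, which is a positive semidefinite form on $E^*$ at every point.  This
  limit is the completion of $h^*$: off the exceptional set $h_{j,s} \to h$ with $h$ positive
  definite, and inversion of matrices is continuous.  What has to be shown is that the limit of
  $|u|^2$ is plurisubharmonic for a holomorphic section $u$ of $E^*$, and that the limits obtained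
  on different $M_j$ agree at the points of the exceptional set as well.

  Curvature.  In a holomorphic frame let $H$ be the Gram matrix and $G = H^{-1}$; the squared dual
  norm of the section with coefficient column $u$ is $F = u^* G u$.  Along a complex line
  $\zeta \mapsto p + \zeta w$,
  $$F_{\zeta\bar\zeta} = |u' - H_\zeta G u|^2_G + (Gu)^* (\Theta_w H) (Gu),$$
  where $\Theta_w$ is the curvature contracted with $w$ and $\bar w$.  The last term is the
  curvature form at the decomposable tensor $w \otimes e$, $e$ having the coefficients
  $\overline{Gu}$, so it is at least $-\lambda_{j,s}\, \omega(w,w) F$
  (\<open>quad_inverse_laplacian\<close>, \<open>dual_norm_laplacian\<close>).

  Mean values.  A lower bound $-B\lambda$ for $F_{\zeta\bar\zeta}$ on the closed unit disc makes the
  sub-mean value inequality hold up to a multiple of the integral of $\lambda(re^{it})$ over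
  $[0,1] \times [0,2\pi]$ (\<open>disc_mean_inequality\<close>).  If $\lambda_{j,s} \to 0$ almost everywhere on
  the disc, that error tends to 0 by dominated convergence.  Convergence is known almost everywhere
  in $M$ only, but by Fubini a null set meets almost every disc through a given point in a null set.
  The remaining discs are reached by approximation, since the circle means of the continuous
  function $F_s$ depend continuously on the disc and dominate those of the limit
  (\<open>almost_all_lines_avoid_null_set\<close>, \<open>psh_on_decreasing_limit\<close>).

  Gluing.  A plurisubharmonic function is determined by its values off a null set
  (\<open>psh_on_le_off_null_set\<close>).  The limits belonging to $M_i$ and $M_j$ agree with $h^*$ off the
  exceptional set; applied to local sections through a given covector this shows that they agree
  everywhere on $M_i \cap M_j$.  As every compact disc lies in some $M_j$, plurisubharmonicity on
  all $M_j$ gives plurisubharmonicity on $M$.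
\<close>

section \<open>Wirtinger calculus in one variable\<close>

text \<open>
  The functions \<open>a\<close> and \<open>b\<close> are $f_\zeta$ and $f_{\bar\zeta}$.  They are arguments, so that a
  derivation of the predicate computes them; their continuity is included because differentiation
  under the integral sign will require it of second derivatives.
\<close>

definition wirtinger_on ::
  "complex set \<Rightarrow> (complex \<Rightarrow> complex) \<Rightarrow> (complex \<Rightarrow> complex) \<Rightarrow> (complex \<Rightarrow> complex) \<Rightarrow> bool" where
  "wirtinger_on D f a b \<longleftrightarrow>
     (\<forall>\<zeta>\<in>D. (f has_derivative (\<lambda>v. a \<zeta> * v + b \<zeta> * cnj v)) (at \<zeta>)) \<and>
     continuous_on D a \<and> continuous_on D b"

lemma wirtinger_on_derivative:
  "wirtinger_on D f a b \<Longrightarrow> \<zeta> \<in> D \<Longrightarrow> (f has_derivative (\<lambda>v. a \<zeta> * v + b \<zeta> * cnj v)) (at \<zeta>)"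
  by (simp add: wirtinger_on_def)

lemma wirtinger_on_continuous: "wirtinger_on D f a b \<Longrightarrow> continuous_on D f"
  unfolding wirtinger_on_def
  by (meson continuous_at_imp_continuous_on has_derivative_continuous)

lemma wirtinger_derivative_unique:
  assumes "\<And>v. a * v + b * cnj v = a' * v + b' * cnj v"
  shows "a = a'" "b = b'"
proof -
  have 1: "a + b = a' + b'" using assms[of 1] by simp
  have "\<i> * (a - b) = \<i> * (a' - b')" using assms[of \<i>] by (simp add: algebra_simps)
  then have 2: "a - b = a' - b'" by simp
  have "2 * a = 2 * a'" using arg_cong2[OF 1 2, of "(+)"] by (simp add: algebra_simps)
  then show "a = a'" by simp
  with 1 show "b = b'" by simp
qed

lemma wirtinger_on_unique:
  assumes "wirtinger_on D f a b" "wirtinger_on D' f' a' b'" "open D''" "D'' \<subseteq> D \<inter> D'"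
    and "\<And>\<zeta>. \<zeta> \<in> D'' \<Longrightarrow> f \<zeta> = f' \<zeta>" and "\<zeta> \<in> D''"
  shows "a \<zeta> = a' \<zeta>" "b \<zeta> = b' \<zeta>"
proof -
  have 1: "(f has_derivative (\<lambda>v. a \<zeta> * v + b \<zeta> * cnj v)) (at \<zeta>)"
    and 2: "(f' has_derivative (\<lambda>v. a' \<zeta> * v + b' \<zeta> * cnj v)) (at \<zeta>)"
    using assms by (auto simp: wirtinger_on_def)
  have "(f has_derivative (\<lambda>v. a' \<zeta> * v + b' \<zeta> * cnj v)) (at \<zeta>)"
    by (rule has_derivative_transform_within_open[OF 2 assms(3) assms(6)]) (use assms in auto)
  from has_derivative_unique[OF 1 this]
  have "\<And>v. a \<zeta> * v + b \<zeta> * cnj v = a' \<zeta> * v + b' \<zeta> * cnj v" by (rule fun_cong)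
  from wirtinger_derivative_unique[OF this] show "a \<zeta> = a' \<zeta>" "b \<zeta> = b' \<zeta>" by auto
qed

lemma wirtinger_on_const: "wirtinger_on D (\<lambda>_. c) (\<lambda>_. 0) (\<lambda>_. 0)"
  by (simp add: wirtinger_on_def)

lemma wirtinger_on_add:
  assumes "wirtinger_on D f a b" "wirtinger_on D g c d"
  shows "wirtinger_on D (\<lambda>\<zeta>. f \<zeta> + g \<zeta>) (\<lambda>\<zeta>. a \<zeta> + c \<zeta>) (\<lambda>\<zeta>. b \<zeta> + d \<zeta>)"
  using assms unfolding wirtinger_on_def
  by (auto intro!: continuous_intros derivative_eq_intros simp: algebra_simps)

lemma wirtinger_on_mult:
  assumes "wirtinger_on D f a b" "wirtinger_on D g c d"
  shows "wirtinger_on D (\<lambda>\<zeta>. f \<zeta> * g \<zeta>)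
    (\<lambda>\<zeta>. a \<zeta> * g \<zeta> + f \<zeta> * c \<zeta>) (\<lambda>\<zeta>. b \<zeta> * g \<zeta> + f \<zeta> * d \<zeta>)"
  using assms wirtinger_on_continuous[OF assms(1)] wirtinger_on_continuous[OF assms(2)]
  unfolding wirtinger_on_def
  by (auto intro!: continuous_intros derivative_eq_intros simp: algebra_simps)

lemma wirtinger_on_cmult:
  "wirtinger_on D f a b \<Longrightarrow> wirtinger_on D (\<lambda>\<zeta>. c * f \<zeta>) (\<lambda>\<zeta>. c * a \<zeta>) (\<lambda>\<zeta>. c * b \<zeta>)"
  using wirtinger_on_mult[OF wirtinger_on_const[of D c], of f a b] by simp

lemma wirtinger_on_sum:
  assumes "\<And>i. i \<in> I \<Longrightarrow> wirtinger_on D (f i) (a i) (b i)"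
  shows "wirtinger_on D (\<lambda>\<zeta>. \<Sum>i\<in>I. f i \<zeta>) (\<lambda>\<zeta>. \<Sum>i\<in>I. a i \<zeta>) (\<lambda>\<zeta>. \<Sum>i\<in>I. b i \<zeta>)"
  using assms
proof (induction I rule: infinite_finite_induct)
  case (insert x F)
  then show ?case using wirtinger_on_add[of D "f x" "a x" "b x"] by simp
qed (simp_all add: wirtinger_on_const)

lemma wirtinger_on_cnj:
  assumes "wirtinger_on D f a b"
  shows "wirtinger_on D (\<lambda>\<zeta>. cnj (f \<zeta>)) (\<lambda>\<zeta>. cnj (b \<zeta>)) (\<lambda>\<zeta>. cnj (a \<zeta>))"
  using assms unfolding wirtinger_on_def
  by (auto intro!: continuous_intros derivative_eq_intros has_derivative_cnj[THEN has_derivative_eq_rhs] simp: algebra_simps)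

lemma wirtinger_on_holomorphic:
  assumes "f holomorphic_on D" "open D"
  shows "wirtinger_on D f (deriv f) (\<lambda>_. 0)"
  unfolding wirtinger_on_def
proof (intro conjI ballI)
  fix \<zeta> assume "\<zeta> \<in> D"
  then have "(f has_field_derivative deriv f \<zeta>) (at \<zeta>)"
    using assms holomorphic_derivI by blast
  then show "(f has_derivative (\<lambda>v. deriv f \<zeta> * v + 0 * cnj v)) (at \<zeta>)"
    by (simp add: has_field_derivative_def)
qed (use assms holomorphic_deriv holomorphic_on_imp_continuous_on in auto)

definition mat_wirtinger_on ::
  "complex set \<Rightarrow> (complex \<Rightarrow> complex^'m^'n) \<Rightarrow> (complex \<Rightarrow> complex^'m^'n) \<Rightarrow> (complex \<Rightarrow> complex^'m^'n) \<Rightarrow> bool"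
where
  "mat_wirtinger_on D M A B \<longleftrightarrow>
     (\<forall>i j. wirtinger_on D (\<lambda>\<zeta>. M \<zeta> $ i $ j) (\<lambda>\<zeta>. A \<zeta> $ i $ j) (\<lambda>\<zeta>. B \<zeta> $ i $ j))"

text \<open>
  The conjugate transpose (not the adjugate).
\<close>

definition adj :: "complex^'m^'n \<Rightarrow> complex^'n^'m" where
  "adj M = (\<chi> i j. cnj (M $ j $ i))"

lemma mat_wirtinger_on_add:
  "mat_wirtinger_on D M A B \<Longrightarrow> mat_wirtinger_on D N P Q \<Longrightarrow>
   mat_wirtinger_on D (\<lambda>\<zeta>. M \<zeta> + N \<zeta>) (\<lambda>\<zeta>. A \<zeta> + P \<zeta>) (\<lambda>\<zeta>. B \<zeta> + Q \<zeta>)"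
  unfolding mat_wirtinger_on_def by (simp add: wirtinger_on_add)

lemma mat_wirtinger_on_minus:
  assumes "mat_wirtinger_on D M A B"
  shows "mat_wirtinger_on D (\<lambda>\<zeta>. - M \<zeta>) (\<lambda>\<zeta>. - A \<zeta>) (\<lambda>\<zeta>. - B \<zeta>)"
  using assms wirtinger_on_cmult[of D _ _ _ "-1"] unfolding mat_wirtinger_on_def by simp

lemma mat_wirtinger_on_mult:
  fixes M :: "complex \<Rightarrow> complex^'m^'n" and N :: "complex \<Rightarrow> complex^'p^'m"
  assumes "mat_wirtinger_on D M A B" "mat_wirtinger_on D N P Q"
  shows "mat_wirtinger_on D (\<lambda>\<zeta>. M \<zeta> ** N \<zeta>)
    (\<lambda>\<zeta>. A \<zeta> ** N \<zeta> + M \<zeta> ** P \<zeta>) (\<lambda>\<zeta>. B \<zeta> ** N \<zeta> + M \<zeta> ** Q \<zeta>)"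
  unfolding mat_wirtinger_on_def matrix_matrix_mult_def vector_add_component vec_lambda_beta
    sum.distrib[symmetric]
  by (intro allI wirtinger_on_sum wirtinger_on_mult)
     (use assms in \<open>auto simp: mat_wirtinger_on_def\<close>)

lemma mat_wirtinger_on_adj:
  "mat_wirtinger_on D M A B \<Longrightarrow>
   mat_wirtinger_on D (\<lambda>\<zeta>. adj (M \<zeta>)) (\<lambda>\<zeta>. adj (B \<zeta>)) (\<lambda>\<zeta>. adj (A \<zeta>))"
  unfolding mat_wirtinger_on_def adj_def by (simp add: wirtinger_on_cnj)

lemma matrix_inv_both:
  fixes A :: "complex^'r^'r"
  assumes "invertible A"
  shows "A ** matrix_inv A = mat 1" "matrix_inv A ** A = mat 1"
  using assms unfolding invertible_def matrix_inv_def
  by (metis (mono_tags, lifting) someI_ex)+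

text \<open>
  Cramer's rule, used to see that inversion is differentiable: near an invertible matrix the entries
  of the inverse are quotients of polynomials in the entries.
\<close>

lemma matrix_inv_entry:
  fixes A :: "complex^'r^'r"
  assumes "invertible A"
  shows "matrix_inv A $ a $ b = det (\<chi> i j. if j = a then axis b 1 $ i else A $ i $ j) / det A"
proof -
  have d: "det A \<noteq> 0" using assms invertible_det_nz by blast
  have "A *v (matrix_inv A *v axis b 1) = axis b 1"
    by (simp add: matrix_vector_mul_assoc matrix_inv_both(1)[OF assms])
  with cramer[OF d] have
    "matrix_inv A *v axis b 1 = (\<chi> k. det (\<chi> i j. if j = k then axis b 1 $ i else A $ i $ j) / det A)"
    by blast
  then have "(matrix_inv A *v axis b 1) $ a
      = det (\<chi> i j. if j = a then axis b 1 $ i else A $ i $ j) / det A" by simp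
  moreover have "(matrix_inv A *v axis b 1) $ a = matrix_inv A $ a $ b"
    by (simp add: matrix_vector_mult_def axis_def if_distrib cong: if_cong)
  ultimately show ?thesis by simp
qed

lemma differentiable_matrix_entry:
  "(\<lambda>A::complex^'m^'n. A $ i $ j) differentiable (at A0)"
proof -
  have "bounded_linear (\<lambda>A::complex^'m^'n. A $ i $ j)"
    by (intro bounded_linear_compose[OF bounded_linear_vec_nth] bounded_linear_vec_nth)
  then show ?thesis by (rule bounded_linear_imp_differentiable)
qed

lemma differentiable_prod:
  fixes f :: "'i \<Rightarrow> 'a::real_normed_vector \<Rightarrow> complex"
  assumes "\<And>i. i \<in> I \<Longrightarrow> f i differentiable (at x0)"
  shows "(\<lambda>x. \<Prod>i\<in>I. f i x) differentiable (at x0)"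
  using assms by (induction I rule: infinite_finite_induct) (auto intro!: differentiable_mult)

lemma differentiable_det:
  fixes M :: "'a::real_normed_vector \<Rightarrow> complex^'n^'n"
  assumes "\<And>i j. (\<lambda>x. M x $ i $ j) differentiable (at x0)"
  shows "(\<lambda>x. det (M x)) differentiable (at x0)"
  unfolding det_def
  by (intro differentiable_sum differentiable_mult differentiable_prod assms ballI) (auto simp: finite_permutations)

lemma eventually_invertible:
  fixes A :: "complex^'r^'r"
  assumes "invertible A"
  shows "\<forall>\<^sub>F B in nhds A. invertible B"
proof -
  have "isCont (\<lambda>B::complex^'r^'r. det B) A"
    by (intro differentiable_imp_continuous_within differentiable_det differentiable_matrix_entry)
  moreover have "det A \<noteq> 0" using assms invertible_det_nz by blast
  ultimately have "\<forall>\<^sub>F B in at A. det B \<noteq> 0"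
    by (metis isCont_def tendsto_imp_eventually_ne)
  with \<open>det A \<noteq> 0\<close> have "\<forall>\<^sub>F B in nhds A. det B \<noteq> 0"
    by (simp add: eventually_nhds_conv_at)
  then show ?thesis by (simp add: invertible_det_nz)
qed

lemma differentiable_matrix_inv_entry:
  fixes A0 :: "complex^'r^'r"
  assumes "invertible A0"
  shows "(\<lambda>A. matrix_inv A $ a $ b) differentiable (at A0)"
proof -
  let ?f = "\<lambda>A::complex^'r^'r. det (\<chi> i j. if j = a then axis b 1 $ i else A $ i $ j) / det A"
  have d: "det A0 \<noteq> 0" using assms invertible_det_nz by blast
  have "(\<lambda>x::complex^'r^'r. (\<chi> i j. if j = a then axis b 1 $ i else x $ i $ j) $ i $ j)
          differentiable at A0" for i j
    by (cases "j = a") (auto intro: differentiable_matrix_entry)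
  then have "?f differentiable (at A0)"
    by (intro differentiable_divide differentiable_det differentiable_matrix_entry d)
  then obtain L where L: "(?f has_derivative L) (at A0)"
    by (auto simp: differentiable_def)
  have ev: "\<forall>\<^sub>F A in nhds A0. ?f A = matrix_inv A $ a $ b"
    using eventually_invertible[OF assms] by eventually_elim (simp add: matrix_inv_entry)
  have "((\<lambda>A. matrix_inv A $ a $ b) has_derivative L) (at A0)"
    by (rule has_derivative_transform_eventually[OF L])
       (use ev in \<open>auto simp: eventually_nhds_conv_at\<close>)
  then show ?thesis by (auto simp: differentiable_def)
qed

lemma differentiable_matrixI:
  fixes M :: "'a::euclidean_space \<Rightarrow> complex^'m^'n"
  assumes "\<And>i j. (\<lambda>x. M x $ i $ j) differentiable (at x0)"
  shows "M differentiable (at x0)"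
proof (subst differentiable_componentwise_within, intro ballI)
  fix b :: "complex^'m^'n" assume "b \<in> Basis"
  then obtain i j c where "b = axis i (axis j c)" by (auto simp: Basis_vec_def)
  then have eq: "(\<lambda>x. M x \<bullet> b) = (\<lambda>x. (M x $ i $ j) \<bullet> c)"
    by (simp add: inner_axis)
  obtain L where "((\<lambda>x. M x $ i $ j) has_derivative L) (at x0)"
    using assms[of i j] by (auto simp: differentiable_def)
  then show "(\<lambda>x. M x \<bullet> b) differentiable at x0"
    unfolding eq by (auto simp: differentiable_def intro!: has_derivative_inner_left exI)
qed

lemma differentiable_matrix_inv:
  fixes M :: "'a::euclidean_space \<Rightarrow> complex^'r^'r"
  assumes "\<And>i j. (\<lambda>x. M x $ i $ j) differentiable (at x0)" "invertible (M x0)"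
  shows "(\<lambda>x. matrix_inv (M x) $ a $ b) differentiable (at x0)"
  using differentiable_compose[OF differentiable_matrix_inv_entry[OF assms(2)] differentiable_matrixI[OF assms(1)]]
  by simp

lemma matrix_inv_mult_cancel:
  fixes A :: "complex^'r^'r" and X :: "complex^'p^'r"
  assumes "invertible A"
  shows "matrix_inv A ** (A ** X) = X" "A ** (matrix_inv A ** X) = X"
  using matrix_inv_both[OF assms] by (simp_all add: matrix_mul_assoc)

lemma matrix_minus_left: "(- A) ** B = - (A ** B)" for A :: "complex^'m^'n"
  by (simp add: matrix_matrix_mult_def vec_eq_iff sum_negf)

lemma matrix_minus_right: "A ** (- B) = - (A ** B)" for A :: "complex^'m^'n"
  by (simp add: matrix_matrix_mult_def vec_eq_iff sum_negf)

lemma continuous_on_mat_mult_entry: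
  assumes "\<And>i j. continuous_on D (\<lambda>\<zeta>. A \<zeta> $ i $ j)" "\<And>i j. continuous_on D (\<lambda>\<zeta>. B \<zeta> $ i $ j)"
  shows "continuous_on D (\<lambda>\<zeta>. ((A \<zeta> :: complex^'m^'n) ** B \<zeta>) $ i $ j)"
  unfolding matrix_matrix_mult_def vec_lambda_beta
  by (intro continuous_on_sum continuous_on_mult assms)

text \<open>
  Differentiability of the inverse comes from Cramer's rule; once it is known, the values
  $-G M_\zeta G$ and $-G M_{\bar\zeta} G$ of the derivatives are forced by $GM = 1$.
\<close>

lemma mat_wirtinger_on_inv:
  fixes M :: "complex \<Rightarrow> complex^'r^'r"
  assumes M: "mat_wirtinger_on D M A B" and D: "open D"
    and inv: "\<And>\<zeta>. \<zeta> \<in> D \<Longrightarrow> invertible (M \<zeta>)"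
  defines "G \<equiv> \<lambda>\<zeta>. matrix_inv (M \<zeta>)"
  shows "mat_wirtinger_on D G (\<lambda>\<zeta>. - (G \<zeta> ** A \<zeta> ** G \<zeta>)) (\<lambda>\<zeta>. - (G \<zeta> ** B \<zeta> ** G \<zeta>))"
proof -
  have Md: "((\<lambda>\<zeta>. M \<zeta> $ i $ j) has_derivative (\<lambda>v. A \<zeta> $ i $ j * v + B \<zeta> $ i $ j * cnj v)) (at \<zeta>)"
    if "\<zeta> \<in> D" for i j \<zeta>
    using M that unfolding mat_wirtinger_on_def wirtinger_on_def by blast
  have Gd: "(\<lambda>\<zeta>. G \<zeta> $ i $ j) differentiable (at \<zeta>)" if "\<zeta> \<in> D" for i j \<zeta>
    unfolding G_def using that Md inv
    by (intro differentiable_matrix_inv) (auto simp: differentiable_def)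
  have Gc: "continuous_on D (\<lambda>\<zeta>. G \<zeta> $ i $ j)" for i j
    using Gd by (meson continuous_at_imp_continuous_on differentiable_imp_continuous_within)
  have MAB: "continuous_on D (\<lambda>\<zeta>. A \<zeta> $ i $ j)" "continuous_on D (\<lambda>\<zeta>. B \<zeta> $ i $ j)" for i j
    using M unfolding mat_wirtinger_on_def wirtinger_on_def by blast+
  have der: "((\<lambda>\<zeta>. G \<zeta> $ i $ j) has_derivative
      (\<lambda>v. (- (G \<zeta> ** A \<zeta> ** G \<zeta>)) $ i $ j * v + (- (G \<zeta> ** B \<zeta> ** G \<zeta>)) $ i $ j * cnj v)) (at \<zeta>)"
    if z: "\<zeta> \<in> D" for i j \<zeta>
  proof -
    obtain L where L: "\<And>i j. ((\<lambda>\<zeta>. G \<zeta> $ i $ j) has_derivative L i j) (at \<zeta>)"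
      using Gd[OF z] unfolding differentiable_def by metis
    have prod: "((\<lambda>\<zeta>. (G \<zeta> ** M \<zeta>) $ i $ j) has_derivative
        (\<lambda>v. ((\<chi> i j. L i j v) ** M \<zeta>) $ i $ j
           + (G \<zeta> ** (\<chi> i j. A \<zeta> $ i $ j * v + B \<zeta> $ i $ j * cnj v)) $ i $ j)) (at \<zeta>)" for i j
      unfolding matrix_matrix_mult_def vec_lambda_beta sum.distrib[symmetric]
      by (auto intro!: derivative_eq_intros L Md z simp: algebra_simps)
    have const: "((\<lambda>\<zeta>. (G \<zeta> ** M \<zeta>) $ i $ j) has_derivative (\<lambda>v. 0)) (at \<zeta>)" for i j
    proof (rule has_derivative_transform_within_open[OF _ D z])
      show "((\<lambda>\<zeta>. (mat 1 :: complex^'r^'r) $ i $ j) has_derivative (\<lambda>v. 0)) (at \<zeta>)" by simp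
    qed (simp add: G_def matrix_inv_both inv)
    have "L i j v = (- (G \<zeta> ** A \<zeta> ** G \<zeta>)) $ i $ j * v + (- (G \<zeta> ** B \<zeta> ** G \<zeta>)) $ i $ j * cnj v"
      for i j v
    proof -
      let ?L = "(\<chi> i j. L i j v) :: complex^'r^'r"
      let ?X = "(\<chi> i j. A \<zeta> $ i $ j * v + B \<zeta> $ i $ j * cnj v) :: complex^'r^'r"
      have "?L ** M \<zeta> + G \<zeta> ** ?X = 0"
        using has_derivative_unique[OF prod const] by (auto simp: vec_eq_iff fun_eq_iff)
      then have "?L ** M \<zeta> = - (G \<zeta> ** ?X)" by (simp add: eq_neg_iff_add_eq_0)
      then have "?L ** M \<zeta> ** G \<zeta> = - (G \<zeta> ** ?X ** G \<zeta>)" by (simp add: matrix_minus_left)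
      then have "?L = - (G \<zeta> ** ?X ** G \<zeta>)"
        by (simp add: G_def matrix_mul_assoc[symmetric] matrix_inv_both inv z)
      then have "L i j v = - (G \<zeta> ** ?X ** G \<zeta>) $ i $ j" by (simp add: vec_eq_iff)
      also have "\<dots> = (- (G \<zeta> ** A \<zeta> ** G \<zeta>)) $ i $ j * v + (- (G \<zeta> ** B \<zeta> ** G \<zeta>)) $ i $ j * cnj v"
        by (simp add: matrix_matrix_mult_def sum_distrib_left sum_distrib_right sum.distrib algebra_simps)
      finally show ?thesis .
    qed
    then have "L i j = (\<lambda>v. (- (G \<zeta> ** A \<zeta> ** G \<zeta>)) $ i $ j * v + (- (G \<zeta> ** B \<zeta> ** G \<zeta>)) $ i $ j * cnj v)"
      by blast
    then show ?thesis using L by metis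
  qed
  have cont: "continuous_on D (\<lambda>\<zeta>. (- (G \<zeta> ** A \<zeta> ** G \<zeta>)) $ i $ j)"
    "continuous_on D (\<lambda>\<zeta>. (- (G \<zeta> ** B \<zeta> ** G \<zeta>)) $ i $ j)" for i j
    unfolding vector_uminus_component
    by (intro continuous_on_minus continuous_on_mat_mult_entry Gc MAB)+
  show ?thesis
    unfolding mat_wirtinger_on_def wirtinger_on_def using der cont by blast
qed

section \<open>Hermitian forms and the Laplacian of an inverse form\<close>

text \<open>
  Vectors are one-column matrices here, so that the rules for products and conjugate transposes of
  matrices also compute with hermitian forms.  The value of the form is the entry of the resulting
  $1 \times 1$ matrix.
\<close>

abbreviation quad :: "complex^'r^'r \<Rightarrow> complex^1^'r \<Rightarrow> complex" where
  "quad H y \<equiv> (adj y ** H ** y) $ 1 $ 1"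

definition pos_def_matrix :: "complex^'r^'r \<Rightarrow> bool" where
  "pos_def_matrix H \<longleftrightarrow> adj H = H \<and> (\<forall>y. y \<noteq> 0 \<longrightarrow> 0 < Re (quad H y))"

definition column_matrix :: "'a^'r \<Rightarrow> 'a^1^'r" where
  "column_matrix v = (\<chi> i j. v $ i)"

lemma adj_adj [simp]: "adj (adj A) = A"
  by (simp add: adj_def vec_eq_iff)

lemma adj_mult: "adj (A ** B) = adj B ** adj A" for A :: "complex^'m^'n"
  by (simp add: adj_def matrix_matrix_mult_def vec_eq_iff mult.commute)

lemma adj_add: "adj (A + B) = adj A + adj B"
  by (simp add: adj_def vec_eq_iff)

lemma adj_zero [simp]: "adj 0 = 0"
  by (simp add: adj_def vec_eq_iff)

lemma adj_mat1 [simp]: "adj (mat 1) = mat 1"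
  by (simp add: adj_def mat_def vec_eq_iff)

lemma matrix_zero_right [simp]: "A ** 0 = 0" for A :: "complex^'m^'n"
  by (simp add: matrix_matrix_mult_def vec_eq_iff)

lemma matrix_zero_left [simp]: "0 ** A = 0" for A :: "complex^'m^'n"
  by (simp add: matrix_matrix_mult_def vec_eq_iff)

lemma matrix_mul_add_left: "(A + B) ** C = A ** C + B ** C" for A :: "complex^'m^'n"
  by (simp add: matrix_matrix_mult_def vec_eq_iff sum.distrib algebra_simps)

lemma adj_diff: "adj (A - B) = adj A - adj B"
  by (simp add: adj_def vec_eq_iff)

lemma matrix_mul_diff_left: "(A - B) ** C = A ** C - B ** C" for A :: "complex^'m^'n"
  by (simp add: matrix_matrix_mult_def vec_eq_iff sum_subtractf algebra_simps)

lemma matrix_mul_diff_right: "A ** (B - C) = A ** B - A ** C" for A :: "complex^'m^'n"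
  by (simp add: matrix_matrix_mult_def vec_eq_iff sum_subtractf algebra_simps)

lemma quad_expand: "quad H y = (\<Sum>a\<in>UNIV. \<Sum>b\<in>UNIV. H $ a $ b * cnj (y $ a $ 1) * y $ b $ 1)"
  unfolding matrix_matrix_mult_def adj_def
  by (simp add: sum_distrib_right sum_distrib_left) (subst sum.swap, simp add: ac_simps)

lemma quad_nonneg: "pos_def_matrix H \<Longrightarrow> 0 \<le> Re (quad H y)"
  unfolding pos_def_matrix_def by (cases "y = 0") (auto simp: less_imp_le)

lemma adj_quad: "adj H = H \<Longrightarrow> cnj (quad H y) = quad H y"
proof -
  assume "adj H = H"
  then have "adj (adj y ** H ** y) = adj y ** H ** y"
    by (simp add: adj_mult matrix_mul_assoc)
  then have "adj (adj y ** H ** y) $ 1 $ 1 = quad H y" by simp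
  then show ?thesis by (simp add: adj_def)
qed

lemma pos_def_matrix_invertible:
  fixes H :: "complex^'r^'r"
  assumes "pos_def_matrix H"
  shows "invertible H"
proof -
  have "x = 0" if "H *v x = 0" for x
  proof (rule ccontr)
    assume "x \<noteq> 0"
    then have "column_matrix x \<noteq> 0" by (auto simp: column_matrix_def vec_eq_iff)
    then have "0 < Re (quad H (column_matrix x))" using assms by (auto simp: pos_def_matrix_def)
    moreover have "H ** column_matrix x = 0"
      using that by (simp add: column_matrix_def matrix_matrix_mult_def matrix_vector_mult_def vec_eq_iff)
    ultimately show False by (simp add: matrix_mul_assoc[symmetric])
  qed
  then show ?thesis
    using invertible_left_inverse matrix_left_invertible_ker by blast
qed

lemma adj_matrix_inv:
  fixes H :: "complex^'r^'r"
  assumes "adj H = H" "invertible H"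
  shows "adj (matrix_inv H) = matrix_inv H"
proof -
  have "adj (matrix_inv H) ** H = mat 1"
    using arg_cong[OF matrix_inv_both(1)[OF assms(2)], of adj] assms(1)
    by (simp add: adj_mult)
  then have "adj (matrix_inv H) ** H ** matrix_inv H = matrix_inv H" by simp
  then show ?thesis by (simp add: matrix_mul_assoc[symmetric] matrix_inv_both assms)
qed

lemma quad_matrix_inv:
  fixes H :: "complex^'r^'r"
  assumes "pos_def_matrix H"
  shows "quad (matrix_inv H) y = quad H (matrix_inv H ** y)"
proof -
  have "invertible H" "adj H = H"
    using assms pos_def_matrix_invertible by (auto simp: pos_def_matrix_def)
  then show ?thesis
    by (simp add: adj_mult adj_matrix_inv matrix_mul_assoc[symmetric] matrix_inv_mult_cancel)
qed

text \<open>
  With $E = u' - H_\zeta G u$ one has $F_\zeta = u^* G E$, because $G_\zeta = -G H_\zeta G$ and $u^*$ is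
  antiholomorphic.  The hermitian symmetry of $H$ gives $H_{\bar\zeta} = H_\zeta^*$, hence
  $(u^* G)_{\bar\zeta} = E^* G$, while $E_{\bar\zeta} = \Theta\, G u$ for
  $\Theta = H_\zeta G H_{\bar\zeta} - H_{\zeta\bar\zeta}$.  Therefore
  $F_{\zeta\bar\zeta} = E^* G E + (Gu)^* \Theta (Gu)$, and the first summand is nonnegative.  For real $F$ the
  derivative in the direction $v$ is $2 \mathrm{Re}(F_\zeta v)$, the form used from here on.
\<close>

lemma quad_inverse_laplacian:
  fixes H :: "complex \<Rightarrow> complex^'r^'r" and u :: "complex \<Rightarrow> complex^1^'r"
  assumes D: "open D" and H: "mat_wirtinger_on D H H1 Hb" and H1: "mat_wirtinger_on D H1 H11 H1b"
    and pd: "\<And>\<zeta>. \<zeta> \<in> D \<Longrightarrow> pos_def_matrix (H \<zeta>)"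
    and u: "mat_wirtinger_on D u u1 (\<lambda>_. 0)" and u1: "mat_wirtinger_on D u1 u2 (\<lambda>_. 0)"
  defines "G \<equiv> \<lambda>\<zeta>. matrix_inv (H \<zeta>)"
  defines "\<Theta> \<equiv> \<lambda>\<zeta>. H1 \<zeta> ** G \<zeta> ** Hb \<zeta> + - H1b \<zeta>"
  obtains Fz Fzz Fzb where
    "\<And>\<zeta>. \<zeta> \<in> D \<Longrightarrow> ((\<lambda>\<zeta>. Re (quad (G \<zeta>) (u \<zeta>))) has_derivative (\<lambda>v. 2 * Re (Fz \<zeta> * v))) (at \<zeta>)"
    "wirtinger_on D Fz Fzz Fzb"
    "\<And>\<zeta>. \<zeta> \<in> D \<Longrightarrow> Re (quad (\<Theta> \<zeta>) (G \<zeta> ** u \<zeta>)) \<le> Re (Fzb \<zeta>)"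
proof -
  have inv: "invertible (H \<zeta>)" and Hh: "adj (H \<zeta>) = H \<zeta>" if "\<zeta> \<in> D" for \<zeta>
    using pd[OF that] pos_def_matrix_invertible by (auto simp: pos_def_matrix_def)
  have Gh: "adj (G \<zeta>) = G \<zeta>" if "\<zeta> \<in> D" for \<zeta>
    unfolding G_def by (intro adj_matrix_inv inv Hh that)
  have G: "mat_wirtinger_on D G (\<lambda>\<zeta>. - (G \<zeta> ** H1 \<zeta> ** G \<zeta>)) (\<lambda>\<zeta>. - (G \<zeta> ** Hb \<zeta> ** G \<zeta>))"
    unfolding G_def by (rule mat_wirtinger_on_inv[OF H D inv])
  have Hb: "Hb \<zeta> = adj (H1 \<zeta>)" if z: "\<zeta> \<in> D" for \<zeta>
  proof -
    have "Hb \<zeta> $ i $ j = adj (H1 \<zeta>) $ i $ j" for i j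
      by (rule wirtinger_on_unique(2)[of D "\<lambda>\<zeta>. H \<zeta> $ i $ j" "\<lambda>\<zeta>. H1 \<zeta> $ i $ j" "\<lambda>\<zeta>. Hb \<zeta> $ i $ j"
            D "\<lambda>\<zeta>. adj (H \<zeta>) $ i $ j" "\<lambda>\<zeta>. adj (Hb \<zeta>) $ i $ j" _ D])
         (use H mat_wirtinger_on_adj[OF H] D z Hh in \<open>auto simp: mat_wirtinger_on_def\<close>)
    then show ?thesis by (simp add: vec_eq_iff)
  qed
  define E where "E \<zeta> = u1 \<zeta> + - (H1 \<zeta> ** G \<zeta> ** u \<zeta>)" for \<zeta>
  define P where "P \<zeta> = adj (u \<zeta>) ** G \<zeta>" for \<zeta>
  note rules = mat_wirtinger_on_add mat_wirtinger_on_minus mat_wirtinger_on_mult mat_wirtinger_on_adj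
  have P: "mat_wirtinger_on D P (\<lambda>\<zeta>. adj (0 :: complex^1^'r) ** G \<zeta> + adj (u \<zeta>) ** - (G \<zeta> ** H1 \<zeta> ** G \<zeta>))
        (\<lambda>\<zeta>. adj (u1 \<zeta>) ** G \<zeta> + adj (u \<zeta>) ** - (G \<zeta> ** Hb \<zeta> ** G \<zeta>))" (is "mat_wirtinger_on D P ?P1 ?Pb")
    unfolding P_def by (intro rules u G)
  obtain E1 where E: "mat_wirtinger_on D E E1 (\<lambda>\<zeta>. 0 + - ((H1b \<zeta> ** G \<zeta> + H1 \<zeta> ** - (G \<zeta> ** Hb \<zeta> ** G \<zeta>)) ** u \<zeta>
            + (H1 \<zeta> ** G \<zeta>) ** 0))" (is "mat_wirtinger_on D E E1 ?Eb")
    using mat_wirtinger_on_add[OF u1 mat_wirtinger_on_minus[OF mat_wirtinger_on_mult[OF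
          mat_wirtinger_on_mult[OF H1 G] u]]]
    unfolding E_def by blast
  have Pb: "?Pb \<zeta> = adj (E \<zeta>) ** G \<zeta>" if "\<zeta> \<in> D" for \<zeta>
    using that by (simp add: E_def Hb Gh adj_diff adj_mult matrix_mul_add_left matrix_mul_diff_left matrix_mul_diff_right matrix_minus_left
        matrix_minus_right matrix_mul_assoc)
  have Eb: "?Eb \<zeta> = \<Theta> \<zeta> ** (G \<zeta> ** u \<zeta>)" for \<zeta>
    by (simp add: \<Theta>_def matrix_mul_add_left matrix_mul_diff_left matrix_mul_diff_right matrix_minus_left matrix_minus_right matrix_mul_assoc)
  let ?C = "\<lambda>\<zeta>. P \<zeta> ** u \<zeta>"
  have C: "mat_wirtinger_on D ?C (\<lambda>\<zeta>. ?P1 \<zeta> ** u \<zeta> + P \<zeta> ** u1 \<zeta>) (\<lambda>\<zeta>. ?Pb \<zeta> ** u \<zeta> + P \<zeta> ** 0)"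
    by (rule mat_wirtinger_on_mult[OF P u])
  have C1: "?P1 \<zeta> ** u \<zeta> + P \<zeta> ** u1 \<zeta> = P \<zeta> ** E \<zeta>" for \<zeta>
    by (simp add: P_def E_def matrix_add_ldistrib matrix_mul_diff_left matrix_mul_diff_right matrix_minus_left matrix_minus_right matrix_mul_assoc)
  have Cb: "(?Pb \<zeta> ** u \<zeta> + P \<zeta> ** 0) $ 1 $ 1 = cnj ((P \<zeta> ** E \<zeta>) $ 1 $ 1)" if "\<zeta> \<in> D" for \<zeta>
  proof -
    have "?Pb \<zeta> ** u \<zeta> + P \<zeta> ** 0 = adj (P \<zeta> ** E \<zeta>)"
      unfolding Pb[OF that] by (simp add: P_def adj_mult Gh that matrix_mul_assoc)
    then show ?thesis by (simp add: adj_def)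
  qed
  define Fz where "Fz \<zeta> = (P \<zeta> ** E \<zeta>) $ 1 $ 1" for \<zeta>
  define Fzz where "Fzz \<zeta> = (?P1 \<zeta> ** E \<zeta> + P \<zeta> ** E1 \<zeta>) $ 1 $ 1" for \<zeta>
  define Fzb where "Fzb \<zeta> = (?Pb \<zeta> ** E \<zeta> + P \<zeta> ** ?Eb \<zeta>) $ 1 $ 1" for \<zeta>
  show thesis
  proof (rule that[of Fz Fzz Fzb])
    fix \<zeta> assume z: "\<zeta> \<in> D"
    have "((\<lambda>\<zeta>. ?C \<zeta> $ 1 $ 1) has_derivative (\<lambda>v. Fz \<zeta> * v + cnj (Fz \<zeta>) * cnj v)) (at \<zeta>)"
      using wirtinger_on_derivative[OF C[unfolded mat_wirtinger_on_def, rule_format, of 1 1] z]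
      unfolding C1 Cb[OF z] Fz_def .
    from has_derivative_Re[OF this]
    show "((\<lambda>\<zeta>. Re (quad (G \<zeta>) (u \<zeta>))) has_derivative (\<lambda>v. 2 * Re (Fz \<zeta> * v))) (at \<zeta>)"
      by (simp add: P_def mult.commute)
  next
    show "wirtinger_on D Fz Fzz Fzb"
      using mat_wirtinger_on_mult[OF P E, unfolded mat_wirtinger_on_def, rule_format, of 1 1]
      unfolding Fz_def Fzz_def Fzb_def .
  next
    fix \<zeta> assume z: "\<zeta> \<in> D"
    have "Fzb \<zeta> = quad (G \<zeta>) (E \<zeta>) + quad (\<Theta> \<zeta>) (G \<zeta> ** u \<zeta>)"
      unfolding Fzb_def Eb Pb[OF z] by (simp add: P_def adj_mult Gh z matrix_mul_assoc)
    moreover have "0 \<le> Re (quad (G \<zeta>) (E \<zeta>))"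
      unfolding G_def quad_matrix_inv[OF pd[OF z]] by (rule quad_nonneg[OF pd[OF z]])
    ultimately show "Re (quad (\<Theta> \<zeta>) (G \<zeta> ** u \<zeta>)) \<le> Re (Fzb \<zeta>)" by simp
  qed
qed

section \<open>Curvature along complex lines\<close>

text \<open>
  A real linear functional is the sum of a complex linear and a complex antilinear one, with the
  Wirtinger expressions in its values on $e_j$ and $\mathrm{i} e_j$ as coefficients.  Applied to a derivative
  this expresses the Wirtinger derivatives along a line through \<open>d_z\<close> and \<open>d_zbar\<close>.
\<close>

lemma linear_wirtinger_form:
  fixes L :: "complex^'n \<Rightarrow> complex"
  assumes "linear L"
  shows "L (v *s w) = (\<Sum>j\<in>UNIV. w $ j * ((L (axis j 1) - \<i> * L (axis j \<i>)) / 2)) * v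
           + (\<Sum>k\<in>UNIV. cnj (w $ k) * ((L (axis k 1) + \<i> * L (axis k \<i>)) / 2)) * cnj v"
proof -
  interpret linear L by (rule assms)
  have ax: "L (axis j c) = of_real (Re c) * L (axis j 1) + of_real (Im c) * L (axis j \<i>)" for j c
  proof -
    have "axis j c = Re c *\<^sub>R axis j 1 + Im c *\<^sub>R axis j \<i>"
      by (auto simp: axis_def vec_eq_iff complex_eq_iff)
    then show ?thesis by (simp only: add scale) (simp only: scaleR_conv_of_real)
  qed
  have "v *s w = (\<Sum>j\<in>UNIV. axis j (v * w $ j))"
    by (simp add: vec_eq_iff axis_def if_distrib cong: if_cong)
  then have "L (v *s w) = (\<Sum>j\<in>UNIV. L (axis j (v * w $ j)))" by (simp add: sum)
  also have "\<dots> = (\<Sum>j\<in>UNIV. w $ j * ((L (axis j 1) - \<i> * L (axis j \<i>)) / 2) * v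
           + cnj (w $ j) * ((L (axis j 1) + \<i> * L (axis j \<i>)) / 2) * cnj v)"
  proof (rule sum.cong[OF refl])
    fix j
    let ?c = "v * w $ j"
    have re: "of_real (Re c) = (c + cnj c) / 2" and im: "of_real (Im c) = - \<i> * (c - cnj c) / 2" for c
      by (simp_all add: complex_eq_iff)
    show "L (axis j ?c) = w $ j * ((L (axis j 1) - \<i> * L (axis j \<i>)) / 2) * v
           + cnj (w $ j) * ((L (axis j 1) + \<i> * L (axis j \<i>)) / 2) * cnj v"
      unfolding ax[of j ?c] re im complex_cnj_mult by (simp add: algebra_simps add_divide_distrib diff_divide_distrib)
  qed
  finally show ?thesis by (simp add: sum.distrib sum_distrib_right)
qed

lemma has_derivative_line:
  fixes f :: "complex^'n \<Rightarrow> complex"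
  assumes "f differentiable (at (p + \<zeta> *s w))"
  shows "((\<lambda>\<zeta>. f (p + \<zeta> *s w)) has_derivative
     (\<lambda>v. (\<Sum>j\<in>UNIV. w $ j * d_z j f (p + \<zeta> *s w)) * v
        + (\<Sum>k\<in>UNIV. cnj (w $ k) * d_zbar k f (p + \<zeta> *s w)) * cnj v)) (at \<zeta>)"
proof -
  let ?L = "frechet_derivative f (at (p + \<zeta> *s w))"
  have L: "(f has_derivative ?L) (at (p + \<zeta> *s w))"
    using assms frechet_derivative_works by blast
  have "bounded_linear (\<lambda>v. v *s w)"
    unfolding vector_scalar_mult_def
    by (intro linear_conv_bounded_linear[THEN iffD1] linearI)
       (auto simp: vec_eq_iff algebra_simps)
  then have "((\<lambda>\<zeta>. p + \<zeta> *s w) has_derivative (\<lambda>v. v *s w)) (at \<zeta>)"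
    by (auto intro!: derivative_eq_intros bounded_linear_imp_has_derivative)
  from has_derivative_compose[OF this L]
  show ?thesis
    unfolding linear_wirtinger_form[OF has_derivative_linear[OF L]] d_z_def d_zbar_def .
qed

lemma Ck_on_imp_continuous: "Ck_on k S f \<Longrightarrow> continuous_on S f"
  by (cases k) (auto intro!: continuous_at_imp_continuous_on differentiable_imp_continuous_within)

lemma continuous_on_line:
  fixes f :: "complex^'n \<Rightarrow> 'b::topological_space"
  assumes "continuous_on \<Omega> f"
  shows "continuous_on {\<zeta>. p + \<zeta> *s w \<in> \<Omega>} (\<lambda>\<zeta>. f (p + \<zeta> *s w))"
  by (rule continuous_on_compose2[OF assms])
     (auto simp: vector_scalar_mult_def intro!: continuous_intros)

lemma open_line:
  assumes "open (\<Omega> :: (complex^'n) set)"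
  shows "open {\<zeta>. p + \<zeta> *s w \<in> \<Omega>}"
proof -
  have "continuous_on UNIV (\<lambda>\<zeta>. p + \<zeta> *s w)"
    by (auto simp: vector_scalar_mult_def intro!: continuous_intros)
  from open_vimage[OF assms this] show ?thesis by (simp add: vimage_def)
qed

lemma Ck1_wirtinger_line:
  assumes "Ck_on (Suc 0) \<Omega> f"
  shows "wirtinger_on {\<zeta>. p + \<zeta> *s w \<in> \<Omega>} (\<lambda>\<zeta>. f (p + \<zeta> *s w))
     (\<lambda>\<zeta>. \<Sum>j\<in>UNIV. w $ j * d_z j f (p + \<zeta> *s w)) (\<lambda>\<zeta>. \<Sum>k\<in>UNIV. cnj (w $ k) * d_zbar k f (p + \<zeta> *s w))"
proof -
  have c: "continuous_on {\<zeta>. p + \<zeta> *s w \<in> \<Omega>} (\<lambda>\<zeta>. frechet_derivative f (at (p + \<zeta> *s w)) v)" for v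
    using assms continuous_on_line[of \<Omega> "\<lambda>z. frechet_derivative f (at z) v"] by simp
  show ?thesis
    unfolding wirtinger_on_def
  proof (intro conjI ballI)
    show "continuous_on {\<zeta>. p + \<zeta> *s w \<in> \<Omega>} (\<lambda>\<zeta>. \<Sum>j\<in>UNIV. w $ j * d_z j f (p + \<zeta> *s w))"
      unfolding d_z_def by (intro continuous_intros c) auto
    show "continuous_on {\<zeta>. p + \<zeta> *s w \<in> \<Omega>} (\<lambda>\<zeta>. \<Sum>k\<in>UNIV. cnj (w $ k) * d_zbar k f (p + \<zeta> *s w))"
      unfolding d_zbar_def by (intro continuous_intros c) auto
  qed (use assms in \<open>auto intro!: has_derivative_line\<close>)
qed

lemma Ck1_lincomb:
  fixes f g :: "'a::real_normed_vector \<Rightarrow> complex"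
  assumes "Ck_on (Suc 0) \<Omega> f" "Ck_on (Suc 0) \<Omega> g"
  shows "Ck_on (Suc 0) \<Omega> (\<lambda>z. c * f z + d * g z)"
proof -
  have der: "((\<lambda>z. c * f z + d * g z) has_derivative
      (\<lambda>v. c * frechet_derivative f (at z) v + d * frechet_derivative g (at z) v)) (at z)" if "z \<in> \<Omega>" for z
    using assms that by (auto intro!: derivative_eq_intros frechet_derivative_works[THEN iffD1])
  have "frechet_derivative (\<lambda>z. c * f z + d * g z) (at z) v
      = c * frechet_derivative f (at z) v + d * frechet_derivative g (at z) v" if "z \<in> \<Omega>" for z v
    using fun_cong[OF frechet_derivative_at[OF der[OF that], symmetric]] .
  moreover have "continuous_on \<Omega> (\<lambda>z. c * frechet_derivative f (at z) v + d * frechet_derivative g (at z) v)" for v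
    using assms by (auto intro!: continuous_intros)
  moreover have "(\<lambda>z. c * f z + d * g z) differentiable (at z)" if "z \<in> \<Omega>" for z
    using der[OF that] by (rule differentiableI)
  ultimately show ?thesis
    unfolding Ck_on.simps by (simp cong: continuous_on_cong)
qed

lemma Ck2_imp_Ck1:
  assumes "Ck_on 2 \<Omega> f"
  shows "Ck_on (Suc 0) \<Omega> f"
proof -
  have "Ck_on (Suc 0) \<Omega> (\<lambda>z. frechet_derivative f (at z) v)" for v
    using assms by (simp add: numeral_2_eq_2)
  then have "continuous_on \<Omega> (\<lambda>z. frechet_derivative f (at z) v)" for v
    by (rule Ck_on_imp_continuous)
  with assms show ?thesis by (simp add: numeral_2_eq_2)
qed

lemma Ck2_d_z:
  assumes "Ck_on 2 \<Omega> f"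
  shows "Ck_on (Suc 0) \<Omega> (d_z j f)"
proof -
  have 1: "Ck_on (Suc 0) \<Omega> (\<lambda>z. frechet_derivative f (at z) v)" for v
    using assms by (simp add: numeral_2_eq_2)
  have "d_z j f = (\<lambda>z. (1/2) * frechet_derivative f (at z) (axis j 1)
      + (- \<i> / 2) * frechet_derivative f (at z) (axis j \<i>))"
    by (rule ext) (simp add: d_z_def diff_divide_distrib)
  then show ?thesis by (simp only: Ck1_lincomb[OF 1 1])
qed

lemma hol_map_line:
  assumes "hol_map \<Omega> u"
  shows "(\<lambda>\<zeta>. u (p + \<zeta> *s w) $ a) holomorphic_on {\<zeta>. p + \<zeta> *s w \<in> \<Omega>}"
  unfolding holomorphic_on_def
proof (intro ballI)
  fix \<zeta> assume "\<zeta> \<in> {\<zeta>. p + \<zeta> *s w \<in> \<Omega>}"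
  then obtain L where L: "(u has_derivative L) (at (p + \<zeta> *s w))" "\<And>c v. L (c *s v) = c *s L v"
    using assms by (auto simp: hol_map_def)
  have "bounded_linear (\<lambda>v. v *s w)"
    unfolding vector_scalar_mult_def
    by (intro linear_conv_bounded_linear[THEN iffD1] linearI)
       (auto simp: vec_eq_iff algebra_simps)
  then have "((\<lambda>\<zeta>. p + \<zeta> *s w) has_derivative (\<lambda>v. v *s w)) (at \<zeta>)"
    by (auto intro!: derivative_eq_intros bounded_linear_imp_has_derivative)
  from has_derivative_compose[OF this L(1)]
  have "((\<lambda>\<zeta>. u (p + \<zeta> *s w) $ a) has_derivative (\<lambda>v. L w $ a * v)) (at \<zeta>)"
    by (intro has_derivative_eq_rhs[OF bounded_linear.has_derivative[OF bounded_linear_vec_nth]])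
       (auto simp: L(2) mult.commute)
  then have "((\<lambda>\<zeta>. u (p + \<zeta> *s w) $ a) has_field_derivative L w $ a) (at \<zeta>)"
    by (simp add: has_field_derivative_def)
  then show "(\<lambda>\<zeta>. u (p + \<zeta> *s w) $ a) field_differentiable at \<zeta> within {\<zeta>. p + \<zeta> *s w \<in> \<Omega>}"
    using field_differentiable_at_within field_differentiable_def by blast
qed

lemma sum_swap_triple:
  "(\<Sum>j\<in>A. \<Sum>k\<in>B. \<Sum>c\<in>C. f j k c) = (\<Sum>c\<in>C. \<Sum>j\<in>A. \<Sum>k\<in>B. f j k c)"
proof -
  have "(\<Sum>j\<in>A. \<Sum>k\<in>B. \<Sum>c\<in>C. f j k c) = (\<Sum>j\<in>A. \<Sum>c\<in>C. \<Sum>k\<in>B. f j k c)"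
    by (intro sum.cong refl sum.swap)
  also have "\<dots> = (\<Sum>c\<in>C. \<Sum>j\<in>A. \<Sum>k\<in>B. f j k c)"
    by (rule sum.swap)
  finally show ?thesis .
qed

lemma sum_swap_pairs:
  "(\<Sum>j\<in>A. \<Sum>k\<in>B. \<Sum>a\<in>C. \<Sum>b\<in>D. f j k a b) = (\<Sum>a\<in>C. \<Sum>b\<in>D. \<Sum>j\<in>A. \<Sum>k\<in>B. f j k a b)"
  by (subst sum_swap_triple) (intro sum.cong refl sum_swap_triple)

text \<open>
  The curvature form on $TM \otimes E$ is evaluated at $t_{ja} = w_j \overline{y_a}$ with
  $y = Gu$ only.  At such decomposable tensors the sum over $j, k$ contracts the curvature with the
  direction of the line, which leaves the one-variable expression of \<open>quad_inverse_laplacian\<close>,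
  and the comparison form factors into $\omega(w,w)$ and the squared dual norm.
\<close>

lemma dual_norm_laplacian:
  fixes H :: "complex^'n \<Rightarrow> complex^'r^'r" and u :: "complex^'n \<Rightarrow> complex^'r"
    and p w :: "complex^'n" and W :: "complex^'n \<Rightarrow> complex^'n^'n" and \<mu> :: "complex^'n \<Rightarrow> real"
  assumes \<Omega>: "open \<Omega>" and H: "\<And>a b. Ck_on 2 \<Omega> (\<lambda>z. H z $ a $ b)"
    and pd: "\<And>z. z \<in> \<Omega> \<Longrightarrow> pos_def_matrix (H z)" and u: "hol_map \<Omega> u"
    and curv: "\<And>z t. z \<in> \<Omega> \<Longrightarrow>
      \<mu> z * Re (\<Sum>j\<in>UNIV. \<Sum>k\<in>UNIV. \<Sum>a\<in>UNIV. \<Sum>b\<in>UNIV.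
                 W z $ j $ k * H z $ a $ b * t $ j $ a * cnj (t $ k $ b))
      \<le> Re (\<Sum>j\<in>UNIV. \<Sum>k\<in>UNIV. \<Sum>a\<in>UNIV. \<Sum>b\<in>UNIV.
                 (chern_curvature H j k z ** H z) $ a $ b * t $ j $ a * cnj (t $ k $ b))"
  defines "F \<equiv> \<lambda>z. Re (quad (matrix_inv (H z)) (column_matrix (u z)))"
  defines "D \<equiv> {\<zeta>. p + \<zeta> *s w \<in> \<Omega>}"
  shows "\<exists>Fz Fzz Fzb.
    (\<forall>\<zeta>\<in>D. ((\<lambda>\<zeta>. F (p + \<zeta> *s w)) has_derivative (\<lambda>v. 2 * Re (Fz \<zeta> * v))) (at \<zeta>)) \<and>
    wirtinger_on D Fz Fzz Fzb \<and>
    (\<forall>\<zeta>\<in>D. \<mu> (p + \<zeta> *s w) *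
        (Re (\<Sum>j\<in>UNIV. \<Sum>k\<in>UNIV. W (p + \<zeta> *s w) $ j $ k * w $ j * cnj (w $ k)) * F (p + \<zeta> *s w))
      \<le> Re (Fzb \<zeta>))"
proof -
  have D: "open D" unfolding D_def by (rule open_line[OF \<Omega>])
  let ?z = "\<lambda>\<zeta>. p + \<zeta> *s w"
  let ?h = "\<lambda>a b z. H z $ a $ b"
  have H1: "Ck_on (Suc 0) \<Omega> (?h a b)" for a b
    using H by (rule Ck2_imp_Ck1)
  define Hz where "Hz \<zeta> = (\<chi> a b. \<Sum>j\<in>UNIV. w $ j * d_z j (?h a b) (?z \<zeta>))" for \<zeta>
  define Hb where "Hb \<zeta> = (\<chi> a b. \<Sum>k\<in>UNIV. cnj (w $ k) * d_zbar k (?h a b) (?z \<zeta>))" for \<zeta>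
  define Hzz where "Hzz \<zeta> = (\<chi> a b. \<Sum>j\<in>UNIV. w $ j * (\<Sum>k\<in>UNIV. w $ k * d_z k (d_z j (?h a b)) (?z \<zeta>)))" for \<zeta>
  define Hzb where "Hzb \<zeta> = (\<chi> a b. \<Sum>j\<in>UNIV. w $ j * (\<Sum>k\<in>UNIV. cnj (w $ k) * d_zbar k (d_z j (?h a b)) (?z \<zeta>)))" for \<zeta>
  have HW: "mat_wirtinger_on D (\<lambda>\<zeta>. H (?z \<zeta>)) Hz Hb"
    unfolding mat_wirtinger_on_def D_def Hz_def Hb_def using Ck1_wirtinger_line[OF H1] by simp
  have HzW: "mat_wirtinger_on D Hz Hzz Hzb"
    unfolding mat_wirtinger_on_def D_def Hz_def Hzz_def Hzb_def vec_lambda_beta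
    by (intro allI wirtinger_on_sum wirtinger_on_cmult Ck1_wirtinger_line Ck2_d_z H)
  define u1 where "u1 \<zeta> = column_matrix (\<chi> a. deriv (\<lambda>\<zeta>. u (?z \<zeta>) $ a) \<zeta>)" for \<zeta>
  define u2 where "u2 \<zeta> = column_matrix (\<chi> a. deriv (deriv (\<lambda>\<zeta>. u (?z \<zeta>) $ a)) \<zeta>)" for \<zeta>
  have hol: "(\<lambda>\<zeta>. u (?z \<zeta>) $ a) holomorphic_on D" for a
    unfolding D_def by (rule hol_map_line[OF u])
  have uW: "mat_wirtinger_on D (\<lambda>\<zeta>. column_matrix (u (?z \<zeta>))) u1 (\<lambda>_. 0)"
    unfolding mat_wirtinger_on_def u1_def column_matrix_def
    using wirtinger_on_holomorphic[OF hol D] by simp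
  have u1W: "mat_wirtinger_on D u1 u2 (\<lambda>_. 0)"
    unfolding mat_wirtinger_on_def u1_def u2_def column_matrix_def
    using wirtinger_on_holomorphic[OF holomorphic_deriv[OF hol D] D] by simp
  let ?G = "\<lambda>z. matrix_inv (H z)"
  obtain Fz Fzz Fzb where
    F1: "\<And>\<zeta>. \<zeta> \<in> D \<Longrightarrow> ((\<lambda>\<zeta>. Re (quad (?G (?z \<zeta>)) (column_matrix (u (?z \<zeta>))))) has_derivative (\<lambda>v. 2 * Re (Fz \<zeta> * v))) (at \<zeta>)"
    and F2: "wirtinger_on D Fz Fzz Fzb"
    and F3: "\<And>\<zeta>. \<zeta> \<in> D \<Longrightarrow> Re (quad (Hz \<zeta> ** ?G (?z \<zeta>) ** Hb \<zeta> + - Hzb \<zeta>) (?G (?z \<zeta>) ** column_matrix (u (?z \<zeta>)))) \<le> Re (Fzb \<zeta>)"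
    by (rule quad_inverse_laplacian[OF D HW HzW _ uW u1W]) (use pd in \<open>auto simp: D_def\<close>)
  have "\<mu> (?z \<zeta>) * (Re (\<Sum>j\<in>UNIV. \<Sum>k\<in>UNIV. W (?z \<zeta>) $ j $ k * w $ j * cnj (w $ k)) * F (?z \<zeta>)) \<le> Re (Fzb \<zeta>)"
    if z: "\<zeta> \<in> D" for \<zeta>
  proof -
    let ?x = "?z \<zeta>"
    have x: "?x \<in> \<Omega>" using z by (simp add: D_def)
    have inv: "invertible (H ?x)" using pd[OF x] pos_def_matrix_invertible by blast
    let ?C = "\<lambda>j z. chern_connection H j z"
    let ?\<Theta> = "Hz \<zeta> ** ?G ?x ** Hb \<zeta> + - Hzb \<zeta>"
    \<comment> \<open>Contracted with w, the connection coefficients become $H_\zeta G$ on the line, and contraction with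
      the conjugate of w turns the derivatives \<open>d_zbar\<close> into the derivative along the line.  The latter
      uses the chain rule, hence that the connection is differentiable in all variables.\<close>
    have Cd: "(\<lambda>z. ?C j z $ a $ b) differentiable (at ?x)" for j a b
    proof -
      have "(\<lambda>z. ?G z $ i $ k) differentiable (at ?x)" for i k
        by (rule differentiable_matrix_inv[of H, OF _ inv]) (use H1 x in auto)
      moreover have "(\<lambda>z. d_z j (?h i k) z) differentiable (at ?x)" for i k
        using Ck2_d_z[OF H] x by simp
      ultimately show ?thesis
        unfolding chern_connection_def matrix_matrix_mult_def vec_lambda_beta
        by (intro differentiable_sum differentiable_mult) auto
    qed
    have curvature: "(\<Sum>j\<in>UNIV. \<Sum>k\<in>UNIV. w $ j * cnj (w $ k) * chern_curvature H j k ?x $ a $ b)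
        = - (Hzb \<zeta> ** ?G ?x + Hz \<zeta> ** - (?G ?x ** Hb \<zeta> ** ?G ?x)) $ a $ b" for a b
    proof -
      have eq: "(\<Sum>j\<in>UNIV. w $ j * ?C j (?z \<xi>) $ a $ b) = (Hz \<xi> ** ?G (?z \<xi>)) $ a $ b" for \<xi>
        unfolding Hz_def chern_connection_def matrix_matrix_mult_def vec_lambda_beta sum_distrib_left sum_distrib_right
        by (subst sum.swap) (simp add: mult.assoc)
      have 1: "((\<lambda>\<xi>. \<Sum>j\<in>UNIV. w $ j * ?C j (?z \<xi>) $ a $ b) has_derivative
         (\<lambda>v. (\<Sum>j\<in>UNIV. w $ j * (\<Sum>k\<in>UNIV. w $ k * d_z k (\<lambda>z. ?C j z $ a $ b) ?x)) * v
            + (\<Sum>j\<in>UNIV. w $ j * (\<Sum>k\<in>UNIV. cnj (w $ k) * d_zbar k (\<lambda>z. ?C j z $ a $ b) ?x)) * cnj v)) (at \<zeta>)"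
        by (rule has_derivative_eq_rhs[OF has_derivative_sum[OF has_derivative_mult_right[OF has_derivative_line[OF Cd]]]])
           (simp add: fun_eq_iff sum_distrib_right sum.distrib distrib_left mult.assoc)
      have "mat_wirtinger_on D (\<lambda>\<xi>. Hz \<xi> ** ?G (?z \<xi>))
         (\<lambda>\<zeta>. Hzz \<zeta> ** ?G (?z \<zeta>) + Hz \<zeta> ** - (?G (?z \<zeta>) ** Hz \<zeta> ** ?G (?z \<zeta>)))
         (\<lambda>\<zeta>. Hzb \<zeta> ** ?G (?z \<zeta>) + Hz \<zeta> ** - (?G (?z \<zeta>) ** Hb \<zeta> ** ?G (?z \<zeta>)))"
        by (intro mat_wirtinger_on_mult HzW mat_wirtinger_on_inv HW D pos_def_matrix_invertible pd)
           (simp add: D_def)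
      then have 2: "((\<lambda>\<xi>. (Hz \<xi> ** ?G (?z \<xi>)) $ a $ b) has_derivative
          (\<lambda>v. (Hzz \<zeta> ** ?G ?x + Hz \<zeta> ** - (?G ?x ** Hz \<zeta> ** ?G ?x)) $ a $ b * v
             + (Hzb \<zeta> ** ?G ?x + Hz \<zeta> ** - (?G ?x ** Hb \<zeta> ** ?G ?x)) $ a $ b * cnj v)) (at \<zeta>)"
        using z unfolding mat_wirtinger_on_def wirtinger_on_def by blast
      have "(\<Sum>j\<in>UNIV. w $ j * (\<Sum>k\<in>UNIV. cnj (w $ k) * d_zbar k (\<lambda>z. ?C j z $ a $ b) ?x))
          = (Hzb \<zeta> ** ?G ?x + Hz \<zeta> ** - (?G ?x ** Hb \<zeta> ** ?G ?x)) $ a $ b"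
        by (rule wirtinger_derivative_unique(2))
           (rule has_derivative_unique[OF 1[unfolded eq] 2, THEN fun_cong])
      then show ?thesis
        by (simp add: chern_curvature_def sum_distrib_left sum_negf mult.assoc)
    qed
    define y where "y = ?G ?x ** column_matrix (u ?x)"
    define t where "t = (\<chi> j a. w $ j * cnj (y $ a $ 1))"
    have "(\<Sum>j\<in>UNIV. \<Sum>k\<in>UNIV. \<Sum>a\<in>UNIV. \<Sum>b\<in>UNIV.
             (chern_curvature H j k ?x ** H ?x) $ a $ b * t $ j $ a * cnj (t $ k $ b)) = quad ?\<Theta> y"
    proof -
      have contracted: "(\<Sum>j\<in>UNIV. \<Sum>k\<in>UNIV. (chern_curvature H j k ?x ** H ?x) $ a $ b * (w $ j * cnj (w $ k)))
         = ?\<Theta> $ a $ b" for a b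
      proof -
        have "(\<Sum>j\<in>UNIV. \<Sum>k\<in>UNIV. (chern_curvature H j k ?x ** H ?x) $ a $ b * (w $ j * cnj (w $ k)))
          = (\<Sum>c\<in>UNIV. (\<Sum>j\<in>UNIV. \<Sum>k\<in>UNIV. w $ j * cnj (w $ k) * chern_curvature H j k ?x $ a $ c) * H ?x $ c $ b)"
          unfolding matrix_matrix_mult_def vec_lambda_beta sum_distrib_right
          by (subst sum_swap_triple) (simp add: ac_simps)
        also have "\<dots> = (- (Hzb \<zeta> ** ?G ?x + Hz \<zeta> ** - (?G ?x ** Hb \<zeta> ** ?G ?x)) ** H ?x) $ a $ b"
          unfolding curvature by (simp add: matrix_matrix_mult_def)
        also have "- (Hzb \<zeta> ** ?G ?x + Hz \<zeta> ** - (?G ?x ** Hb \<zeta> ** ?G ?x)) ** H ?x = ?\<Theta>"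
          by (simp add: matrix_minus_left matrix_minus_right matrix_mul_add_left matrix_mul_diff_left
              matrix_mul_assoc[symmetric] matrix_inv_both[OF inv])
        finally show ?thesis .
      qed
      have "(\<Sum>j\<in>UNIV. \<Sum>k\<in>UNIV. \<Sum>a\<in>UNIV. \<Sum>b\<in>UNIV.
             (chern_curvature H j k ?x ** H ?x) $ a $ b * t $ j $ a * cnj (t $ k $ b))
          = (\<Sum>a\<in>UNIV. \<Sum>b\<in>UNIV. (\<Sum>j\<in>UNIV. \<Sum>k\<in>UNIV.
             (chern_curvature H j k ?x ** H ?x) $ a $ b * (w $ j * cnj (w $ k))) * cnj (y $ a $ 1) * y $ b $ 1)"
        unfolding t_def vec_lambda_beta sum_distrib_right
        by (subst sum_swap_pairs) (simp add: ac_simps)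
      then show ?thesis by (simp only: contracted quad_expand)
    qed
    moreover have "Re (\<Sum>j\<in>UNIV. \<Sum>k\<in>UNIV. \<Sum>a\<in>UNIV. \<Sum>b\<in>UNIV.
                 W ?x $ j $ k * H ?x $ a $ b * t $ j $ a * cnj (t $ k $ b))
        = Re (\<Sum>j\<in>UNIV. \<Sum>k\<in>UNIV. W ?x $ j $ k * w $ j * cnj (w $ k)) * F ?x"
    proof -
      have "(\<Sum>j\<in>UNIV. \<Sum>k\<in>UNIV. \<Sum>a\<in>UNIV. \<Sum>b\<in>UNIV. W ?x $ j $ k * H ?x $ a $ b * t $ j $ a * cnj (t $ k $ b))
         = (\<Sum>j\<in>UNIV. \<Sum>k\<in>UNIV. W ?x $ j $ k * w $ j * cnj (w $ k)) * quad (H ?x) y"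
        unfolding quad_expand t_def vec_lambda_beta sum_distrib_right
        by (simp add: sum_distrib_left ac_simps)
      moreover have "Im (quad (H ?x) y) = 0"
      proof -
        have "cnj (quad (H ?x) y) = quad (H ?x) y"
          using pd[OF x] by (intro adj_quad) (simp add: pos_def_matrix_def)
        from arg_cong[OF this, of Im] show ?thesis by simp
      qed
      moreover have "Re (quad (H ?x) y) = F ?x"
        unfolding F_def y_def quad_matrix_inv[OF pd[OF x]] ..
      ultimately show ?thesis by simp
    qed
    ultimately have "\<mu> ?x * (Re (\<Sum>j\<in>UNIV. \<Sum>k\<in>UNIV. W ?x $ j $ k * w $ j * cnj (w $ k)) * F ?x)
        \<le> Re (quad ?\<Theta> y)"
      using curv[OF x, of t] by simp
    also have "\<dots> \<le> Re (Fzb \<zeta>)" using F3[OF z] by (simp add: y_def)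
    finally show ?thesis .
  qed
  then show ?thesis
    using F1 F2 unfolding F_def by (intro exI[of _ Fz] exI[of _ Fzz] exI[of _ Fzb] conjI ballI)
qed

section \<open>A mean value inequality on the disc\<close>

lemma unit_interval_mono:
  fixes f :: "real \<Rightarrow> real"
  assumes "\<And>x. x \<in> {0..1} \<Longrightarrow> (f has_real_derivative f' x) (at x within {0..1})"
    and "\<And>x. 0 < x \<Longrightarrow> x < 1 \<Longrightarrow> 0 \<le> f' x" and "r \<in> {0..1}"
  shows "f 0 \<le> f r"
proof (rule DERIV_nonneg_imp_increasing_open[of 0 r f])
  fix x assume x: "0 < x" "x < r"
  then have "(f has_real_derivative f' x) (at x)"
    using assms(1)[of x] assms(3) at_within_interior[of x "{0..1}"] by auto
  then show "\<exists>y. (f has_real_derivative y) (at x) \<and> 0 \<le> y"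
    using assms(2)[of x] assms(3) x by auto
next
  have "continuous_on {0..1} f"
    using assms(1) by (meson DERIV_continuous continuous_on_eq_continuous_within)
  then show "continuous_on {0..r} f"
    by (rule continuous_on_subset) (use assms(3) in auto)
qed (use assms in auto)

text \<open>
  In polar coordinates the components $P = r F_r$ and $Q = F_t / r$ of the gradient satisfy
  $\partial_r P + \partial_t Q = 4 r F_{\zeta\bar\zeta}$.  Integrated over the circle the second term vanishes
  by periodicity.  With $m$ the integral of $F$ over the circle of radius $r$, $K$ that of $\lambda$
  and $k(r) = \int_0^r K$, this reads $(r m')' \ge -4 B r K$, so that
  $r m' + 4 B r k$ is nondecreasing from the value 0; hence $m' \ge -4 B k(1)$, and integration from
  0 to 1 gives the claim.  The weight $r$ of the area element is dropped, which keeps the error an integral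
  over a rectangle.
\<close>

lemma disc_mean_inequality:
  fixes F lam :: "complex \<Rightarrow> real"
  assumes D: "open D" "cball 0 1 \<subseteq> D"
    and F: "\<And>\<zeta>. \<zeta> \<in> D \<Longrightarrow> (F has_derivative (\<lambda>v. 2 * Re (Fz \<zeta> * v))) (at \<zeta>)"
    and Fz: "wirtinger_on D Fz Fzz Fzb"
    and lap: "\<And>\<zeta>. \<zeta> \<in> cball 0 1 \<Longrightarrow> - (B * lam \<zeta>) \<le> Re (Fzb \<zeta>)"
    and lam: "continuous_on D lam" "\<And>\<zeta>. \<zeta> \<in> D \<Longrightarrow> 0 \<le> lam \<zeta>" and B: "0 \<le> B"
  shows "2 * pi * F 0 \<le> integral {0..2*pi} (\<lambda>t. F (cis t))
           + 4 * B * integral (cbox (0, 0) (1, 2*pi)) (\<lambda>(r, t). lam (of_real r * cis t))"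
proof -
  let ?I = "cbox 0 (2*pi)" and ?c = "\<lambda>r t. of_real r * cis t :: complex"
  have inD: "?c r t \<in> D" if "r \<in> {0..1}" for r t
    using that D(2) by (auto simp: norm_mult subset_iff)
  note FzD = wirtinger_on_derivative[OF Fz]
  have cFz: "continuous_on D Fz" "continuous_on D Fzz" "continuous_on D Fzb"
    using Fz wirtinger_on_continuous[OF Fz] by (auto simp: wirtinger_on_def)
  have cF: "continuous_on D F"
    using F by (meson continuous_at_imp_continuous_on has_derivative_continuous)
  have polar: "continuous_on ({0..1} \<times> ?I) (\<lambda>x. g (?c (fst x) (snd x)))"
    if "continuous_on D g" for g :: "complex \<Rightarrow> 'b::topological_space"
    by (rule continuous_on_compose2[OF that]) (auto intro!: continuous_intros inD)
  have circ: "continuous_on S (\<lambda>t. g (?c r t))"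
    if "continuous_on D g" "r \<in> {0..1}" for g :: "complex \<Rightarrow> 'b::topological_space" and r S
    by (rule continuous_on_compose2[OF that(1)]) (auto intro!: continuous_intros inD that)
  have Re_r: "Re (of_real r * z) = r * Re z" for r :: real and z by simp
  have ray: "((\<lambda>x. ?c x t) has_derivative (\<lambda>v. of_real v * cis t)) (at x within S)" for x t :: real and S
    by (auto intro!: derivative_eq_intros)
  have arc: "((\<lambda>t. ?c r t) has_derivative (\<lambda>v. of_real r * (of_real v * (\<i> * cis t)))) (at t within S)"
    for r t :: real and S
    by (auto intro!: derivative_eq_intros simp: scaleR_conv_of_real algebra_simps)
  have rot: "((\<lambda>t. cis t) has_derivative (\<lambda>v. of_real v * (\<i> * cis t))) (at t within S)" for t :: real and S
    using arc[of 1] by simp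
  have FzR: "((\<lambda>x. Re (Fz (?c x t) * cis t)) has_real_derivative
      Re ((Fzz (?c x t) * cis t + Fzb (?c x t) * cnj (cis t)) * cis t)) (at x within {0..1})"
    if "x \<in> {0..1}" for x t
  proof -
    have "((\<lambda>x. Fz (?c x t)) has_vector_derivative
        (Fzz (?c x t) * cis t + Fzb (?c x t) * cnj (cis t))) (at x within {0..1})"
      unfolding has_vector_derivative_def
      by (rule has_derivative_eq_rhs[OF has_derivative_compose[OF ray FzD[OF inD[OF that]]]])
         (simp add: fun_eq_iff scaleR_conv_of_real distrib_left mult.left_commute)
    from bounded_linear.has_vector_derivative[OF bounded_linear_Re has_vector_derivative_mult_left[OF this]]
    show ?thesis by (simp only: has_real_derivative_iff_has_vector_derivative)
  qed
  have FzA: "((\<lambda>t. Re (Fz (?c r t) * (\<i> * cis t))) has_real_derivative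
      Re (Fz (?c r t) * (- cis t) +
        of_real r * (Fzz (?c r t) * (\<i> * cis t) + Fzb (?c r t) * cnj (\<i> * cis t)) * (\<i> * cis t))) (at t within S)"
    if "r \<in> {0..1}" for r t S
  proof -
    have 1: "((\<lambda>t. Fz (?c r t)) has_vector_derivative
        of_real r * (Fzz (?c r t) * (\<i> * cis t) + Fzb (?c r t) * cnj (\<i> * cis t))) (at t within S)"
      unfolding has_vector_derivative_def
      by (rule has_derivative_eq_rhs[OF has_derivative_compose[OF arc FzD[OF inD[OF that]]]])
         (simp add: fun_eq_iff scaleR_conv_of_real algebra_simps)
    have 2: "((\<lambda>t. \<i> * cis t) has_vector_derivative \<i> * (\<i> * cis t)) (at t within S)"
      by (rule has_vector_derivative_mult_right)
         (use rot in \<open>simp add: has_vector_derivative_def scaleR_conv_of_real\<close>)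
    from bounded_linear.has_vector_derivative[OF bounded_linear_Re has_vector_derivative_mult[OF 1 2]]
    show ?thesis by (simp only: has_real_derivative_iff_has_vector_derivative mult.assoc[symmetric] i_squared) (simp add: mult.assoc)
  qed
  define m where "m r = integral ?I (\<lambda>t. F (?c r t))" for r
  define M where "M r = integral ?I (\<lambda>t. 2 * Re (Fz (?c r t) * cis t))" for r
  define K where "K r = integral ?I (\<lambda>t. lam (?c r t))" for r
  have m': "(m has_real_derivative M r) (at r within {0..1})" if r: "r \<in> {0..1}" for r
    unfolding m_def M_def
  proof (rule leibniz_rule_field_derivative)
    fix x t :: real assume "x \<in> {0..1}"
    then show "((\<lambda>x. F (?c x t)) has_real_derivative 2 * Re (Fz (?c x t) * cis t)) (at x within {0..1})"
      unfolding has_field_derivative_def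
      by (intro has_derivative_eq_rhs[OF has_derivative_compose[OF ray F[OF inD]]])
         (auto simp: fun_eq_iff algebra_simps)
  next
    fix x :: real assume "x \<in> {0..1}"
    then show "(\<lambda>t. F (?c x t)) integrable_on ?I"
      by (intro integrable_continuous circ cF)
  next
    show "continuous_on ({0..1} \<times> ?I) (\<lambda>(x, t). 2 * Re (Fz (?c x t) * cis t))"
      unfolding split_beta by (intro continuous_intros polar[OF cFz(1)])
  qed (use r in auto)
  \<comment> \<open>The radial derivative of $r F_r$.\<close>
  define dP where "dP r t = 2 * Re (Fz (?c r t) * cis t)
      + r * (2 * Re ((Fzz (?c r t) * cis t + Fzb (?c r t) * cnj (cis t)) * cis t))" for r t
  \<comment> \<open>The angular derivative of $F_t / r$, whose integral over the circle vanishes.\<close>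
  define dQ where "dQ r t = 2 * Re (Fz (?c r t) * (- cis t))
      + r * (2 * Re ((Fzz (?c r t) * (\<i> * cis t) + Fzb (?c r t) * cnj (\<i> * cis t)) * (\<i> * cis t)))" for r t
  have P': "((\<lambda>r. r * M r) has_real_derivative integral ?I (dP r)) (at r within {0..1})"
    if r: "r \<in> {0..1}" for r
  proof -
    have "((\<lambda>r. integral ?I (\<lambda>t. r * (2 * Re (Fz (?c r t) * cis t)))) has_real_derivative
            integral ?I (dP r)) (at r within {0..1})"
    proof (rule leibniz_rule_field_derivative)
      fix x t :: real assume "x \<in> {0..1}"
      then show "((\<lambda>x. x * (2 * Re (Fz (?c x t) * cis t))) has_real_derivative dP x t) (at x within {0..1})"
        unfolding dP_def
        by (intro DERIV_cong[OF DERIV_mult[OF DERIV_ident DERIV_cmult[OF FzR]]]) simp_all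
    next
      fix x :: real assume "x \<in> {0..1}"
      then show "(\<lambda>t. x * (2 * Re (Fz (?c x t) * cis t))) integrable_on ?I"
        by (intro integrable_continuous continuous_intros circ cFz)
    next
      show "continuous_on ({0..1} \<times> ?I) (\<lambda>(x, t). dP x t)"
        unfolding split_beta dP_def by (intro continuous_intros polar cFz)
    qed (use r in auto)
    then show ?thesis unfolding M_def by simp
  qed
  have Q: "(dQ r has_integral 0) ?I" if r: "r \<in> {0..1}" for r
  proof -
    have "(dQ r has_integral
        (2 * Re (Fz (?c r (2*pi)) * (\<i> * cis (2*pi))) - 2 * Re (Fz (?c r 0) * (\<i> * cis 0)))) {0..2*pi}"
    proof (rule fundamental_theorem_of_calculus)
      fix t :: real
      show "((\<lambda>t. 2 * Re (Fz (?c r t) * (\<i> * cis t))) has_vector_derivative dQ r t) (at t within {0..2*pi})"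
        unfolding has_real_derivative_iff_has_vector_derivative[symmetric]
        by (rule DERIV_cong[OF DERIV_cmult[OF FzA[OF r]]])
           (simp only: dQ_def plus_complex.sel mult.assoc Re_r, simp only: algebra_simps)
    qed simp
    then show ?thesis by simp
  qed
  have sum: "dP r t + dQ r t = r * (4 * Re (Fzb (?c r t)))" for r t
  proof -
    have c: "cis t * cis (- t) = 1" by (simp add: cis_mult)
    have "dP r t + dQ r t = r * (2 * Re ((Fzz (?c r t) * cis t + Fzb (?c r t) * cnj (cis t)) * cis t
       + (Fzz (?c r t) * (\<i> * cis t) + Fzb (?c r t) * cnj (\<i> * cis t)) * (\<i> * cis t)))"
      unfolding dP_def dQ_def plus_complex.sel mult_minus_right uminus_complex.sel
      by (simp only: algebra_simps)
    also have "(Fzz (?c r t) * cis t + Fzb (?c r t) * cnj (cis t)) * cis t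
       + (Fzz (?c r t) * (\<i> * cis t) + Fzb (?c r t) * cnj (\<i> * cis t)) * (\<i> * cis t)
       = 2 * Fzb (?c r t)"
      using c by (simp add: cis_cnj algebra_simps)
    finally show ?thesis by simp
  qed
  have lam_circ: "continuous_on ?I (\<lambda>t. lam (?c r t))" if "r \<in> {0..1}" for r
    by (rule circ[OF lam(1) that])
  have P'_ge: "- (4 * B * r * K r) \<le> integral ?I (dP r)" if r: "r \<in> {0..1}" for r
  proof -
    have "continuous_on ?I (\<lambda>t. dP r t)"
      unfolding dP_def by (intro continuous_intros circ[OF cFz(1) r] circ[OF cFz(2) r] circ[OF cFz(3) r])
    then have int: "dP r integrable_on ?I" by (rule integrable_continuous)
    have "integral ?I (\<lambda>t. dP r t + dQ r t) = integral ?I (dP r) + integral ?I (dQ r)"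
      by (rule integral_add[OF int has_integral_integrable[OF Q[OF r]]])
    then have "integral ?I (dP r) = integral ?I (\<lambda>t. r * (4 * Re (Fzb (?c r t))))"
      using integral_unique[OF Q[OF r]] by (simp only: sum add_0_right)
    moreover have "integral ?I (\<lambda>t. - (4 * B * r) * lam (?c r t)) \<le> integral ?I (\<lambda>t. r * (4 * Re (Fzb (?c r t))))"
    proof (rule integral_le)
      show "(\<lambda>t. - (4 * B * r) * lam (?c r t)) integrable_on ?I"
        by (rule integrable_continuous, rule continuous_on_mult_left, rule lam_circ[OF r])
      show "(\<lambda>t. r * (4 * Re (Fzb (?c r t)))) integrable_on ?I"
        by (rule integrable_continuous)
           (rule continuous_on_mult_left continuous_on_Re circ[OF cFz(3) r])+
      fix t
      have "r * (4 * - (B * lam (?c r t))) \<le> r * (4 * Re (Fzb (?c r t)))"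
        by (intro mult_left_mono lap) (use r in \<open>auto simp: norm_mult\<close>)
      then show "- (4 * B * r) * lam (?c r t) \<le> r * (4 * Re (Fzb (?c r t)))"
        by (metis mult.assoc mult.commute mult_minus_right)
    qed
    moreover have "integral ?I (\<lambda>t. - (4 * B * r) * lam (?c r t)) = - (4 * B * r * K r)"
      unfolding K_def integral_mult_right by (rule mult_minus_left)
    ultimately show ?thesis by linarith
  qed
  have Kpos: "0 \<le> K r" if "r \<in> {0..1}" for r
    unfolding K_def by (rule integral_nonneg[OF integrable_continuous[OF lam_circ[OF that]] lam(2)[OF inD[OF that]]])
  have Kc: "continuous_on {0..1} K"
    unfolding K_def
    by (rule integral_continuous_on_param) (use polar[OF lam(1)] in \<open>simp add: split_beta\<close>)
  define k where "k r = integral {0..r} K" for r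
  have k': "(k has_real_derivative K r) (at r within {0..1})" if "r \<in> {0..1}" for r
    unfolding k_def using integral_has_real_derivative[OF Kc that] .
  have kpos: "0 \<le> k r" and kle: "k r \<le> k 1" if r: "r \<in> {0..1}" for r
  proof -
    have int: "K integrable_on {0..s}" if "s \<in> {0..1}" for s
      by (rule integrable_continuous_real, rule continuous_on_subset[OF Kc]) (use that in auto)
    show "0 \<le> k r"
      unfolding k_def by (intro integral_nonneg int r Kpos) (use r in auto)
    show "k r \<le> k 1"
      unfolding k_def by (rule integral_subset_le) (use r int Kpos in auto)
  qed
  have M_ge: "- (4 * B * k 1) \<le> M r" if r: "0 < r" "r < 1" for r
  proof -
    have "0 * M 0 + 4 * B * 0 * k 0 \<le> r * M r + 4 * B * r * k r"
    proof (rule unit_interval_mono[where f = "\<lambda>r. r * M r + 4 * B * r * k r"])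
      fix x :: real assume x: "x \<in> {0..1}"
      show "((\<lambda>r. r * M r + 4 * B * r * k r) has_real_derivative
        integral ?I (dP x) + (4 * B * k x + 4 * B * x * K x)) (at x within {0..1})"
        by (rule DERIV_add[OF P'[OF x] DERIV_cong[OF DERIV_mult[OF DERIV_cmult[OF DERIV_ident] k'[OF x]]]]) simp_all
    next
      fix x :: real assume x: "0 < x" "x < 1"
      then have "0 \<le> 4 * B * k x" using B kpos[of x] by simp
      with x P'_ge[of x] show "0 \<le> integral ?I (dP x) + (4 * B * k x + 4 * B * x * K x)"
        by simp
    qed (use r in auto)
    then have "0 \<le> r * (M r + 4 * B * k r)" by (simp add: algebra_simps)
    then have "0 \<le> M r + 4 * B * k r" using r by (simp add: zero_le_mult_iff)
    moreover have "4 * B * k r \<le> 4 * B * k 1" using kle[of r] B r by (intro mult_left_mono) auto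
    ultimately show ?thesis by simp
  qed
  have "m 0 + 4 * B * k 1 * 0 \<le> m 1 + 4 * B * k 1 * 1"
  proof (rule unit_interval_mono[where f = "\<lambda>r. m r + 4 * B * k 1 * r"])
    fix x :: real assume x: "x \<in> {0..1}"
    show "((\<lambda>r. m r + 4 * B * k 1 * r) has_real_derivative M x + 4 * B * k 1) (at x within {0..1})"
      by (rule DERIV_cong[OF DERIV_add[OF m'[OF x] DERIV_cmult[OF DERIV_ident]]]) simp
  next
    fix x :: real assume "0 < x" "x < 1"
    from M_ge[OF this] show "0 \<le> M x + 4 * B * k 1" by linarith
  qed auto
  moreover have "m 0 = 2 * pi * F 0" "m 1 = integral {0..2*pi} (\<lambda>t. F (cis t))"
    unfolding m_def by simp_all
  moreover have "k 1 = integral (cbox (0, 0) (1, 2*pi)) (\<lambda>(r, t). lam (?c r t))"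
  proof -
    have "continuous_on (cbox (0, 0) (1, 2*pi)) (\<lambda>(r, t). lam (?c r t))"
      using polar[OF lam(1)] by (simp add: split_beta cbox_Pair_eq)
    from integral_prod_continuous[OF this] show ?thesis by (simp add: k_def K_def[abs_def])
  qed
  ultimately show ?thesis by simp
qed

section \<open>Null sets, lines and plurisubharmonic limits\<close>

lemma continuous_on_complex_scaling [continuous_intros]:
  fixes v :: "'a::topological_space \<Rightarrow> complex^'n"
  assumes "continuous_on S c" "continuous_on S v"
  shows "continuous_on S (\<lambda>x. c x *s v x)"
  unfolding vector_scalar_mult_def using assms by (intro continuous_intros)

lemma AE_lborel_negligible:
  assumes "AE x in lborel. P x"
  shows "negligible {x :: 'a::euclidean_space. \<not> P x}"
proof -
  obtain N where "N \<in> null_sets lborel" "{x. \<not> P x} \<subseteq> N"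
    using assms by (auto simp: eventually_ae_filter)
  then show ?thesis
    by (meson negligible_iff_null_sets negligible_subset null_sets_completionI)
qed

lemma negligible_lborel_superset:
  fixes N :: "'a::euclidean_space set"
  assumes "negligible N"
  obtains N' where "N \<subseteq> N'" "N' \<in> null_sets lborel"
  using assms unfolding negligible_iff_null_sets null_sets_completion_iff2 by blast

lemma negligible_complex_scaling_preimage:
  fixes N :: "(complex^'n) set"
  assumes "negligible N" "c \<noteq> 0"
  shows "negligible {w. z + c *s w \<in> N}"
proof -
  have "linear (\<lambda>v::complex^'n. inverse c *s v)"
    by (rule linearI) (auto simp: vector_scalar_mult_def vec_eq_iff algebra_simps)
  then have "negligible ((\<lambda>v. inverse c *s v) ` ((+) (- z) ` N))"
    by (intro negligible_differentiable_image_negligible negligible_translation assms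
        linear_imp_differentiable_on) simp_all
  moreover have "{w. z + c *s w \<in> N} \<subseteq> (\<lambda>v. inverse c *s v) ` ((+) (- z) ` N)"
  proof
    fix w assume "w \<in> {w. z + c *s w \<in> N}"
    moreover have "w = inverse c *s (- z + (z + c *s w))"
      using assms(2) by (simp add: vec_eq_iff)
    ultimately show "w \<in> (\<lambda>v. inverse c *s v) ` ((+) (- z) ` N)" by blast
  qed
  ultimately show ?thesis by (rule negligible_subset)
qed

text \<open>
  By Fubini it suffices to look at the exceptional set of $w$ for a fixed parameter $y$.  For
  $c(y) \ne 0$ it is the image of \<open>N\<close> under an invertible affine map, hence null.  The cases needed
  are circles, $c(t) = e^{it}$, and discs, $c(r,t) = r e^{it}$.
\<close>

lemma almost_all_lines_avoid_null_set:
  fixes N :: "(complex^'n) set" and c :: "'a::euclidean_space \<Rightarrow> complex"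
  assumes N: "negligible N" and c: "continuous_on UNIV c" and c0: "negligible {y. c y = 0}"
  obtains Z where "negligible Z" "\<And>w. w \<notin> Z \<Longrightarrow> negligible {y. z + c y *s w \<in> N}"
proof -
  obtain N' where N': "N \<subseteq> N'" "N' \<in> null_sets lborel"
    using negligible_lborel_superset[OF N] .
  then have negl: "negligible N'"
    by (simp add: negligible_iff_null_sets null_sets_completionI)
  let ?f = "\<lambda>x::(complex^'n) \<times> 'a. z + c (snd x) *s fst x"
  have "continuous_on UNIV ?f"
    by (intro continuous_intros continuous_on_compose2[OF c]) auto
  then have "?f \<in> borel_measurable (borel \<Otimes>\<^sub>M borel)"
    by (simp add: borel_prod borel_measurable_continuous_onI)
  moreover have "N' \<in> sets borel" using N' by auto
  ultimately have meas: "{x \<in> space (lborel \<Otimes>\<^sub>M lborel). ?f x \<notin> N'} \<in> sets (lborel \<Otimes>\<^sub>M lborel)"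
  proof -
    assume f: "?f \<in> borel_measurable (borel \<Otimes>\<^sub>M borel)" and "N' \<in> sets borel"
    then have "- N' \<in> sets borel" by auto
    from measurable_sets[OF f this]
    have "?f -` (- N') \<inter> space (borel \<Otimes>\<^sub>M borel) \<in> sets (borel \<Otimes>\<^sub>M borel)" .
    moreover have "sets (lborel \<Otimes>\<^sub>M lborel) = sets ((borel :: (complex^'n) measure) \<Otimes>\<^sub>M (borel :: 'a measure))"
      by (rule sets_pair_measure_cong) auto
    moreover have "?f -` (- N') \<inter> space (borel \<Otimes>\<^sub>M borel) = {x \<in> space (lborel \<Otimes>\<^sub>M lborel). ?f x \<notin> N'}"
      by (auto simp: space_pair_measure)
    ultimately show ?thesis by simp
  qed
  have "AE y in lborel. AE w in lborel. z + c y *s w \<notin> N'"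
  proof -
    have "AE y in lborel. c y \<noteq> 0"
    proof -
      obtain C where "{y. c y = 0} \<subseteq> C" "C \<in> null_sets lborel"
        using negligible_lborel_superset[OF c0] .
      then show ?thesis by (auto simp: eventually_ae_filter)
    qed
    then show ?thesis
    proof eventually_elim
      case (elim y)
      obtain C where "{w. z + c y *s w \<in> N'} \<subseteq> C" "C \<in> null_sets lborel"
        using negligible_lborel_superset[OF negligible_complex_scaling_preimage[OF negl elim]] .
      then show ?case by (auto simp: eventually_ae_filter)
    qed
  qed
  then have AE: "AE w in lborel. AE y in lborel. z + c y *s w \<notin> N'"
    using lborel_pair.AE_commute[of "\<lambda>w y. z + c y *s w \<notin> N'"] meas by simp
  show thesis
  proof (rule that[OF AE_lborel_negligible[OF AE]])
    fix w assume "w \<notin> {w. \<not> (AE y in lborel. z + c y *s w \<notin> N')}"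
    then have "AE y in lborel. z + c y *s w \<notin> N'" by simp
    from AE_lborel_negligible[OF this] show "negligible {y. z + c y *s w \<in> N}"
      by (rule negligible_subset) (use N' in auto)
  qed
qed

lemma norm_complex_scaling: "norm (c *s v) = cmod c * norm (v :: complex^'n)"
  unfolding norm_vec_def by (simp add: norm_mult L2_set_right_distrib)

lemma exists_near_off_null_set:
  fixes Z :: "'a::euclidean_space set"
  assumes "negligible Z" "0 < e"
  obtains w where "w \<notin> Z" "dist w w0 < e"
proof -
  have "\<not> ball w0 e \<subseteq> Z"
    using assms open_not_negligible[of "ball w0 e"] negligible_subset by auto
  then obtain w where "w \<in> ball w0 e" "w \<notin> Z" by blast
  then show thesis using that by (simp add: dist_commute)
qed

text \<open>
  If $F_2(z) < c < F_1(z)$, then $F_2 < c$ near $z$ by semicontinuity.  On almost every small circle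
  around $z$ the two functions agree almost everywhere, so the circle mean of $F_1$, which is at least
  $F_1(z)$, is at most $c$.
\<close>

lemma psh_on_le_off_null_set:
  fixes F1 F2 :: "complex^'n \<Rightarrow> real"
  assumes \<Omega>: "open \<Omega>" and F1: "psh_on \<Omega> F1" and F2: "psh_on \<Omega> F2"
    and N: "negligible N" and eq: "\<And>z. z \<in> \<Omega> - N \<Longrightarrow> F1 z = F2 z" and z: "z \<in> \<Omega>"
  shows "F1 z \<le> F2 z"
proof (rule ccontr)
  assume "\<not> F1 z \<le> F2 z"
  then obtain c where c: "F2 z < c" "c < F1 z" using dense not_le by metis
  have "openin (top_of_set \<Omega>) {z \<in> \<Omega>. F2 z < c}" using F2 by (simp add: psh_on_def)
  then have "open {z \<in> \<Omega>. F2 z < c}" using \<Omega> by (simp add: openin_open_eq)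
  then obtain e where e: "0 < e" "ball z e \<subseteq> {z \<in> \<Omega>. F2 z < c}"
    using z c open_contains_ball by (metis (mono_tags, lifting) mem_Collect_eq)
  have "continuous_on UNIV cis" by (intro continuous_intros)
  moreover have "{y. cis y = 0} = {}" by auto
  ultimately obtain Z where Z: "negligible Z" "\<And>w. w \<notin> Z \<Longrightarrow> negligible {t. z + cis t *s w \<in> N}"
    using almost_all_lines_avoid_null_set[OF N, of cis z] by (metis negligible_empty)
  obtain w where w: "w \<notin> Z" "dist w 0 < e"
    using exists_near_off_null_set[OF Z(1) e(1)] .
  have disc: "z + \<zeta> *s w \<in> {z \<in> \<Omega>. F2 z < c}" if "cmod \<zeta> \<le> 1" for \<zeta>
  proof -
    have "norm (\<zeta> *s w) \<le> 1 * norm w"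
      unfolding norm_complex_scaling using that by (intro mult_right_mono) auto
    then have "z + \<zeta> *s w \<in> ball z e" using w by (simp add: dist_norm)
    then show ?thesis using e by blast
  qed
  let ?F1 = "\<lambda>t. F1 (z + cis t *s w)" and ?F2 = "\<lambda>t. F2 (z + cis t *s w)"
  have "F1 z \<le> integral {0..2*pi} ?F1 / (2*pi)"
    using F1 disc by (auto simp: psh_on_def)
  also have "integral {0..2*pi} ?F1 = integral {0..2*pi} ?F2"
    by (rule integral_spike[OF Z(2)[OF w(1)]]) (use eq disc in \<open>auto\<close>)
  also have "integral {0..2*pi} ?F2 \<le> integral {0..2*pi} (\<lambda>t. c)"
  proof (rule integral_le)
    show "?F2 integrable_on {0..2*pi}"
      using F2 disc unfolding psh_on_def by (auto intro: set_lebesgue_integral_eq_integral(1))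
    show "F2 (z + cis t *s w) \<le> c" for t
      using disc[of "cis t"] by auto
  qed auto
  finally have "F1 z \<le> c" by (simp add: divide_right_mono)
  with c show False by simp
qed

text \<open>
  The approximants satisfy the sub-mean value inequality with an error that vanishes in the limit
  only for discs on which $\lambda_s \to 0$ almost everywhere.  For those discs the limit satisfies
  $2\pi F(z) \le \int f_s$ for every $s$.  The right-hand side is continuous in the direction $w$ of the
  disc and such $w$ are dense, so the inequality extends to all discs before $s$ tends to infinity.
\<close>

lemma psh_on_decreasing_limit:
  fixes f :: "nat \<Rightarrow> complex^'n \<Rightarrow> real"
  assumes \<Omega>: "open \<Omega>"
    and f: "\<And>s. continuous_on \<Omega> (f s)" "\<And>s z. z \<in> \<Omega> \<Longrightarrow> f (Suc s) z \<le> f s z"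
      "\<And>s z. z \<in> \<Omega> \<Longrightarrow> 0 \<le> f s z" "\<And>z. z \<in> \<Omega> \<Longrightarrow> (\<lambda>s. f s z) \<longlonglongrightarrow> F z"
    and lam: "\<And>s. continuous_on \<Omega> (lam s)" "\<And>s z. z \<in> \<Omega> \<Longrightarrow> 0 \<le> lam s z"
      "\<And>s z. z \<in> \<Omega> \<Longrightarrow> lam s z \<le> l z" "continuous_on \<Omega> l"
      "negligible N" "\<And>z. z \<in> \<Omega> - N \<Longrightarrow> (\<lambda>s. lam s z) \<longlonglongrightarrow> 0"
    and mean: "\<And>z w. (\<And>\<zeta>. cmod \<zeta> \<le> 1 \<Longrightarrow> z + \<zeta> *s w \<in> \<Omega>) \<Longrightarrow>
      \<exists>B. \<forall>s. 2 * pi * f s z \<le> integral {0..2*pi} (\<lambda>t. f s (z + cis t *s w))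
        + B * integral (cbox (0, 0) (1, 2*pi)) (\<lambda>(r, t). lam s (z + (of_real r * cis t) *s w))"
  shows "psh_on \<Omega> F"
proof -
  have mono: "f s z \<le> f s' z" if "z \<in> \<Omega>" "s' \<le> s" for s s' z
    using that(2) f(2)[OF that(1)] by (rule lift_Suc_antimono_le[rotated])
  have Fle: "F z \<le> f s z" if "z \<in> \<Omega>" for s z
    by (rule LIMSEQ_le_const2[OF f(4)[OF that]]) (use mono[OF that] in auto)
  have usc: "openin (top_of_set \<Omega>) {z \<in> \<Omega>. F z < c}" for c
  proof -
    have "{z \<in> \<Omega>. F z < c} = (\<Union>s. {z \<in> \<Omega>. f s z < c})"
    proof (intro equalityI subsetI)
      fix z assume "z \<in> {z \<in> \<Omega>. F z < c}"
      then have z: "z \<in> \<Omega>" "F z < c" by auto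
      then obtain s where "f s z < c"
        using order_tendstoD(2)[OF f(4)[OF z(1)] z(2)] by (auto simp: eventually_sequentially)
      with z show "z \<in> (\<Union>s. {z \<in> \<Omega>. f s z < c})" by auto
    next
      fix z assume "z \<in> (\<Union>s. {z \<in> \<Omega>. f s z < c})"
      then show "z \<in> {z \<in> \<Omega>. F z < c}" using le_less_trans[OF Fle] by blast
    qed
    moreover have "openin (top_of_set \<Omega>) {z \<in> \<Omega>. f s z < c}" for s
      using continuous_openin_preimage_gen[OF f(1)[of s], of "{..<c}"] by (simp add: vimage_def Int_def)
    ultimately show ?thesis by auto
  qed
  have circ: "continuous_on {0..2*pi} (\<lambda>t. g (z + cis t *s w))"
    if "\<And>\<zeta>. cmod \<zeta> \<le> 1 \<Longrightarrow> z + \<zeta> *s w \<in> \<Omega>" "continuous_on \<Omega> g" for g :: "complex^'n \<Rightarrow> real" and z w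
    by (rule continuous_on_compose2[OF that(2)])
       (use that(1) in \<open>auto intro!: continuous_intros\<close>)
  have lim: "(\<lambda>t. F (z + cis t *s w)) integrable_on {0..2*pi}"
    "(\<lambda>s. integral {0..2*pi} (\<lambda>t. f s (z + cis t *s w))) \<longlonglongrightarrow> integral {0..2*pi} (\<lambda>t. F (z + cis t *s w))"
    if "\<And>\<zeta>. cmod \<zeta> \<le> 1 \<Longrightarrow> z + \<zeta> *s w \<in> \<Omega>" for z w
  proof -
    note int = integrable_continuous_real[OF circ[OF that f(1)]]
    have le: "norm (f s (z + cis t *s w)) \<le> f 0 (z + cis t *s w)" for s t
      using f(3)[OF that] mono[OF that] by simp
    show "(\<lambda>t. F (z + cis t *s w)) integrable_on {0..2*pi}"
      "(\<lambda>s. integral {0..2*pi} (\<lambda>t. f s (z + cis t *s w))) \<longlonglongrightarrow> integral {0..2*pi} (\<lambda>t. F (z + cis t *s w))"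
      using dominated_convergence[OF int int le f(4)] that by auto
  qed
  have sub: "2 * pi * F z \<le> integral {0..2*pi} (\<lambda>t. F (z + cis t *s w0))"
    if disc0: "\<And>\<zeta>. cmod \<zeta> \<le> 1 \<Longrightarrow> z + \<zeta> *s w0 \<in> \<Omega>" for z w0
  proof -
    have z: "z \<in> \<Omega>" using disc0[of 0] by simp
    let ?Q = "cbox (0, 0) (1, 2*pi) :: (real \<times> real) set"
    let ?c = "\<lambda>y::real \<times> real. of_real (fst y) * cis (snd y)"
    have cont_c: "continuous_on UNIV ?c" by (intro continuous_intros)
    have null_c: "negligible {y. ?c y = 0}"
    proof -
      have "negligible {y::real \<times> real. y \<bullet> (1, 0) = 0}"
        by (rule negligible_standard_hyperplane) (simp add: Basis_prod_def)
      then show ?thesis by (rule negligible_subset) (auto simp: inner_prod_def)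
    qed
    obtain Z where Z: "negligible Z" "\<And>w. w \<notin> Z \<Longrightarrow> negligible {y. z + ?c y *s w \<in> N}"
    proof (rule almost_all_lines_avoid_null_set[OF lam(5) cont_c null_c, of z])
      fix Z' assume "negligible Z'" "\<And>w. w \<notin> Z' \<Longrightarrow> negligible {y. z + ?c y *s w \<in> N}"
      then show thesis by (rule that)
    qed
    \<comment> \<open>Use the inequality for $s' \ge s$ and let $s'$ tend to infinity with $s$ fixed.\<close>
    have good: "2 * pi * F z \<le> integral {0..2*pi} (\<lambda>t. f s (z + cis t *s w))"
      if disc: "\<And>\<zeta>. cmod \<zeta> \<le> 1 \<Longrightarrow> z + \<zeta> *s w \<in> \<Omega>" and w: "w \<notin> Z" for w s
    proof -
      have in\<Omega>: "z + ?c y *s w \<in> \<Omega>" if "y \<in> ?Q" for y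
        using that by (intro disc) (auto simp: cbox_Pair_eq norm_mult mem_Times_iff)
      have cont: "continuous_on ?Q (\<lambda>y. g (z + ?c y *s w))" if "continuous_on \<Omega> g" for g :: "complex^'n \<Rightarrow> real"
        by (rule continuous_on_compose2[OF that]) (intro continuous_intros, use in\<Omega> in blast)
      let ?Y = "{y. z + ?c y *s w \<in> N}"
      let ?e = "\<lambda>s. integral ?Q (\<lambda>y. lam s (z + ?c y *s w))"
      have "?e \<longlonglongrightarrow> 0"
      proof -
        let ?g = "\<lambda>s y. if y \<in> ?Y then 0 else lam s (z + ?c y *s w)"
        have "(\<lambda>s. integral ?Q (?g s)) \<longlonglongrightarrow> integral ?Q (\<lambda>y. 0)"
        proof (rule dominated_convergence)
          show "?g s integrable_on ?Q" for s
            by (rule integrable_spike[OF integrable_continuous[OF cont[OF lam(1)]] Z(2)[OF w]]) auto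
          show "(\<lambda>y. l (z + ?c y *s w)) integrable_on ?Q"
            by (rule integrable_continuous[OF cont[OF lam(4)]])
          show "norm (?g s y) \<le> l (z + ?c y *s w)" if "y \<in> ?Q" for s y
            using lam(2,3)[OF in\<Omega>[OF that], of s] by auto
          show "(\<lambda>s. ?g s y) \<longlonglongrightarrow> 0" if "y \<in> ?Q" for y
            using lam(6) in\<Omega>[OF that] by (cases "z + ?c y *s w \<in> N") auto
        qed
        moreover have "integral ?Q (?g s) = ?e s" for s
          by (rule integral_spike[OF Z(2)[OF w]]) auto
        ultimately show ?thesis by simp
      qed
      obtain B where B: "\<And>s. 2 * pi * f s z \<le> integral {0..2*pi} (\<lambda>t. f s (z + cis t *s w)) + B * ?e s"
        using mean[OF disc] unfolding case_prod_unfold by blast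
      have "(\<lambda>s'. integral {0..2*pi} (\<lambda>t. f s (z + cis t *s w)) + B * ?e s')
          \<longlonglongrightarrow> integral {0..2*pi} (\<lambda>t. f s (z + cis t *s w)) + B * 0"
        by (intro tendsto_intros \<open>?e \<longlonglongrightarrow> 0\<close>)
      moreover have "2 * pi * F z \<le> integral {0..2*pi} (\<lambda>t. f s (z + cis t *s w)) + B * ?e s'" if "s \<le> s'" for s'
      proof -
        have "2 * pi * F z \<le> 2 * pi * f s' z" using Fle[OF z] by simp
        also note B
        also have "integral {0..2*pi} (\<lambda>t. f s' (z + cis t *s w)) \<le> integral {0..2*pi} (\<lambda>t. f s (z + cis t *s w))"
          by (rule integral_le[OF integrable_continuous_real[OF circ[OF disc f(1)]]
                integrable_continuous_real[OF circ[OF disc f(1)]] mono[OF disc that]]) simp_all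
        finally show ?thesis by simp
      qed
      ultimately have "2 * pi * F z \<le> integral {0..2*pi} (\<lambda>t. f s (z + cis t *s w)) + B * 0"
        by (intro LIMSEQ_le_const[of _ _ "2 * pi * F z"] exI[of _ s]) blast+
      then show ?thesis by simp
    qed
    let ?disc = "(\<lambda>\<zeta>. z + \<zeta> *s w0) ` cball 0 1"
    have "compact ?disc"
      by (intro compact_continuous_image continuous_intros) simp
    moreover have "?disc \<subseteq> \<Omega>" using disc0 by auto
    ultimately obtain d where d: "0 < d" "(\<Union>x\<in>?disc. ball x d) \<subseteq> \<Omega>"
      using compact_subset_open_imp_ball_epsilon_subset[OF _ \<Omega>] by blast
    have disc: "z + \<zeta> *s w \<in> \<Omega>" if "dist w w0 < d" "cmod \<zeta> \<le> 1" for w \<zeta>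
    proof -
      have "norm (\<zeta> *s (w - w0)) \<le> 1 * norm (w - w0)"
        unfolding norm_complex_scaling using that by (intro mult_right_mono) auto
      then have "z + \<zeta> *s w \<in> ball (z + \<zeta> *s w0) d"
        using that by (simp add: dist_norm vector_ssub_ldistrib norm_minus_commute)
      moreover have "z + \<zeta> *s w0 \<in> ?disc" using that(2) by auto
      ultimately show ?thesis using d(2) by blast
    qed
    \<comment> \<open>Approximate $w_0$ by good directions; $s$ is still fixed, so the integrand is continuous.\<close>
    have all: "2 * pi * F z \<le> integral {0..2*pi} (\<lambda>t. f s (z + cis t *s w0))" for s
    proof -
      let ?B = "ball w0 (d / 2) - Z"
      have "w0 \<in> closure ?B"
        unfolding closure_approachable
      proof (intro allI impI)
        fix e :: real assume "0 < e"
        then have "0 < min e (d / 2)" using d by simp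
        from exists_near_off_null_set[OF Z(1) this, of w0]
        obtain w where "w \<notin> Z" "dist w w0 < min e (d / 2)" .
        then show "\<exists>y\<in>?B. dist y w0 < e" by (intro bexI[of _ w]) (simp_all add: dist_commute)
      qed
      have cl: "closure ?B \<subseteq> cball w0 (d / 2)"
        by (rule closure_minimal) auto
      have "continuous_on (cball w0 (d / 2)) (\<lambda>w. integral (cbox 0 (2*pi)) (\<lambda>t. f s (z + cis t *s w)))"
      proof (rule integral_continuous_on_param)
        show "continuous_on (cball w0 (d / 2) \<times> cbox 0 (2*pi)) (\<lambda>(w, t). f s (z + cis t *s w))"
          unfolding split_beta
          by (rule continuous_on_compose2[OF f(1)[of s]])
             (intro continuous_intros, clarsimp, rule disc, use d(1) in \<open>simp_all add: dist_commute\<close>)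
      qed
      then have "continuous_on (closure ?B) (\<lambda>w. integral {0..2*pi} (\<lambda>t. f s (z + cis t *s w)))"
        using continuous_on_subset[OF _ cl] by simp
      then show ?thesis
      proof (rule continuous_ge_on_closure[OF _ \<open>w0 \<in> closure ?B\<close>])
        fix w assume w: "w \<in> ?B"
        then have "dist w w0 < d" using d(1) by (simp add: dist_commute)
        then show "2 * pi * F z \<le> integral {0..2*pi} (\<lambda>t. f s (z + cis t *s w))"
          by (intro good disc) (use w in simp_all)
      qed
    qed
    show ?thesis
      by (rule LIMSEQ_le_const[OF lim(2)[OF disc0]]) (use all in auto)
  qed
  show ?thesis
    unfolding psh_on_def
  proof (intro conjI allI impI usc)
    fix z w assume "\<forall>\<zeta>. cmod \<zeta> \<le> 1 \<longrightarrow> z + \<zeta> *s w \<in> \<Omega>"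
    then have disc: "z + \<zeta> *s w \<in> \<Omega>" if "cmod \<zeta> \<le> 1" for \<zeta> using that by blast
    have "0 \<le> F x" if "x \<in> \<Omega>" for x
      by (rule LIMSEQ_le_const[OF f(4)[OF that]]) (use f(3)[OF that] in auto)
    then show "(\<lambda>t. F (z + cis t *s w)) absolutely_integrable_on {0..2*pi}"
      using lim(1)[OF disc] disc by (intro nonnegative_absolutely_integrable_1) auto
    show "F z \<le> integral {0..2*pi} (\<lambda>t. F (z + cis t *s w)) / (2*pi)"
      using sub[OF disc] by (simp add: field_simps)
  qed
qed

section \<open>Gram matrices and dual metrics\<close>

text \<open>
  The reason is the variational formula $u^* G u = \max_v\, (2 \mathrm{Re}(v^* u) - v^* H v)$: evaluating the
  expression for $H$ at the maximizer $v = G'u$ belonging to $H'$ gives a lower bound for $u^* G u$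
  and, as $H \le H'$, an upper bound for $u^* G' u$.
\<close>

lemma quad_inverse_antimono:
  fixes H H' :: "complex^'r^'r"
  assumes H: "pos_def_matrix H" and H': "pos_def_matrix H'"
    and le: "\<And>y. Re (quad H y) \<le> Re (quad H' y)"
  shows "Re (quad (matrix_inv H') u) \<le> Re (quad (matrix_inv H) u)"
proof -
  let ?G = "matrix_inv H" and ?G' = "matrix_inv H'"
  have inv: "invertible H" "invertible H'" and adj: "adj H = H" "adj H' = H'"
    using H H' pos_def_matrix_invertible by (auto simp: pos_def_matrix_def)
  note adjG = adj_matrix_inv[OF adj(1) inv(1)] adj_matrix_inv[OF adj(2) inv(2)]
  define v where "v = ?G' ** u"
  have "quad H (v - ?G ** u) = quad H v - quad ?G' u - quad ?G' u + quad ?G u"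
    unfolding v_def
    by (simp add: adj_diff adj_mult adjG matrix_mul_diff_left matrix_mul_diff_right matrix_mul_assoc[symmetric]
        matrix_inv_mult_cancel inv)
  moreover have "0 \<le> Re (quad H (v - ?G ** u))" by (rule quad_nonneg[OF H])
  moreover have "Re (quad H v) \<le> Re (quad ?G' u)"
    using le[of v] quad_matrix_inv[OF H', of u] by (simp add: v_def)
  ultimately show ?thesis by simp
qed

lemma quad_axis_pair:
  fixes K :: "complex^'r^'r"
  shows "quad K (column_matrix (axis a 1) + column_matrix (axis b c))
    = K $ a $ a + K $ b $ b * (cnj c * c) + K $ a $ b * c + K $ b $ a * cnj c"
proof -
  have "(adj (column_matrix (axis a c)) ** K ** column_matrix (axis b d)) $ 1 $ 1 = cnj c * K $ a $ b * d" for a b c d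
    by (simp add: matrix_matrix_mult_def adj_def column_matrix_def axis_def if_distrib if_distribR
        cong: if_cong)
  then show ?thesis
    by (simp add: adj_add matrix_mul_add_left matrix_add_ldistrib)
qed

text \<open>
  Monotonicity makes the quadratic forms converge; the matrix entries are recovered from them by
  polarization.
\<close>

lemma decreasing_hermitian_matrices_converge:
  fixes K :: "nat \<Rightarrow> complex^'r^'r"
  assumes adj: "\<And>s. adj (K s) = K s" and nonneg: "\<And>s y. 0 \<le> Re (quad (K s) y)"
    and dec: "\<And>s y. Re (quad (K (Suc s)) y) \<le> Re (quad (K s) y)"
  obtains L where "\<And>a b. (\<lambda>s. K s $ a $ b) \<longlonglongrightarrow> L $ a $ b"
proof -
  have conv: "convergent (\<lambda>s. quad (K s) y)" for y
  proof -
    have "decseq (\<lambda>s. Re (quad (K s) y))" by (rule decseq_SucI) (rule dec)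
    moreover have "\<forall>s. 0 \<le> Re (quad (K s) y)" by (simp only: nonneg simp_thms)
    ultimately obtain c where "(\<lambda>s. Re (quad (K s) y)) \<longlonglongrightarrow> c"
      by (rule decseq_convergent)
    then have "(\<lambda>s. of_real (Re (quad (K s) y))) \<longlonglongrightarrow> complex_of_real c" by (rule tendsto_of_real)
    moreover have "of_real (Re (quad (K s) y)) = quad (K s) y" for s
      using adj_quad[OF adj, of y s] by (intro of_real_Re) (simp only: Reals_cnj_iff)
    ultimately show ?thesis unfolding convergent_def by (intro exI[of _ "of_real c"]) simp
  qed
  have "convergent (\<lambda>s. K s $ a $ b)" for a b
  proof -
    \<comment> \<open>With c = 0 the form gives a diagonal entry, with c = 1 and c = i the real and imaginary parts
      of an off-diagonal one.\<close>
    let ?q = "\<lambda>a b c s. quad (K s) (column_matrix (axis a 1) + column_matrix (axis b c))"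
    have "K s $ a $ b = (?q a b 1 s - ?q a a 0 s - ?q b b 0 s - \<i> * (?q a b \<i> s - ?q a a 0 s - ?q b b 0 s)) / 2" for s
      unfolding quad_axis_pair by (simp add: algebra_simps)
    moreover have "convergent (\<lambda>s. (?q a b 1 s - ?q a a 0 s - ?q b b 0 s - \<i> * (?q a b \<i> s - ?q a a 0 s - ?q b b 0 s)) / 2)"
    proof -
      from conv have lims: "(\<lambda>s. ?q a b c s) \<longlonglongrightarrow> lim (?q a b c)" for a b c
        by (simp only: convergent_LIMSEQ_iff)
      show ?thesis unfolding convergent_def by (rule exI, rule tendsto_divide[OF tendsto_diff[OF tendsto_diff[OF tendsto_diff[OF lims lims] lims]
          tendsto_mult_left[OF tendsto_diff[OF tendsto_diff[OF lims lims] lims]]] tendsto_const]) simp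
    qed
    ultimately show ?thesis by presburger
  qed
  then have "(\<lambda>s. K s $ a $ b) \<longlonglongrightarrow> (\<chi> a b. lim (\<lambda>s. K s $ a $ b)) $ a $ b" for a b
    by (simp add: convergent_LIMSEQ_iff)
  then show thesis by (rule that)
qed

lemma tendsto_quad:
  fixes K :: "nat \<Rightarrow> complex^'r^'r" and x y :: "complex^1^'r"
  assumes "\<And>a b. (\<lambda>s. K s $ a $ b) \<longlonglongrightarrow> L $ a $ b"
  shows "(\<lambda>s. (adj x ** K s ** y) $ 1 $ 1) \<longlonglongrightarrow> (adj x ** L ** y) $ 1 $ 1"
  unfolding matrix_matrix_mult_def vec_lambda_beta by (intro tendsto_intros assms)

lemma tendsto_matrix_inv:
  fixes M :: "nat \<Rightarrow> complex^'r^'r"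
  assumes "\<And>a b. (\<lambda>s. M s $ a $ b) \<longlonglongrightarrow> L $ a $ b" "invertible L"
  shows "(\<lambda>s. matrix_inv (M s) $ a $ b) \<longlonglongrightarrow> matrix_inv L $ a $ b"
proof -
  have "M \<longlonglongrightarrow> L" by (intro vec_tendstoI assms(1))
  moreover have "isCont (\<lambda>A. matrix_inv A $ a $ b) L"
    by (intro differentiable_imp_continuous_within differentiable_matrix_inv_entry assms(2))
  ultimately show ?thesis by (rule isCont_tendsto_compose[rotated])
qed

text \<open>
  What a local trivialisation says about a single fibre: it is a linear isomorphism onto
  $\mathbb{C}^r$ for the fibrewise operations.
\<close>

definition fibre_coordinates :: "('e, 'm, 'r::finite) vbundle \<Rightarrow> 'm \<Rightarrow> ('e \<Rightarrow> complex^'r) \<Rightarrow> bool" where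
  "fibre_coordinates E x \<tau> \<longleftrightarrow> bij_betw \<tau> (fibre E x) UNIV \<and>
     (\<forall>e\<in>fibre E x. \<forall>f\<in>fibre E x. vadd E e f \<in> fibre E x \<and> \<tau> (vadd E e f) = \<tau> e + \<tau> f) \<and>
     (\<forall>c. \<forall>e\<in>fibre E x. vscale E c e \<in> fibre E x \<and> \<tau> (vscale E c e) = c *s \<tau> e)"

lemma pos_def_sesquilinear: "pos_def_at E x h \<Longrightarrow> sesquilinear_at E x h"
  unfolding pos_def_at_def hermitian_at_def by blast

lemma bundle_fibre_coordinates:
  assumes "holomorphic_vector_bundle A E" and U: "(U, \<tau>) \<in> trivs E" and x: "x \<in> U"
  shows "fibre_coordinates E x \<tau>"
proof -
  have "\<forall>(U, \<tau>)\<in>trivs E. open U \<and> (\<forall>x\<in>U. fibre_coordinates E x \<tau>)"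
    unfolding fibre_coordinates_def
    by (rule assms(1)[unfolded holomorphic_vector_bundle_def, THEN conjunct2, THEN conjunct1])
  from bspec[OF this U] have "\<forall>x\<in>U. fibre_coordinates E x \<tau>" unfolding prod.case by (rule conjunct2)
  then show ?thesis using x by (rule bspec)
qed

context
  fixes E :: "('e, 'm, 'r::finite) vbundle" and x :: 'm and \<tau> :: "'e \<Rightarrow> complex^'r"
  assumes coords: "fibre_coordinates E x \<tau>"
begin

lemma fibre_vector:
  "inv_into (fibre E x) \<tau> v \<in> fibre E x" "\<tau> (inv_into (fibre E x) \<tau> v) = v"
proof -
  have "v \<in> \<tau> ` fibre E x" using coords by (simp add: fibre_coordinates_def bij_betw_def)
  then show "inv_into (fibre E x) \<tau> v \<in> fibre E x" "\<tau> (inv_into (fibre E x) \<tau> v) = v"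
    by (rule inv_into_into, rule f_inv_into_f)
qed

lemma fibre_eqI: "e \<in> fibre E x \<Longrightarrow> f \<in> fibre E x \<Longrightarrow> \<tau> e = \<tau> f \<Longrightarrow> e = f"
  using coords by (auto simp: fibre_coordinates_def bij_betw_def inj_on_def)

lemma fibre_ops:
  assumes "e \<in> fibre E x"
  shows "f \<in> fibre E x \<Longrightarrow> vadd E e f \<in> fibre E x" "f \<in> fibre E x \<Longrightarrow> \<tau> (vadd E e f) = \<tau> e + \<tau> f"
    "vscale E c e \<in> fibre E x" "\<tau> (vscale E c e) = c *s \<tau> e"
  using coords assms by (auto simp: fibre_coordinates_def)

lemma frame_in_fibre: "frame E \<tau> x a \<in> fibre E x" and coords_frame: "\<tau> (frame E \<tau> x a) = axis a 1"
  unfolding frame_def by (rule fibre_vector)+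

text \<open>
  The fibre operations belong to no type class, so sums of fibre elements are not available; the
  expansion is obtained in $\mathbb{C}^r$ and transported by the coordinates.
\<close>

lemma functional_in_frame:
  assumes add: "\<And>e f. e \<in> fibre E x \<Longrightarrow> f \<in> fibre E x \<Longrightarrow> L (vadd E e f) = L e + L f"
    and scale: "\<And>c e. e \<in> fibre E x \<Longrightarrow> L (vscale E c e) = c * (L e :: complex)"
    and e: "e \<in> fibre E x"
  shows "L e = (\<Sum>a\<in>UNIV. \<tau> e $ a * L (frame E \<tau> x a))"
proof -
  let ?i = "inv_into (fibre E x) \<tau>"
  have i_add: "?i (v + w) = vadd E (?i v) (?i w)" for v w
    by (rule fibre_eqI) (simp_all add: fibre_vector fibre_ops)
  have i_scale: "?i (c *s v) = vscale E c (?i v)" for c v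
    by (rule fibre_eqI) (simp_all add: fibre_vector fibre_ops)
  have "L (?i (\<Sum>a\<in>I. v a *s axis a 1)) = (\<Sum>a\<in>I. v a * L (?i (axis a 1)))" if "finite I" for I v
    using that
  proof (induction I rule: finite_induct)
    case empty
    have "?i 0 = vscale E 0 (?i 0)" by (rule fibre_eqI) (simp_all add: fibre_vector fibre_ops)
    then have "L (?i 0) = 0 * L (?i 0)" using scale[OF fibre_vector(1)[of 0], of 0] by simp
    then show ?case by simp
  next
    case (insert a I)
    then show ?case by (simp add: i_add i_scale add scale fibre_vector fibre_ops)
  qed
  from this[of UNIV "\<lambda>a. \<tau> e $ a"] have "L (?i (\<tau> e)) = (\<Sum>a\<in>UNIV. \<tau> e $ a * L (frame E \<tau> x a))"
    by (simp add: basis_expansion frame_def)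
  moreover have "?i (\<tau> e) = e" by (rule fibre_eqI) (simp_all add: fibre_vector e)
  ultimately show ?thesis by simp
qed

lemma sesquilinear_in_frame:
  assumes h: "sesquilinear_at E x h" and e: "e \<in> fibre E x" and f: "f \<in> fibre E x"
  shows "h e f = (\<Sum>a\<in>UNIV. \<Sum>b\<in>UNIV. \<tau> e $ a * cnj (\<tau> f $ b) * gram E h \<tau> x $ a $ b)"
proof -
  have inner: "h (frame E \<tau> x a) f = (\<Sum>b\<in>UNIV. cnj (\<tau> f $ b) * h (frame E \<tau> x a) (frame E \<tau> x b))" for a
  proof -
    have "cnj (h (frame E \<tau> x a) f) = (\<Sum>b\<in>UNIV. \<tau> f $ b * cnj (h (frame E \<tau> x a) (frame E \<tau> x b)))"
      by (rule functional_in_frame[of "\<lambda>f. cnj (h (frame E \<tau> x a) f)"])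
         (use h f frame_in_fibre in \<open>auto simp: sesquilinear_at_def\<close>)
    from arg_cong[OF this, of cnj] show ?thesis by simp
  qed
  have "h e f = (\<Sum>a\<in>UNIV. \<tau> e $ a * h (frame E \<tau> x a) f)"
    by (rule functional_in_frame[of "\<lambda>e. h e f"]) (use h e f in \<open>auto simp: sesquilinear_at_def\<close>)
  then show ?thesis by (simp add: inner gram_def sum_distrib_left mult.assoc)
qed

text \<open>
  A hermitian metric is linear in its first argument, whereas the form of a matrix is antilinear in the
  first; hence the conjugation of the coordinates.
\<close>

lemma quad_gram:
  assumes "sesquilinear_at E x h" "e \<in> fibre E x" "\<And>a. \<tau> e $ a = cnj (y $ a $ 1)"
  shows "h e e = quad (gram E h \<tau> x) y"
  unfolding sesquilinear_in_frame[OF assms(1,2,2)] quad_expand using assms(3) by (simp add: ac_simps)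

lemma pos_def_gram:
  assumes h: "pos_def_at E x h"
  shows "pos_def_matrix (gram E h \<tau> x)"
  unfolding pos_def_matrix_def
proof (intro conjI allI impI)
  show "adj (gram E h \<tau> x) = gram E h \<tau> x"
  proof -
    have "\<forall>e\<in>fibre E x. \<forall>f\<in>fibre E x. h f e = cnj (h e f)"
      using h unfolding pos_def_at_def hermitian_at_def by blast
    then have "h (frame E \<tau> x i) (frame E \<tau> x j) = cnj (h (frame E \<tau> x j) (frame E \<tau> x i))" for i j
      using frame_in_fibre by blast
    then have "cnj (h (frame E \<tau> x j) (frame E \<tau> x i)) = h (frame E \<tau> x i) (frame E \<tau> x j)" for i j
      by (rule sym)
    then show ?thesis unfolding adj_def gram_def vec_eq_iff vec_lambda_beta by blast
  qed
next
  fix y :: "complex^1^'r" assume y: "y \<noteq> 0"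
  define e where "e = inv_into (fibre E x) \<tau> (\<chi> a. cnj (y $ a $ 1))"
  have e: "e \<in> fibre E x" "\<And>a. \<tau> e $ a = cnj (y $ a $ 1)"
    by (simp_all add: e_def fibre_vector)
  obtain a where "y $ a $ 1 \<noteq> 0" using y by (auto simp: vec_eq_iff forall_1)
  then have "\<tau> e \<noteq> 0" using e(2) by (auto simp: vec_eq_iff)
  moreover have "\<tau> (vscale E 0 e) = 0" using fibre_ops[OF e(1)] by simp
  ultimately have "e \<noteq> vscale E 0 e" by auto
  then have "0 < Re (h e e)" using h e unfolding pos_def_at_def by blast
  then show "0 < Re (quad (gram E h \<tau> x) y)"
    using quad_gram[OF pos_def_sesquilinear[OF h] e] by simp
qed

end

text \<open>
  The trivialisation of the dual bundle that belongs to $\tau$: the coefficients with respect to the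
  dual frame.
\<close>

definition dual_coords :: "('e, 'm, 'r::finite) vbundle \<Rightarrow> ('e \<Rightarrow> complex^'r) \<Rightarrow> 'm \<times> ('e \<Rightarrow> complex) \<Rightarrow> complex^'r" where
  "dual_coords E \<tau> p = (\<chi> a. snd p (frame E \<tau> (fst p) a))"

lemma dual_fibre_iff:
  "(y, \<xi>) \<in> fibre (dual_bundle E) x \<longleftrightarrow> y = x \<and> \<xi> \<in> extensional (fibre E x) \<and>
     (\<forall>e\<in>fibre E x. \<forall>f\<in>fibre E x. \<xi> (vadd E e f) = \<xi> e + \<xi> f) \<and>
     (\<forall>c. \<forall>e\<in>fibre E x. \<xi> (vscale E c e) = c * \<xi> e)"
  by (auto simp: fibre_def dual_bundle_def)

lemma dual_ops:
  "vadd (dual_bundle E) (x, \<xi>) (y, \<eta>) = (x, restrict (\<lambda>e. \<xi> e + \<eta> e) (fibre E x))"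
  "vscale (dual_bundle E) c (x, \<xi>) = (x, restrict (\<lambda>e. c * \<xi> e) (fibre E x))"
  by (simp_all add: dual_bundle_def)

lemma dual_fibreD:
  assumes "p \<in> fibre (dual_bundle E) x"
  shows "fst p = x" "snd p \<in> extensional (fibre E x)"
    "\<And>e f. e \<in> fibre E x \<Longrightarrow> f \<in> fibre E x \<Longrightarrow> snd p (vadd E e f) = snd p e + snd p f"
    "\<And>c e. e \<in> fibre E x \<Longrightarrow> snd p (vscale E c e) = c * snd p e"
  using assms by (auto simp: fibre_def dual_bundle_def)

context
  fixes E :: "('e, 'm, 'r::finite) vbundle" and x :: 'm and \<tau> :: "'e \<Rightarrow> complex^'r"
  assumes coords: "fibre_coordinates E x \<tau>"
begin

lemma covector_in_frame:
  assumes p: "p \<in> fibre (dual_bundle E) x" and e: "e \<in> fibre E x"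
  shows "snd p e = (\<Sum>a\<in>UNIV. \<tau> e $ a * dual_coords E \<tau> p $ a)"
  using functional_in_frame[OF coords, of "snd p", OF dual_fibreD(3)[OF p] dual_fibreD(4)[OF p] e]
  by (simp add: dual_coords_def dual_fibreD(1)[OF p])

lemma dual_coords_ops:
  assumes p: "p \<in> fibre (dual_bundle E) x"
  shows "q \<in> fibre (dual_bundle E) x \<Longrightarrow> dual_coords E \<tau> (vadd (dual_bundle E) p q) = dual_coords E \<tau> p + dual_coords E \<tau> q"
    "dual_coords E \<tau> (vscale (dual_bundle E) c p) = c *s dual_coords E \<tau> p"
    "q \<in> fibre (dual_bundle E) x \<Longrightarrow> vadd (dual_bundle E) p q \<in> fibre (dual_bundle E) x"
    "vscale (dual_bundle E) c p \<in> fibre (dual_bundle E) x"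
proof -
  note fib = frame_in_fibre[OF coords] fibre_ops[OF coords]
  obtain \<xi> where px: "p = (x, \<xi>)" using dual_fibreD(1)[OF p] by (cases p) auto
  show "dual_coords E \<tau> (vscale (dual_bundle E) c p) = c *s dual_coords E \<tau> p"
    unfolding px by (simp add: dual_coords_def dual_ops vec_eq_iff fib)
  show "vscale (dual_bundle E) c p \<in> fibre (dual_bundle E) x"
    using p unfolding px by (auto simp: dual_fibre_iff dual_ops fib algebra_simps)
  assume q: "q \<in> fibre (dual_bundle E) x"
  then obtain \<eta> where qx: "q = (x, \<eta>)" using dual_fibreD(1)[OF q] by (cases q) auto
  show "dual_coords E \<tau> (vadd (dual_bundle E) p q) = dual_coords E \<tau> p + dual_coords E \<tau> q"
    unfolding px qx by (simp add: dual_coords_def dual_ops vec_eq_iff fib)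
  show "vadd (dual_bundle E) p q \<in> fibre (dual_bundle E) x"
    using p q unfolding px qx by (auto simp: dual_fibre_iff dual_ops fib algebra_simps)
qed

text \<open>
  The functional with coefficient column $u$ is represented by the vector whose coordinates are the
  conjugates of $Gu$, since $h(\cdot, e)$ has the coefficients $H \bar c$ if $e$ has the coordinates $c$.
\<close>

lemma dual_metric_in_frame:
  assumes h: "pos_def_at E x h" and p: "p \<in> fibre (dual_bundle E) x" and q: "q \<in> fibre (dual_bundle E) x"
  shows "dual_metric E h p q =
    (adj (column_matrix (dual_coords E \<tau> q)) ** matrix_inv (gram E h \<tau> x) ** column_matrix (dual_coords E \<tau> p)) $ 1 $ 1"
proof -
  let ?H = "gram E h \<tau> x"
  note sesq = pos_def_sesquilinear[OF h]
  have inv: "invertible ?H" and adjH: "adj ?H = ?H"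
    using pos_def_gram[OF coords h] pos_def_matrix_invertible by (auto simp: pos_def_matrix_def)
  define e where "e r = inv_into (fibre E x) \<tau> (\<chi> a. cnj ((matrix_inv ?H ** column_matrix (dual_coords E \<tau> r)) $ a $ 1))" for r
  have e: "e r \<in> fibre E x" "\<tau> (e r) = (\<chi> a. cnj ((matrix_inv ?H ** column_matrix (dual_coords E \<tau> r)) $ a $ 1))" for r
    unfolding e_def by (rule fibre_vector[OF coords])+
  have pair: "h f e' = (\<Sum>a\<in>UNIV. \<tau> f $ a * (?H ** column_matrix (\<chi> b. cnj (\<tau> e' $ b))) $ a $ 1)"
    if "f \<in> fibre E x" "e' \<in> fibre E x" for f e'
    unfolding sesquilinear_in_frame[OF coords sesq that]
    by (simp add: matrix_matrix_mult_def column_matrix_def sum_distrib_left ac_simps)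
  have riesz_e: "riesz E h r = e r" if r: "r \<in> fibre (dual_bundle E) x" for r
    unfolding riesz_def dual_fibreD(1)[OF r]
  proof (rule the_equality)
    have "column_matrix (\<chi> b. cnj (\<tau> (e r) $ b)) = matrix_inv ?H ** column_matrix (dual_coords E \<tau> r)"
      by (simp add: e(2) column_matrix_def vec_eq_iff forall_1)
    then show "e r \<in> fibre E x \<and> (\<forall>f\<in>fibre E x. snd r f = h f (e r))"
      using e(1) by (simp add: pair covector_in_frame[OF r] matrix_inv_mult_cancel[OF inv] column_matrix_def)
  next
    fix e' assume e': "e' \<in> fibre E x \<and> (\<forall>f\<in>fibre E x. snd r f = h f e')"
    have "(?H ** column_matrix (\<chi> b. cnj (\<tau> e' $ b))) $ a $ 1 = dual_coords E \<tau> r $ a" for a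
      using e' pair[OF frame_in_fibre[OF coords], of e' a] frame_in_fibre[OF coords, of a]
      by (simp add: coords_frame[OF coords] axis_def if_distrib if_distribR dual_coords_def dual_fibreD(1)[OF r] cong: if_cong)
    then have "?H ** column_matrix (\<chi> b. cnj (\<tau> e' $ b)) = column_matrix (dual_coords E \<tau> r)"
      by (simp add: vec_eq_iff column_matrix_def forall_1)
    then have "column_matrix (\<chi> b. cnj (\<tau> e' $ b)) = matrix_inv ?H ** column_matrix (dual_coords E \<tau> r)"
      using matrix_inv_mult_cancel(1)[OF inv] by metis
    then have "cnj (\<tau> e' $ b) = (matrix_inv ?H ** column_matrix (dual_coords E \<tau> r)) $ b $ 1" for b
      by (simp add: column_matrix_def vec_eq_iff)
    then have "\<tau> e' = \<tau> (e r)"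
      unfolding e(2) by (simp add: vec_eq_iff; metis complex_cnj_cnj)
    then show "e' = e r" using fibre_eqI[OF coords] e' e(1) by blast
  qed
  have "dual_metric E h p q = h (e q) (e p)"
    unfolding dual_metric_def by (simp add: riesz_e p q)
  also have "\<dots> = snd p (e q)"
  proof -
    have "column_matrix (\<chi> b. cnj (\<tau> (e p) $ b)) = matrix_inv ?H ** column_matrix (dual_coords E \<tau> p)"
      by (simp add: e(2) column_matrix_def vec_eq_iff forall_1)
    then show ?thesis
      using e(1) by (simp add: pair covector_in_frame[OF p] matrix_inv_mult_cancel[OF inv] column_matrix_def)
  qed
  also have "\<dots> = (adj (matrix_inv ?H ** column_matrix (dual_coords E \<tau> q)) ** column_matrix (dual_coords E \<tau> p)) $ 1 $ 1"
    unfolding covector_in_frame[OF p e(1)] e(2) by (simp add: matrix_matrix_mult_def adj_def column_matrix_def)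
  finally show ?thesis
    by (simp add: adj_mult adj_matrix_inv[OF adjH inv] matrix_mul_assoc)
qed

lemma pos_semidef_dualI:
  assumes g: "\<And>p q. p \<in> fibre (dual_bundle E) x \<Longrightarrow> q \<in> fibre (dual_bundle E) x \<Longrightarrow>
      g p q = (adj (column_matrix (dual_coords E \<tau> q)) ** K ** column_matrix (dual_coords E \<tau> p)) $ 1 $ 1"
    and K: "adj K = K" "\<And>y. 0 \<le> Re (quad K y)"
  shows "pos_semidef_at (dual_bundle E) x g"
proof -
  have col: "column_matrix (v + w) = column_matrix v + column_matrix w" for v w :: "complex^'r"
    by (simp add: column_matrix_def vec_eq_iff)
  have scl: "(X ** column_matrix (c *s v)) = (\<chi> i j. c * (X ** column_matrix v) $ i $ j)"
    "adj (column_matrix (c *s v)) ** Y = (\<chi> i j. cnj c * (adj (column_matrix v) ** Y) $ i $ j)"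
    "(\<chi> i j. c * Z $ i $ j) ** Y' = (\<chi> i j. c * (Z ** Y') $ i $ j)"
    for X :: "complex^'r^1" and Y :: "complex^'r^'r" and c and v :: "complex^'r" and Z :: "complex^'r^1" and Y' :: "complex^1^'r"
    by (simp_all add: column_matrix_def adj_def matrix_matrix_mult_def vec_eq_iff sum_distrib_left ac_simps)
  have "cnj (g p q) = g q p" if "p \<in> fibre (dual_bundle E) x" "q \<in> fibre (dual_bundle E) x" for p q
  proof -
    have "adj (adj (column_matrix (dual_coords E \<tau> q)) ** K ** column_matrix (dual_coords E \<tau> p))
        = adj (column_matrix (dual_coords E \<tau> p)) ** K ** column_matrix (dual_coords E \<tau> q)"
      by (simp add: adj_mult K matrix_mul_assoc)
    then show ?thesis unfolding g[OF that] g[OF that(2,1)] by (simp add: adj_def vec_eq_iff)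
  qed
  then have "\<forall>p\<in>fibre (dual_bundle E) x. \<forall>q\<in>fibre (dual_bundle E) x. g q p = cnj (g p q)"
    by (metis (no_types))
  moreover have "sesquilinear_at (dual_bundle E) x g"
    unfolding sesquilinear_at_def
    by (simp add: g dual_coords_ops col scl adj_add matrix_mul_add_left matrix_add_ldistrib)
  moreover have "0 \<le> Re (g p p)" if "p \<in> fibre (dual_bundle E) x" for p
    unfolding g[OF that that] by (rule K)
  ultimately show ?thesis
    unfolding pos_semidef_at_def hermitian_at_def by blast
qed

end

section \<open>The limit of the dual norms on one exhausting set\<close>

lemma Ck_on_subset: "Ck_on k S f \<Longrightarrow> T \<subseteq> S \<Longrightarrow> Ck_on k T f"
  by (induction k arbitrary: f) (auto intro: continuous_on_subset)

lemma real_derivative_unique: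
  assumes "(F has_derivative (\<lambda>v. 2 * Re (a * v))) (at \<zeta>)" "(F has_derivative (\<lambda>v. 2 * Re (b * v))) (at \<zeta>)"
  shows "a = b"
proof -
  have "(\<lambda>v. 2 * Re (a * v)) = (\<lambda>v. 2 * Re (b * v))"
    using assms by (rule has_derivative_unique)
  from fun_cong[OF this, of 1] fun_cong[OF this, of \<i>] show ?thesis by (simp add: complex_eq_iff)
qed

text \<open>
  A disc need not lie in the domain of one local frame, so its Laplacian is known only locally.  The
  first derivatives are determined by $F$ and the second ones by the first, which is why the local
  data fit together.
\<close>

lemma wirtinger_patch:
  fixes F :: "complex \<Rightarrow> real"
  assumes loc: "\<And>\<zeta>. \<zeta> \<in> D \<Longrightarrow> \<exists>D0 Fz Fzz Fzb. open D0 \<and> \<zeta> \<in> D0 \<and>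
      (\<forall>\<xi>\<in>D0. (F has_derivative (\<lambda>v. 2 * Re (Fz \<xi> * v))) (at \<xi>)) \<and> wirtinger_on D0 Fz Fzz Fzb \<and>
      (\<forall>\<xi>\<in>D0. b \<xi> \<le> Re (Fzb \<xi>))"
  shows "\<exists>Fz Fzz Fzb. (\<forall>\<zeta>\<in>D. (F has_derivative (\<lambda>v. 2 * Re (Fz \<zeta> * v))) (at \<zeta>)) \<and>
      wirtinger_on D Fz Fzz Fzb \<and> (\<forall>\<zeta>\<in>D. b \<zeta> \<le> Re (Fzb \<zeta>))"
proof -
  define P where "P \<zeta> D0 fz fzz fzb \<longleftrightarrow> open D0 \<and> \<zeta> \<in> D0 \<and>
      (\<forall>\<xi>\<in>D0. (F has_derivative (\<lambda>v. 2 * Re (fz \<xi> * v))) (at \<xi>)) \<and> wirtinger_on D0 fz fzz fzb \<and>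
      (\<forall>\<xi>\<in>D0. b \<xi> \<le> Re (fzb \<xi>))" for \<zeta> D0 fz fzz fzb
  have "\<exists>D0 fz fzz fzb. P \<zeta> D0 fz fzz fzb" if "\<zeta> \<in> D" for \<zeta>
    unfolding P_def by (rule loc[OF that])
  then obtain D0 fz fzz fzb where P: "\<And>\<zeta>. \<zeta> \<in> D \<Longrightarrow> P \<zeta> (D0 \<zeta>) (fz \<zeta>) (fzz \<zeta>) (fzb \<zeta>)"
    by metis
  have D0: "open (D0 \<zeta>)" "\<zeta> \<in> D0 \<zeta>" and W: "wirtinger_on (D0 \<zeta>) (fz \<zeta>) (fzz \<zeta>) (fzb \<zeta>)"
    if "\<zeta> \<in> D" for \<zeta>
    using P[OF that] by (simp_all add: P_def)
  have F: "(F has_derivative (\<lambda>v. 2 * Re (fz \<zeta> \<xi> * v))) (at \<xi>)" and b: "b \<xi> \<le> Re (fzb \<zeta> \<xi>)"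
    if "\<zeta> \<in> D" "\<xi> \<in> D0 \<zeta>" for \<zeta> \<xi>
    using P[OF that(1)] that(2) unfolding P_def by blast+
  define Fz where "Fz \<zeta> = (THE a. (F has_derivative (\<lambda>v. 2 * Re (a * v))) (at \<zeta>))" for \<zeta>
  have Fz: "Fz \<xi> = fz \<zeta> \<xi>" if "\<zeta> \<in> D" "\<xi> \<in> D0 \<zeta>" for \<zeta> \<xi>
    unfolding Fz_def
  proof (rule the_equality)
    show "(F has_derivative (\<lambda>v. 2 * Re (fz \<zeta> \<xi> * v))) (at \<xi>)" by (rule F[OF that])
    fix a assume "(F has_derivative (\<lambda>v. 2 * Re (a * v))) (at \<xi>)"
    then show "a = fz \<zeta> \<xi>" by (rule real_derivative_unique[OF _ F[OF that]])
  qed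
  define Fzz where "Fzz \<zeta> = fzz \<zeta> \<zeta>" for \<zeta>
  define Fzb where "Fzb \<zeta> = fzb \<zeta> \<zeta>" for \<zeta>
  have agree: "Fzz \<xi> = fzz \<zeta> \<xi>" "Fzb \<xi> = fzb \<zeta> \<xi>" if "\<zeta> \<in> D" "\<xi> \<in> D" "\<xi> \<in> D0 \<zeta>" for \<zeta> \<xi>
  proof -
    have o: "open (D0 \<xi> \<inter> D0 \<zeta>)" using D0 that by blast
    have m: "\<xi> \<in> D0 \<xi> \<inter> D0 \<zeta>" using D0 that by blast
    have e: "fz \<xi> x = fz \<zeta> x" if "x \<in> D0 \<xi> \<inter> D0 \<zeta>" for x
      using Fz[of \<xi> x] Fz[of \<zeta> x] that \<open>\<zeta> \<in> D\<close> \<open>\<xi> \<in> D\<close> by simp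
    show "Fzz \<xi> = fzz \<zeta> \<xi>" "Fzb \<xi> = fzb \<zeta> \<xi>"
      unfolding Fzz_def Fzb_def
      using wirtinger_on_unique[OF W[OF that(2)] W[OF that(1)] o subset_refl e m] by blast+
  qed
  have cont: "continuous_on D g" if g: "\<And>\<zeta> \<xi>. \<zeta> \<in> D \<Longrightarrow> \<xi> \<in> D \<Longrightarrow> \<xi> \<in> D0 \<zeta> \<Longrightarrow> g \<xi> = h \<zeta> \<xi>"
    and h: "\<And>\<zeta>. \<zeta> \<in> D \<Longrightarrow> continuous_on (D0 \<zeta>) (h \<zeta>)" for g :: "complex \<Rightarrow> complex" and h
    unfolding continuous_on_eq_continuous_within
  proof
    fix \<zeta> assume z: "\<zeta> \<in> D"
    have "isCont (h \<zeta>) \<zeta>" using h[OF z] D0[OF z] continuous_on_eq_continuous_at by blast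
    then have "continuous (at \<zeta> within D) (h \<zeta>)" by (rule continuous_at_imp_continuous_at_within)
    moreover have "\<forall>\<^sub>F \<xi> in at \<zeta> within D. h \<zeta> \<xi> = g \<xi>"
      unfolding eventually_at_topological using D0[OF z] g[OF z] by (intro exI[of _ "D0 \<zeta>"]) auto
    ultimately show "continuous (at \<zeta> within D) g"
      unfolding continuous_within g[OF z z D0(2)[OF z], symmetric] by (rule Lim_transform_eventually)
  qed
  show ?thesis
  proof (rule exI[of _ Fz], rule exI[of _ Fzz], rule exI[of _ Fzb], intro conjI ballI)
    fix \<zeta> assume z: "\<zeta> \<in> D"
    show "(F has_derivative (\<lambda>v. 2 * Re (Fz \<zeta> * v))) (at \<zeta>)"
      using F[OF z D0(2)[OF z]] Fz[OF z D0(2)[OF z]] by simp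
    show "b \<zeta> \<le> Re (Fzb \<zeta>)" using b[OF z D0(2)[OF z]] by (simp add: Fzb_def)
  next
    show "wirtinger_on D Fz Fzz Fzb"
      unfolding wirtinger_on_def
    proof (intro conjI ballI)
      fix \<zeta> assume z: "\<zeta> \<in> D"
      show "(Fz has_derivative (\<lambda>v. Fzz \<zeta> * v + Fzb \<zeta> * cnj v)) (at \<zeta>)"
        unfolding Fzz_def Fzb_def
        by (rule has_derivative_transform_within_open[OF wirtinger_on_derivative[OF W[OF z] D0(2)[OF z]] D0[OF z]])
           (simp add: Fz[OF z])
    next
      show "continuous_on D Fzz"
        by (rule cont[OF agree(1)]) (use W in \<open>auto simp: wirtinger_on_def\<close>)
      show "continuous_on D Fzb"
        by (rule cont[OF agree(2)]) (use W in \<open>auto simp: wirtinger_on_def\<close>)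
    qed
  qed
qed

lemma dual_norm_continuous:
  fixes H :: "complex^'n \<Rightarrow> complex^'r^'r" and u :: "complex^'n \<Rightarrow> complex^'r"
  assumes H: "\<And>a b. Ck_on 2 \<Omega> (\<lambda>z. H z $ a $ b)"
    and pd: "\<And>z. z \<in> \<Omega> \<Longrightarrow> pos_def_matrix (H z)" and u: "hol_map \<Omega> u"
  shows "continuous_on \<Omega> (\<lambda>z. Re (quad (matrix_inv (H z)) (column_matrix (u z))))"
proof -
  have "(\<lambda>z. matrix_inv (H z) $ a $ b) differentiable (at z)" if "z \<in> \<Omega>" for a b z
    by (rule differentiable_matrix_inv[of H, OF _ pos_def_matrix_invertible[OF pd[OF that]]])
       (use H that in \<open>simp add: numeral_2_eq_2\<close>)
  then have G: "continuous_on \<Omega> (\<lambda>z. matrix_inv (H z) $ a $ b)" for a b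
    by (meson continuous_at_imp_continuous_on differentiable_imp_continuous_within)
  have "continuous_on \<Omega> u"
    using u unfolding hol_map_def by (meson continuous_at_imp_continuous_on has_derivative_continuous)
  then have v: "continuous_on \<Omega> (\<lambda>z. u z $ a)" for a by (intro continuous_intros)
  show ?thesis
    unfolding quad_expand column_matrix_def vec_lambda_beta
    by (intro continuous_on_Re continuous_on_sum continuous_on_mult continuous_on_cnj G v)
qed

lemma chart_homeo:
  assumes "complex_manifold A" and "(V, \<phi>) \<in> A"
  shows "open V" "open (\<phi> ` V)" "homeomorphism V (\<phi> ` V) \<phi> (inv_into V \<phi>)"
proof -
  have "\<forall>(V, \<phi>)\<in>A. open V \<and> open (\<phi> ` V) \<and> homeomorphism V (\<phi> ` V) \<phi> (inv_into V \<phi>)"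
    using assms(1) unfolding complex_manifold_def by (elim conjE)
  from bspec[OF this assms(2)] show "open V" "open (\<phi> ` V)" "homeomorphism V (\<phi> ` V) \<phi> (inv_into V \<phi>)"
    by simp_all
qed

lemma chart_inverse:
  assumes "complex_manifold A" and "(V, \<phi>) \<in> A" and "x \<in> V"
  shows "inv_into V \<phi> (\<phi> x) = x"
  using homeomorphism_apply1[OF chart_homeo(3)[OF assms(1,2)] assms(3)] .

lemma open_chart_image:
  assumes "complex_manifold A" and "(V, \<phi>) \<in> A" and "open U"
  shows "open (\<phi> ` (U \<inter> V))"
proof -
  have "openin (top_of_set V) (U \<inter> V)" using openin_open_Int[OF assms(3), of V] by (simp add: Int_commute)
  then have "openin (top_of_set (\<phi> ` V)) (\<phi> ` (U \<inter> V))"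
    using homeomorphism_imp_open_map[OF chart_homeo(3)[OF assms(1,2)]] by blast
  then show ?thesis using chart_homeo(2)[OF assms(1,2)] openin_open_eq by blast
qed

lemma continuous_on_chart_image:
  assumes "complex_manifold A" and "(V, \<phi>) \<in> A" and "continuous_on T f" and "U \<subseteq> T"
  shows "continuous_on (\<phi> ` (U \<inter> V)) (f \<circ> inv_into V \<phi>)"
proof (rule continuous_on_compose)
  show "continuous_on (\<phi> ` (U \<inter> V)) (inv_into V \<phi>)"
    using homeomorphism_cont2[OF chart_homeo(3)[OF assms(1,2)]] by (rule continuous_on_subset) auto
  have "inv_into V \<phi> ` \<phi> ` (U \<inter> V) \<subseteq> U"
    using chart_inverse[OF assms(1,2)] by auto
  then show "continuous_on (inv_into V \<phi> ` \<phi> ` (U \<inter> V)) f"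
    using continuous_on_subset[OF assms(3)] assms(4) by blast
qed

text \<open>
  Holomorphic sections of the dual bundle, tested in one trivialisation around each point.  Sections
  with constant coefficients in a given frame satisfy this by definition, without computing transition
  functions of the dual bundle.
\<close>

definition dual_section :: "('m::topological_space, 'n::finite) chart set \<Rightarrow> ('e, 'm, 'r::finite) vbundle \<Rightarrow> 'm set \<Rightarrow>
    ('m \<Rightarrow> 'm \<times> ('e \<Rightarrow> complex)) \<Rightarrow> bool" where
  "dual_section A E U u \<longleftrightarrow> (\<forall>x\<in>U. u x \<in> fibre (dual_bundle E) x \<and>
     (\<exists>(W, \<tau>)\<in>trivs E. open W \<and> x \<in> W \<and> holomorphic_on_mfd A (U \<inter> W) (\<lambda>y. dual_coords E \<tau> (u y))))"

text \<open>
  The hypotheses of \<open>psh_on_decreasing_limit\<close> are verified for the squared dual norms in a chart.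
  The error bound for a disc must not depend on $s$; it is found from the first norm, as
  $\lambda_s\, \omega(w,w)\, |u|^2_s \le \lambda_s\, |\omega(w,w)|\, |u|^2_0$ and $|\omega(w,w)|\, |u|^2_0$ is bounded
  on the disc.
\<close>

lemma nakano_approximants_psh:
  fixes A :: "('m::{t2_space,second_countable_topology}, 'n::finite) chart set"
    and E :: "('e, 'm, 'r::finite) vbundle"
  assumes A: "complex_manifold A" and E: "holomorphic_vector_bundle A E"
    and \<omega>: "hermitian_metric_on_manifold A \<omega>"
    and C2: "\<And>s. Ck_metric 2 A E M (hs s)"
    and mono: "\<And>x s e. x \<in> M \<Longrightarrow> e \<in> fibre E x \<Longrightarrow> hnorm (hs s) e \<le> hnorm (hs (Suc s)) e"
    and nak: "\<And>s. nakano_ge A E M (hs s) (\<lambda>x. - ls s x) \<omega>"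
    and ls: "\<And>s. continuous_on M (ls s)" "continuous_on M l" "\<And>x s. x \<in> M \<Longrightarrow> 0 \<le> ls s x"
      "\<And>x s. x \<in> M \<Longrightarrow> ls s x \<le> l x" "measure_zero A {x \<in> M. \<not> (\<lambda>s. ls s x) \<longlonglongrightarrow> 0}"
    and U: "open U" "U \<subseteq> M" and u: "dual_section A E U u" and c: "(V, \<phi>) \<in> A"
    and lim: "\<And>x. x \<in> U \<Longrightarrow> (\<lambda>s. Re (dual_metric E (hs s) (u x) (u x))) \<longlonglongrightarrow> F x"
  shows "psh_on (\<phi> ` (U \<inter> V)) (F \<circ> inv_into V \<phi>)"
proof -
  let ?\<psi> = "inv_into V \<phi>"
  let ?\<Omega> = "\<phi> ` (U \<inter> V)"
  let ?f = "\<lambda>s z. Re (dual_metric E (hs s) (u (?\<psi> z)) (u (?\<psi> z)))"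
  have \<Omega>: "open ?\<Omega>" by (rule open_chart_image[OF A c U(1)])
  have \<psi>: "?\<psi> z \<in> U \<inter> V" "\<phi> (?\<psi> z) = z" if "z \<in> ?\<Omega>" for z
    using that chart_inverse[OF A c] by auto
  have pd: "pos_def_at E x (hs s)" if "x \<in> M" for x s
    using C2[of s] that unfolding Ck_metric_def by blast
  have triv: "fibre_coordinates E x \<tau>" if "(W, \<tau>) \<in> trivs E" "x \<in> W" for x W \<tau>
    by (rule bundle_fibre_coordinates[OF E that])
  let ?H = "\<lambda>s \<tau>. gram E (hs s) \<tau> \<circ> ?\<psi>"
  let ?v = "\<lambda>\<tau> z. dual_coords E \<tau> (u (?\<psi> z))"
  have frame_near: "\<exists>W \<tau>. (W, \<tau>) \<in> trivs E \<and> open (\<phi> ` (U \<inter> W \<inter> V)) \<and> z \<in> \<phi> ` (U \<inter> W \<inter> V) \<and>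
      hol_map (\<phi> ` (U \<inter> W \<inter> V)) (?v \<tau>)" if z: "z \<in> ?\<Omega>" for z
  proof -
    have x: "?\<psi> z \<in> U" using \<psi>[OF z] by blast
    obtain W \<tau> where W: "(W, \<tau>) \<in> trivs E" "open W" "?\<psi> z \<in> W"
      "holomorphic_on_mfd A (U \<inter> W) (\<lambda>y. dual_coords E \<tau> (u y))"
      using u x unfolding dual_section_def by blast
    have "open (\<phi> ` (U \<inter> W \<inter> V))"
      using open_chart_image[OF A c, of "U \<inter> W"] U(1) W(2) by (simp add: open_Int)
    moreover have "z \<in> \<phi> ` (U \<inter> W \<inter> V)"
      using \<psi>[OF z] W(3) by (intro image_eqI[of _ _ "?\<psi> z"]) auto
    moreover have "hol_map (\<phi> ` (U \<inter> W \<inter> V)) (?v \<tau>)"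
      using bspec[OF W(4)[unfolded holomorphic_on_mfd_def] c] by (simp add: o_def)
    ultimately show ?thesis using W(1) by blast
  qed
  have H2: "Ck_on 2 (\<phi> ` (U \<inter> W \<inter> V)) (\<lambda>z. ?H s \<tau> z $ a $ b)" if W: "(W, \<tau>) \<in> trivs E" for W \<tau> s a b
  proof -
    have "\<forall>(U, \<tau>)\<in>trivs E. \<forall>a b. Ck_on_mfd 2 A (M \<inter> U) (\<lambda>x. gram E (hs s) \<tau> x $ a $ b)"
      using C2[of s] unfolding Ck_metric_def by (rule conjunct2)
    from bspec[OF this W] have "Ck_on_mfd 2 A (M \<inter> W) (\<lambda>x. gram E (hs s) \<tau> x $ a $ b)" by simp
    from bspec[OF this[unfolded Ck_on_mfd_def] c]
    have "Ck_on 2 (\<phi> ` (M \<inter> W \<inter> V)) (\<lambda>z. ?H s \<tau> z $ a $ b)" by (simp add: o_def)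
    then show ?thesis by (rule Ck_on_subset) (use U(2) in auto)
  qed
  have pdH: "pos_def_matrix (?H s \<tau> z)" if W: "(W, \<tau>) \<in> trivs E" and z: "z \<in> \<phi> ` (U \<inter> W \<inter> V)" for W \<tau> s z
  proof -
    obtain x where x: "x \<in> U" "x \<in> W" "x \<in> V" "z = \<phi> x" using z by blast
    then have "?\<psi> z = x" using chart_inverse[OF A c] by simp
    then show ?thesis using pos_def_gram[OF triv[OF W x(2)] pd] x U(2) by auto
  qed
  have f_eq: "?f s z = Re (quad (matrix_inv (?H s \<tau> z)) (column_matrix (?v \<tau> z)))"
    if W: "(W, \<tau>) \<in> trivs E" and z: "z \<in> \<phi> ` (U \<inter> W \<inter> V)" for W \<tau> s z
  proof -
    obtain x where x: "x \<in> U" "x \<in> W" "x \<in> V" "z = \<phi> x" using z by blast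
    then have zx: "?\<psi> z = x" using chart_inverse[OF A c] by simp
    have ux: "u x \<in> fibre (dual_bundle E) x" using u x(1) unfolding dual_section_def by blast
    show ?thesis
      using dual_metric_in_frame[OF triv[OF W x(2)] pd ux ux] x(1) U(2) by (auto simp: zx)
  qed
  have f_cont: "continuous_on ?\<Omega> (?f s)" for s
    unfolding continuous_on_eq_continuous_at[OF \<Omega>]
  proof
    fix z assume "z \<in> ?\<Omega>"
    from frame_near[OF this] obtain W \<tau> where W: "(W, \<tau>) \<in> trivs E" "open (\<phi> ` (U \<inter> W \<inter> V))"
      "z \<in> \<phi> ` (U \<inter> W \<inter> V)" "hol_map (\<phi> ` (U \<inter> W \<inter> V)) (?v \<tau>)" by blast
    have "continuous_on (\<phi> ` (U \<inter> W \<inter> V)) (\<lambda>z. Re (quad (matrix_inv (?H s \<tau> z)) (column_matrix (?v \<tau> z))))"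
      by (rule dual_norm_continuous[OF H2[OF W(1)] pdH[OF W(1)] W(4)])
    then have "continuous_on (\<phi> ` (U \<inter> W \<inter> V)) (?f s)"
      by (rule continuous_on_eq) (rule f_eq[OF W(1), symmetric])
    then show "isCont (?f s) z" unfolding continuous_on_eq_continuous_at[OF W(2)] using W(3) by (rule bspec)
  qed
  have f_pos: "0 \<le> ?f s z" if "z \<in> ?\<Omega>" for s z
  proof -
    from frame_near[OF that] obtain W \<tau> where W: "(W, \<tau>) \<in> trivs E" "z \<in> \<phi> ` (U \<inter> W \<inter> V)" by blast
    show ?thesis
      unfolding f_eq[OF W] quad_matrix_inv[OF pdH[OF W]] by (rule quad_nonneg[OF pdH[OF W]])
  qed
  have f_dec: "?f (Suc s) z \<le> ?f s z" if z: "z \<in> ?\<Omega>" for s z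
  proof -
    from frame_near[OF z] obtain W \<tau> where W: "(W, \<tau>) \<in> trivs E" "z \<in> \<phi> ` (U \<inter> W \<inter> V)" by blast
    then have x: "?\<psi> z \<in> M" "?\<psi> z \<in> W" using U(2) chart_inverse[OF A c] by auto
    note co = triv[OF W(1) x(2)]
    have "Re (quad (?H s \<tau> z) y) \<le> Re (quad (?H (Suc s) \<tau> z) y)" for y
    proof -
      define e where "e = inv_into (fibre E (?\<psi> z)) \<tau> (\<chi> a. cnj (y $ a $ 1))"
      have e: "e \<in> fibre E (?\<psi> z)" "\<And>a. \<tau> e $ a = cnj (y $ a $ 1)"
        by (simp_all add: e_def fibre_vector[OF co])
      have "Re (hs s e e) \<le> Re (hs (Suc s) e e)"
        using mono[OF x(1) e(1)] by (simp add: hnorm_def)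
      then show ?thesis
        using quad_gram[OF co pos_def_sesquilinear[OF pd[OF x(1)]] e] by simp
    qed
    then show ?thesis
      unfolding f_eq[OF W] by (rule quad_inverse_antimono[OF pdH[OF W] pdH[OF W]])
  qed
  have f_le: "?f s z \<le> ?f 0 z" if "z \<in> ?\<Omega>" for s z
    by (rule lift_Suc_antimono_le[of "\<lambda>s. ?f s z", OF f_dec[OF that] le0])
  \<comment> \<open>The number $\omega(w,w)$ in the coordinates of the chart.\<close>
  let ?W = "\<lambda>z. gram (tangent_bundle A) \<omega> (chart_triv (V, \<phi>)) (?\<psi> z)"
  let ?q = "\<lambda>w z. Re (\<Sum>j\<in>UNIV. \<Sum>k\<in>UNIV. ?W z $ j $ k * w $ j * cnj (w $ k))"
  have q_cont: "continuous_on ?\<Omega> (?q w)" for w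
  proof -
    have "(V, chart_triv (V, \<phi>)) \<in> trivs (tangent_bundle A)"
      using c unfolding tangent_bundle_def by (auto intro!: image_eqI[of _ _ "(V, \<phi>)"])
    moreover have "\<forall>(U, \<tau>)\<in>trivs (tangent_bundle A). \<forall>a b. Ck_on_mfd 0 A (UNIV \<inter> U) (\<lambda>x. gram (tangent_bundle A) \<omega> \<tau> x $ a $ b)"
      using \<omega> unfolding hermitian_metric_on_manifold_def Ck_metric_def by blast
    ultimately have "\<forall>a b. Ck_on_mfd 0 A (UNIV \<inter> V) (\<lambda>x. gram (tangent_bundle A) \<omega> (chart_triv (V, \<phi>)) x $ a $ b)"
      by blast
    then have "Ck_on_mfd 0 A V (\<lambda>x. gram (tangent_bundle A) \<omega> (chart_triv (V, \<phi>)) x $ a $ b)" for a b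
      by simp
    from bspec[OF this[unfolded Ck_on_mfd_def] c]
    have "continuous_on (\<phi> ` V) (\<lambda>z. ?W z $ a $ b)" for a b by (simp add: o_def)
    then have "continuous_on ?\<Omega> (\<lambda>z. ?W z $ a $ b)" for a b
      by (rule continuous_on_subset) auto
    then show ?thesis
      by (intro continuous_on_Re continuous_on_sum continuous_on_mult continuous_on_const)
  qed
  let ?lam = "\<lambda>s z. ls s (?\<psi> z)"
  have lam_cont: "continuous_on ?\<Omega> (?lam s)" for s
    using continuous_on_chart_image[OF A c ls(1) U(2)] by (simp add: o_def)
  have lap: "\<exists>Fz Fzz Fzb. (\<forall>\<zeta>. p + \<zeta> *s w \<in> ?\<Omega> \<longrightarrow>
        ((\<lambda>\<zeta>. ?f s (p + \<zeta> *s w)) has_derivative (\<lambda>v. 2 * Re (Fz \<zeta> * v))) (at \<zeta>)) \<and>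
      wirtinger_on {\<zeta>. p + \<zeta> *s w \<in> ?\<Omega>} Fz Fzz Fzb \<and>
      (\<forall>\<zeta>. p + \<zeta> *s w \<in> ?\<Omega> \<longrightarrow> - ?lam s (p + \<zeta> *s w) * (?q w (p + \<zeta> *s w) * ?f s (p + \<zeta> *s w)) \<le> Re (Fzb \<zeta>))"
    for s p w
  proof -
    let ?b = "\<lambda>\<zeta>. - ?lam s (p + \<zeta> *s w) * (?q w (p + \<zeta> *s w) * ?f s (p + \<zeta> *s w))"
    have "\<exists>D0 Fz Fzz Fzb. open D0 \<and> \<zeta> \<in> D0 \<and>
      (\<forall>\<xi>\<in>D0. ((\<lambda>\<zeta>. ?f s (p + \<zeta> *s w)) has_derivative (\<lambda>v. 2 * Re (Fz \<xi> * v))) (at \<xi>)) \<and> wirtinger_on D0 Fz Fzz Fzb \<and>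
      (\<forall>\<xi>\<in>D0. ?b \<xi> \<le> Re (Fzb \<xi>))" if z: "\<zeta> \<in> {\<zeta>. p + \<zeta> *s w \<in> ?\<Omega>}" for \<zeta>
    proof -
      from z have "p + \<zeta> *s w \<in> ?\<Omega>" by blast
      from frame_near[OF this] obtain W \<tau> where W: "(W, \<tau>) \<in> trivs E" "open (\<phi> ` (U \<inter> W \<inter> V))"
        "p + \<zeta> *s w \<in> \<phi> ` (U \<inter> W \<inter> V)" "hol_map (\<phi> ` (U \<inter> W \<inter> V)) (?v \<tau>)" by blast
      let ?O = "\<phi> ` (U \<inter> W \<inter> V)" and ?D = "{\<zeta>. p + \<zeta> *s w \<in> \<phi> ` (U \<inter> W \<inter> V)}"
      have curv: "- ?lam s z * Re (\<Sum>j\<in>UNIV. \<Sum>k\<in>UNIV. \<Sum>a\<in>UNIV. \<Sum>b\<in>UNIV.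
                 ?W z $ j $ k * ?H s \<tau> z $ a $ b * t $ j $ a * cnj (t $ k $ b))
        \<le> Re (\<Sum>j\<in>UNIV. \<Sum>k\<in>UNIV. \<Sum>a\<in>UNIV. \<Sum>b\<in>UNIV.
                 (chern_curvature (?H s \<tau>) j k z ** ?H s \<tau> z) $ a $ b * t $ j $ a * cnj (t $ k $ b))"
        if z: "z \<in> ?O" for z t
      proof -
        obtain x where x: "x \<in> U" "x \<in> W" "x \<in> V" "z = \<phi> x" using z by blast
        then have zx: "?\<psi> z = x" using chart_inverse[OF A c] by simp
        have xM: "x \<in> M \<inter> W \<inter> V" using x U(2) by blast
        from bspec[OF bspec[OF nak[of s, unfolded nakano_ge_def] c, unfolded prod.case] W(1), unfolded prod.case,
            THEN bspec, OF xM, rule_format, of t]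
        show ?thesis unfolding Let_def zx x(4)[symmetric] .
      qed
      have "\<exists>Fz Fzz Fzb. (\<forall>\<zeta>\<in>?D. ((\<lambda>\<zeta>. Re (quad (matrix_inv (?H s \<tau> (p + \<zeta> *s w))) (column_matrix (?v \<tau> (p + \<zeta> *s w)))))
            has_derivative (\<lambda>v. 2 * Re (Fz \<zeta> * v))) (at \<zeta>)) \<and>
          wirtinger_on ?D Fz Fzz Fzb \<and>
          (\<forall>\<zeta>\<in>?D. - ?lam s (p + \<zeta> *s w) * (?q w (p + \<zeta> *s w) *
              Re (quad (matrix_inv (?H s \<tau> (p + \<zeta> *s w))) (column_matrix (?v \<tau> (p + \<zeta> *s w))))) \<le> Re (Fzb \<zeta>))"
        by (rule dual_norm_laplacian[OF W(2) H2[OF W(1)] pdH[OF W(1)] W(4) curv])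
      then obtain Fz Fzz Fzb where
        F: "\<forall>\<zeta>\<in>?D. ((\<lambda>\<zeta>. Re (quad (matrix_inv (?H s \<tau> (p + \<zeta> *s w))) (column_matrix (?v \<tau> (p + \<zeta> *s w)))))
            has_derivative (\<lambda>v. 2 * Re (Fz \<zeta> * v))) (at \<zeta>)"
          "wirtinger_on ?D Fz Fzz Fzb"
          "\<forall>\<zeta>\<in>?D. - ?lam s (p + \<zeta> *s w) * (?q w (p + \<zeta> *s w) *
              Re (quad (matrix_inv (?H s \<tau> (p + \<zeta> *s w))) (column_matrix (?v \<tau> (p + \<zeta> *s w))))) \<le> Re (Fzb \<zeta>)"
        by (elim exE conjE)
      have zD: "\<zeta> \<in> ?D" using W(3) by simp
      have D: "open ?D" by (rule open_line[OF W(2)])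
      have 1: "((\<lambda>\<zeta>. ?f s (p + \<zeta> *s w)) has_derivative (\<lambda>v. 2 * Re (Fz \<xi> * v))) (at \<xi>)" if x: "\<xi> \<in> ?D" for \<xi>
        by (rule has_derivative_transform_within_open[OF bspec[OF F(1) x] D x])
           (rule f_eq[OF W(1), symmetric], simp)
      have 2: "?b \<xi> \<le> Re (Fzb \<xi>)" if x: "\<xi> \<in> ?D" for \<xi>
        using bspec[OF F(3) x] f_eq[OF W(1), of "p + \<xi> *s w" s] x by simp
      show ?thesis
        by (rule exI[of _ ?D], rule exI[of _ Fz], rule exI[of _ Fzz], rule exI[of _ Fzb])
           (intro conjI ballI D F(2) 1 2 zD)
    qed
    then have "\<exists>Fz Fzz Fzb. (\<forall>\<zeta>\<in>{\<zeta>. p + \<zeta> *s w \<in> ?\<Omega>}.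
        ((\<lambda>\<zeta>. ?f s (p + \<zeta> *s w)) has_derivative (\<lambda>v. 2 * Re (Fz \<zeta> * v))) (at \<zeta>)) \<and>
      wirtinger_on {\<zeta>. p + \<zeta> *s w \<in> ?\<Omega>} Fz Fzz Fzb \<and>
      (\<forall>\<zeta>\<in>{\<zeta>. p + \<zeta> *s w \<in> ?\<Omega>}. ?b \<zeta> \<le> Re (Fzb \<zeta>))"
      by (rule wirtinger_patch)
    then show ?thesis by (simp only: mem_Collect_eq Ball_def)
  qed
  have mean: "\<exists>B. \<forall>s. 2 * pi * ?f s z \<le> integral {0..2*pi} (\<lambda>t. ?f s (z + cis t *s w))
        + B * integral (cbox (0, 0) (1, 2*pi)) (\<lambda>(r, t). ?lam s (z + (of_real r * cis t) *s w))"
    if disc: "\<And>\<zeta>. cmod \<zeta> \<le> 1 \<Longrightarrow> z + \<zeta> *s w \<in> ?\<Omega>" for z w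
  proof -
    let ?D = "{\<zeta>. z + \<zeta> *s w \<in> ?\<Omega>}"
    have "continuous_on (cball 0 1) (\<lambda>\<zeta>. g (z + \<zeta> *s w))" if "continuous_on ?\<Omega> g" for g :: "complex^'n \<Rightarrow> real"
      by (rule continuous_on_subset[OF continuous_on_line[OF that]]) (use disc in auto)
    then have "continuous_on (cball 0 1) (\<lambda>\<zeta>. \<bar>?q w (z + \<zeta> *s w)\<bar> * ?f 0 (z + \<zeta> *s w))"
      using q_cont f_cont by (intro continuous_on_mult continuous_on_rabs) blast+
    then have "compact ((\<lambda>\<zeta>. \<bar>?q w (z + \<zeta> *s w)\<bar> * ?f 0 (z + \<zeta> *s w)) ` cball 0 1)"
      by (rule compact_continuous_image) simp
    from bounded_pos[THEN iffD1, OF compact_imp_bounded[OF this]]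
    obtain B where B: "0 < B" "\<And>\<zeta>. cmod \<zeta> \<le> 1 \<Longrightarrow> \<bar>?q w (z + \<zeta> *s w)\<bar> * ?f 0 (z + \<zeta> *s w) \<le> B"
      by (auto simp: abs_le_iff)
    have "2 * pi * ?f s z \<le> integral {0..2*pi} (\<lambda>t. ?f s (z + cis t *s w))
        + 4 * B * integral (cbox (0, 0) (1, 2*pi)) (\<lambda>(r, t). ?lam s (z + (of_real r * cis t) *s w))" for s
    proof -
      from lap[where p = z and w = w and s = s] obtain Fz Fzz Fzb where F: "\<And>\<zeta>. \<zeta> \<in> ?D \<Longrightarrow>
        ((\<lambda>\<zeta>. ?f s (z + \<zeta> *s w)) has_derivative (\<lambda>v. 2 * Re (Fz \<zeta> * v))) (at \<zeta>)"
        "wirtinger_on ?D Fz Fzz Fzb"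
        "\<And>\<zeta>. \<zeta> \<in> ?D \<Longrightarrow> - ?lam s (z + \<zeta> *s w) * (?q w (z + \<zeta> *s w) * ?f s (z + \<zeta> *s w)) \<le> Re (Fzb \<zeta>)"
        by blast
      have "2 * pi * ?f s (z + 0 *s w) \<le> integral {0..2*pi} (\<lambda>t. ?f s (z + cis t *s w))
        + 4 * B * integral (cbox (0, 0) (1, 2*pi)) (\<lambda>(r, t). ?lam s (z + (of_real r * cis t) *s w))"
      proof (rule disc_mean_inequality[OF open_line[OF \<Omega>] _ F(1,2)])
        show "cball 0 1 \<subseteq> ?D" using disc by auto
        fix \<zeta> :: complex assume "\<zeta> \<in> cball 0 1"
        then have z1: "cmod \<zeta> \<le> 1" by simp
        let ?x = "z + \<zeta> *s w"
        have x: "?x \<in> ?\<Omega>" by (rule disc[OF z1])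
        have l0: "0 \<le> ?lam s ?x" using ls(3) \<psi>[OF x] U(2) by blast
        have "?q w ?x * ?f s ?x \<le> \<bar>?q w ?x\<bar> * ?f 0 ?x"
          by (intro mult_mono f_le[OF x] f_pos[OF x]) auto
        also have "\<dots> \<le> B" by (rule B(2)[OF z1])
        finally have "?lam s ?x * (?q w ?x * ?f s ?x) \<le> ?lam s ?x * B"
          using l0 by (rule mult_left_mono)
        then show "- (B * ?lam s ?x) \<le> Re (Fzb \<zeta>)"
          using F(3)[of \<zeta>] x by (simp add: mult.commute)
      next
        show "continuous_on ?D (\<lambda>\<zeta>. ?lam s (z + \<zeta> *s w))"
          by (rule continuous_on_line[OF lam_cont])
        fix \<zeta> assume "\<zeta> \<in> ?D"
        then have "?\<psi> (z + \<zeta> *s w) \<in> M" using \<psi>(1) U(2) by blast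
        then show "0 \<le> ?lam s (z + \<zeta> *s w)" by (rule ls(3))
      next
        show "0 \<le> B" using B(1) by simp
      qed
      then show ?thesis by simp
    qed
    then show ?thesis by blast
  qed
  have "psh_on ?\<Omega> (\<lambda>z. F (?\<psi> z))"
  proof (rule psh_on_decreasing_limit[where f = ?f and lam = ?lam and l = "\<lambda>z. l (?\<psi> z)"
        and N = "\<phi> ` ({x \<in> M. \<not> (\<lambda>s. ls s x) \<longlonglongrightarrow> 0} \<inter> V)"])
    show "open ?\<Omega>" by (rule \<Omega>)
    show "continuous_on ?\<Omega> (?f s)" for s by (rule f_cont)
    show "continuous_on ?\<Omega> (?lam s)" for s by (rule lam_cont)
    show "continuous_on ?\<Omega> (\<lambda>z. l (?\<psi> z))"
      using continuous_on_chart_image[OF A c ls(2) U(2)] by (simp add: o_def)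
    show "negligible (\<phi> ` ({x \<in> M. \<not> (\<lambda>s. ls s x) \<longlonglongrightarrow> 0} \<inter> V))"
      using bspec[OF ls(5)[unfolded measure_zero_def] c] by simp
  next
    fix s z assume z: "z \<in> ?\<Omega>"
    then have xM: "?\<psi> z \<in> M" using \<psi>(1)[OF z] U(2) by blast
    show "?f (Suc s) z \<le> ?f s z" by (rule f_dec[OF z])
    show "0 \<le> ?f s z" by (rule f_pos[OF z])
    show "0 \<le> ?lam s z" by (rule ls(3)[OF xM])
    show "?lam s z \<le> l (?\<psi> z)" by (rule ls(4)[OF xM])
  next
    fix z assume z: "z \<in> ?\<Omega>"
    have "?\<psi> z \<in> U" using \<psi>(1)[OF z] by blast
    then show "(\<lambda>s. ?f s z) \<longlonglongrightarrow> F (?\<psi> z)" by (rule lim)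
  next
    fix z assume z: "z \<in> ?\<Omega> - \<phi> ` ({x \<in> M. \<not> (\<lambda>s. ls s x) \<longlonglongrightarrow> 0} \<inter> V)"
    then have zO: "z \<in> ?\<Omega>" by blast
    have xM: "?\<psi> z \<in> M" and xV: "?\<psi> z \<in> V" using \<psi>(1)[OF zO] U(2) by blast+
    show "(\<lambda>s. ?lam s z) \<longlonglongrightarrow> 0"
    proof (rule ccontr)
      assume "\<not> (\<lambda>s. ?lam s z) \<longlonglongrightarrow> 0"
      then have "?\<psi> z \<in> {x \<in> M. \<not> (\<lambda>s. ls s x) \<longlonglongrightarrow> 0} \<inter> V" using xM xV by simp
      from imageI[OF this, of \<phi>] z show False unfolding \<psi>(2)[OF zO] by blast
    qed
  next
    fix z w assume disc: "\<And>\<zeta>. cmod \<zeta> \<le> 1 \<Longrightarrow> z + \<zeta> *s w \<in> ?\<Omega>"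
    then show "\<exists>B. \<forall>s. 2 * pi * ?f s z \<le> integral {0..2*pi} (\<lambda>t. ?f s (z + cis t *s w))
        + B * integral (cbox (0, 0) (1, 2*pi)) (\<lambda>(r, t). ?lam s (z + (of_real r * cis t) *s w))"
      by (rule mean)
  qed
  then show ?thesis by (simp add: o_def)
qed

section \<open>Gluing over the exhaustion\<close>

text \<open>
  Upper semicontinuity is local, and a compact disc lies in one of the increasing open sets.
\<close>

lemma psh_on_open_exhaustion:
  fixes F :: "complex^'n \<Rightarrow> real"
  assumes inc: "\<And>j. \<Omega> j \<subseteq> \<Omega> (Suc j)" and o: "\<And>j. open (\<Omega> j)" and psh: "\<And>j. psh_on (\<Omega> j) F"
  shows "psh_on (\<Union>j. \<Omega> j) F"
  unfolding psh_on_def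
proof (intro conjI allI impI)
  fix c
  have "open {z \<in> \<Omega> j. F z < c}" for j
    using psh[of j] o[of j] unfolding psh_on_def by (simp add: openin_open_eq)
  then have "open (\<Union>j. {z \<in> \<Omega> j. F z < c})" by blast
  moreover have "{z \<in> \<Union>j. \<Omega> j. F z < c} = (\<Union>j. {z \<in> \<Omega> j. F z < c})" by blast
  moreover have "open (\<Union>j. \<Omega> j)" using o by blast
  ultimately show "openin (top_of_set (\<Union>j. \<Omega> j)) {z \<in> \<Union>j. \<Omega> j. F z < c}"
    by (subst openin_open_eq) auto
next
  fix z w
  assume disc: "\<forall>\<zeta>. cmod \<zeta> \<le> 1 \<longrightarrow> z + \<zeta> *s w \<in> (\<Union>j. \<Omega> j)"
  let ?K = "(\<lambda>\<zeta>. z + \<zeta> *s w) ` cball 0 1"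
  have comp: "compact ?K" by (intro compact_continuous_image continuous_intros) simp
  have cov: "?K \<subseteq> (\<Union>j\<in>UNIV. \<Omega> j)" using disc by auto
  obtain J where J: "finite J" "?K \<subseteq> (\<Union>j\<in>J. \<Omega> j)"
    by (rule compactE_image[OF comp o cov])
  obtain m where m: "\<And>j. j \<in> J \<Longrightarrow> j \<le> m" using J(1) unfolding finite_nat_set_iff_bounded_le by blast
  have "\<Omega> j \<subseteq> \<Omega> m" if "j \<in> J" for j
    using lift_Suc_mono_le[of \<Omega>, OF inc m[OF that]] .
  with J(2) have K: "?K \<subseteq> \<Omega> m" by blast
  have "\<forall>\<zeta>. cmod \<zeta> \<le> 1 \<longrightarrow> z + \<zeta> *s w \<in> \<Omega> m"
    using K by (simp add: image_subset_iff)
  from mp[OF spec[OF spec[OF conjunct2[OF psh[of m, unfolded psh_on_def]]]] this]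
  show "(\<lambda>t. F (z + cis t *s w)) absolutely_integrable_on {0..2*pi}"
    "F z \<le> integral {0..2*pi} (\<lambda>t. F (z + cis t *s w)) / (2*pi)"
    by (rule conjunct1, rule conjunct2)
qed

lemma bundle_trivialisation_around:
  assumes E: "holomorphic_vector_bundle A E"
  obtains W \<tau> where "(W, \<tau>) \<in> trivs E" "open W" "x \<in> W"
proof -
  have "(\<Union>(U, \<tau>)\<in>trivs E. U) = UNIV"
    using E unfolding holomorphic_vector_bundle_def by (elim conjE)
  then have "x \<in> (\<Union>(U, \<tau>)\<in>trivs E. U)" by simp
  then obtain W \<tau> where W: "(W, \<tau>) \<in> trivs E" "x \<in> W" by auto
  have "\<forall>(U, \<tau>)\<in>trivs E. open U \<and> (\<forall>x\<in>U. fibre_coordinates E x \<tau>)"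
    using E unfolding holomorphic_vector_bundle_def fibre_coordinates_def by (elim conjE)
  from bspec[OF this W(1)] have "open W" by simp
  then show thesis by (rule that[OF W(1) _ W(2)])
qed

lemma holomorphic_section_dual_section:
  assumes E: "holomorphic_vector_bundle A E" and u: "holomorphic_section A (dual_bundle E) U u"
  shows "dual_section A E U u"
  unfolding dual_section_def
proof (intro ballI conjI)
  fix x assume x: "x \<in> U"
  show "u x \<in> fibre (dual_bundle E) x" using u x unfolding holomorphic_section_def by blast
  obtain W \<tau> where W: "(W, \<tau>) \<in> trivs E" "open W" "x \<in> W"
    using bundle_trivialisation_around[OF E] .
  have "trivs (dual_bundle E) = (\<lambda>(U, \<tau>). (U, \<lambda>(x, \<xi>). \<chi> a. \<xi> (frame E \<tau> x a))) ` trivs E"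
    by (simp add: dual_bundle_def)
  moreover have "dual_coords E \<tau> = (\<lambda>(x, \<xi>). \<chi> a. \<xi> (frame E \<tau> x a))"
    by (simp add: fun_eq_iff dual_coords_def)
  ultimately have "(W, dual_coords E \<tau>) \<in> trivs (dual_bundle E)"
    by (simp only:) (rule image_eqI[OF _ W(1)], simp)
  moreover have "\<forall>(W, \<tau>)\<in>trivs (dual_bundle E). holomorphic_on_mfd A (U \<inter> W) (\<tau> \<circ> u)"
    using u unfolding holomorphic_section_def by (rule conjunct2)
  ultimately have "holomorphic_on_mfd A (U \<inter> W) (dual_coords E \<tau> \<circ> u)"
    by (metis (no_types, lifting) case_prodD)
  then show "\<exists>(W, \<tau>)\<in>trivs E. open W \<and> x \<in> W \<and> holomorphic_on_mfd A (U \<inter> W) (\<lambda>y. dual_coords E \<tau> (u y))"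
    using W by (intro bexI[of _ "(W, \<tau>)"]) (simp_all add: o_def)
qed

lemma dual_section_subset:
  assumes u: "dual_section A E U u" and sub: "U' \<subseteq> U"
  shows "dual_section A E U' u"
  unfolding dual_section_def
proof (intro ballI conjI)
  fix x assume "x \<in> U'"
  then have x: "x \<in> U" using sub by blast
  then show "u x \<in> fibre (dual_bundle E) x" using u unfolding dual_section_def by blast
  from u x obtain W \<tau> where W: "(W, \<tau>) \<in> trivs E" "open W" "x \<in> W"
    "holomorphic_on_mfd A (U \<inter> W) (\<lambda>y. dual_coords E \<tau> (u y))"
    unfolding dual_section_def by blast
  have "holomorphic_on_mfd A (U' \<inter> W) (\<lambda>y. dual_coords E \<tau> (u y))"
    unfolding holomorphic_on_mfd_def
  proof clarify
    fix V \<phi> assume "(V, \<phi>) \<in> A"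
    from bspec[OF W(4)[unfolded holomorphic_on_mfd_def] this]
    have "hol_map (\<phi> ` (U \<inter> W \<inter> V)) ((\<lambda>y. dual_coords E \<tau> (u y)) \<circ> inv_into V \<phi>)" by simp
    moreover have "\<phi> ` (U' \<inter> W \<inter> V) \<subseteq> \<phi> ` (U \<inter> W \<inter> V)" using sub by blast
    ultimately show "hol_map (\<phi> ` (U' \<inter> W \<inter> V)) ((\<lambda>y. dual_coords E \<tau> (u y)) \<circ> inv_into V \<phi>)"
      unfolding hol_map_def by blast
  qed
  with W show "\<exists>(W, \<tau>)\<in>trivs E. open W \<and> x \<in> W \<and> holomorphic_on_mfd A (U' \<inter> W) (\<lambda>y. dual_coords E \<tau> (u y))"
    by (intro bexI[of _ "(W, \<tau>)"]) simp_all
qed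

text \<open>
  The section with constant coefficients in a local frame.
\<close>

lemma exists_dual_section_through:
  assumes A: "complex_manifold A" and E: "holomorphic_vector_bundle A E" and p: "p \<in> fibre (dual_bundle E) x"
  obtains U u where "open U" "x \<in> U" "dual_section A E U u" "u x = p"
proof -
  obtain W \<tau> where W: "(W, \<tau>) \<in> trivs E" "open W" "x \<in> W"
    using bundle_trivialisation_around[OF E] .
  note co = bundle_fibre_coordinates[OF E W(1)]
  define v where "v = dual_coords E \<tau> p"
  define u where "u y = (y, restrict (\<lambda>e. \<Sum>a\<in>UNIV. \<tau> e $ a * v $ a) (fibre E y))" for y
  have uf: "u y \<in> fibre (dual_bundle E) y" if y: "y \<in> W" for y
    unfolding u_def dual_fibre_iff
    using fibre_ops[OF co[OF y]] by (auto simp: algebra_simps sum.distrib sum_distrib_left)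
  have uc: "dual_coords E \<tau> (u y) = v" if y: "y \<in> W" for y
    by (simp add: dual_coords_def u_def vec_eq_iff frame_in_fibre[OF co[OF y]] coords_frame[OF co[OF y]]
        axis_def if_distrib if_distribR cong: if_cong)
  have "hol_map (\<phi> ` (W \<inter> W \<inter> V)) ((\<lambda>y. dual_coords E \<tau> (u y)) \<circ> inv_into V \<phi>)" if "(V, \<phi>) \<in> A" for V \<phi>
    unfolding hol_map_def
  proof
    fix z assume z: "z \<in> \<phi> ` (W \<inter> W \<inter> V)"
    have o: "open (\<phi> ` (W \<inter> W \<inter> V))"
      using open_chart_image[OF A that W(2)] by simp
    have "((\<lambda>y. dual_coords E \<tau> (u y)) \<circ> inv_into V \<phi> has_derivative (\<lambda>v. 0)) (at z)"
    proof (rule has_derivative_transform_within_open[OF _ o z])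
      show "((\<lambda>z. v) has_derivative (\<lambda>v. 0)) (at z)" by simp
      fix y assume "y \<in> \<phi> ` (W \<inter> W \<inter> V)"
      then have "inv_into V \<phi> y \<in> W" using chart_inverse[OF A that] by auto
      then show "v = ((\<lambda>y. dual_coords E \<tau> (u y)) \<circ> inv_into V \<phi>) y" by (simp add: uc)
    qed
    then show "\<exists>D. ((\<lambda>y. dual_coords E \<tau> (u y)) \<circ> inv_into V \<phi> has_derivative D) (at z) \<and> (\<forall>c v. D (c *s v) = c *s D v)"
      by (intro exI[of _ "\<lambda>v. 0"] conjI) simp_all
  qed
  then have "dual_section A E W u"
    unfolding dual_section_def holomorphic_on_mfd_def using uf W by blast
  moreover have "u x = p"
  proof -
    have "p = (x, snd p)" using dual_fibreD(1)[OF p] by (cases p) auto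
    moreover have "restrict (\<lambda>e. \<Sum>a\<in>UNIV. \<tau> e $ a * v $ a) (fibre E x) = snd p"
    proof (rule extensionalityI[OF restrict_extensional dual_fibreD(2)[OF p]])
      fix e assume "e \<in> fibre E x"
      then show "restrict (\<lambda>e. \<Sum>a\<in>UNIV. \<tau> e $ a * v $ a) (fibre E x) e = snd p e"
        using covector_in_frame[OF co[OF W(3)] p] by (simp add: v_def)
    qed
    ultimately show ?thesis unfolding u_def by simp
  qed
  ultimately show thesis using that[OF W(2,3)] by blast
qed


lemma dual_metric_tendsto:
  assumes co: "fibre_coordinates E x \<tau>" and pd: "\<And>s. pos_def_at E x (hs s)" "pos_def_at E x h"
    and lim: "\<And>e f. e \<in> fibre E x \<Longrightarrow> f \<in> fibre E x \<Longrightarrow> (\<lambda>s. hs s e f) \<longlonglongrightarrow> h e f"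
    and p: "p \<in> fibre (dual_bundle E) x" and q: "q \<in> fibre (dual_bundle E) x"
  shows "(\<lambda>s. dual_metric E (hs s) p q) \<longlonglongrightarrow> dual_metric E h p q"
proof -
  have "(\<lambda>s. gram E (hs s) \<tau> x $ a $ b) \<longlonglongrightarrow> gram E h \<tau> x $ a $ b" for a b
    unfolding gram_def vec_lambda_beta by (intro lim frame_in_fibre[OF co])
  then have "(\<lambda>s. matrix_inv (gram E (hs s) \<tau> x) $ a $ b) \<longlonglongrightarrow> matrix_inv (gram E h \<tau> x) $ a $ b" for a b
    by (intro tendsto_matrix_inv pos_def_matrix_invertible pos_def_gram[OF co] pd)
  then show ?thesis
    unfolding dual_metric_in_frame[OF co pd(1) p q] dual_metric_in_frame[OF co pd(2) p q]
    by (rule tendsto_quad)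
qed

lemma increasing_metrics_dual_converge:
  assumes co: "fibre_coordinates E x \<tau>" and pd: "\<And>s. pos_def_at E x (hs s)"
    and mono: "\<And>s e. e \<in> fibre E x \<Longrightarrow> hnorm (hs s) e \<le> hnorm (hs (Suc s)) e"
  shows "\<exists>K. adj K = K \<and> (\<forall>y. 0 \<le> Re (quad K y)) \<and>
    (\<forall>p\<in>fibre (dual_bundle E) x. \<forall>q\<in>fibre (dual_bundle E) x. (\<lambda>s. dual_metric E (hs s) p q)
       \<longlonglongrightarrow> (adj (column_matrix (dual_coords E \<tau> q)) ** K ** column_matrix (dual_coords E \<tau> p)) $ 1 $ 1)"
proof -
  let ?H = "\<lambda>s. gram E (hs s) \<tau> x"
  let ?K = "\<lambda>s. matrix_inv (?H s)"
  have pdH: "pos_def_matrix (?H s)" for s by (rule pos_def_gram[OF co pd])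
  have adjK: "adj (?K s) = ?K s" for s
    using adj_matrix_inv pdH[of s] pos_def_matrix_invertible unfolding pos_def_matrix_def by blast
  have nonneg: "0 \<le> Re (quad (?K s) y)" for s y
    unfolding quad_matrix_inv[OF pdH] by (rule quad_nonneg[OF pdH])
  have "Re (quad (?H s) y) \<le> Re (quad (?H (Suc s)) y)" for s y
  proof -
    define e where "e = inv_into (fibre E x) \<tau> (\<chi> a. cnj (y $ a $ 1))"
    have e: "e \<in> fibre E x" "\<And>a. \<tau> e $ a = cnj (y $ a $ 1)"
      by (simp_all add: e_def fibre_vector[OF co])
    have "Re (hs s e e) \<le> Re (hs (Suc s) e e)"
      using mono[OF e(1)] by (simp add: hnorm_def)
    then show ?thesis
      by (simp only: quad_gram[OF co pos_def_sesquilinear[OF pd] e])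
  qed
  then have dec: "Re (quad (?K (Suc s)) y) \<le> Re (quad (?K s) y)" for s y
    by (rule quad_inverse_antimono[OF pdH pdH])
  obtain K where K: "\<And>a b. (\<lambda>s. ?K s $ a $ b) \<longlonglongrightarrow> K $ a $ b"
    using decreasing_hermitian_matrices_converge[of ?K, OF adjK nonneg dec] by metis
  have "adj K = K"
  proof -
    have "(\<lambda>s. adj (?K s) $ a $ b) \<longlonglongrightarrow> adj K $ a $ b" for a b
      unfolding adj_def vec_lambda_beta by (intro tendsto_intros K)
    then have "adj K $ a $ b = K $ a $ b" for a b
      unfolding adjK using K LIMSEQ_unique by blast
    then show ?thesis by (simp add: vec_eq_iff)
  qed
  moreover have "0 \<le> Re (quad K y)" for y
    by (rule LIMSEQ_le_const[OF tendsto_Re[OF tendsto_quad[OF K]]]) (use nonneg in blast)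
  moreover have "(\<lambda>s. dual_metric E (hs s) p q)
       \<longlonglongrightarrow> (adj (column_matrix (dual_coords E \<tau> q)) ** K ** column_matrix (dual_coords E \<tau> p)) $ 1 $ 1"
    if "p \<in> fibre (dual_bundle E) x" "q \<in> fibre (dual_bundle E) x" for p q
    unfolding dual_metric_in_frame[OF co pd that] by (rule tendsto_quad[OF K])
  ultimately show ?thesis by blast
qed

text \<open>
  A pointwise limit of positive definite forms is semidefinite; definiteness survives because the
  sequence increases, so that its first member is a lower bound.
\<close>

lemma pos_def_limit:
  assumes sesq: "sesquilinear_at E x h" and pd: "\<And>s. pos_def_at E x (hs s)"
    and mono: "\<And>s e. e \<in> fibre E x \<Longrightarrow> hnorm (hs s) e \<le> hnorm (hs (Suc s)) e"
    and lim: "\<And>e f. e \<in> fibre E x \<Longrightarrow> f \<in> fibre E x \<Longrightarrow> (\<lambda>s. hs s e f) \<longlonglongrightarrow> h e f"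
  shows "pos_def_at E x h"
proof -
  have herm: "hs s f e = cnj (hs s e f)" if "e \<in> fibre E x" "f \<in> fibre E x" for s e f
    using pd[of s] that unfolding pos_def_at_def hermitian_at_def by blast
  have "h f e = cnj (h e f)" if "e \<in> fibre E x" "f \<in> fibre E x" for e f
  proof (rule LIMSEQ_unique)
    show "(\<lambda>s. hs s f e) \<longlonglongrightarrow> h f e" by (rule lim[OF that(2,1)])
    have "(\<lambda>s. cnj (hs s e f)) \<longlonglongrightarrow> cnj (h e f)" by (intro tendsto_cnj lim that)
    then show "(\<lambda>s. hs s f e) \<longlonglongrightarrow> cnj (h e f)" unfolding herm[OF that, symmetric] .
  qed
  moreover have "0 < Re (h e e)" if e: "e \<in> fibre E x" "e \<noteq> vscale E 0 e" for e
  proof -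
    have "0 < Re (hs 0 e e)" using pd[of 0] e unfolding pos_def_at_def by blast
    also have "Re (hs 0 e e) \<le> Re (h e e)"
    proof (rule LIMSEQ_le_const[OF tendsto_Re[OF lim[OF e(1) e(1)]]], intro exI allI impI)
      fix s :: nat
      have "Re (hs s e e) \<le> Re (hs (Suc s) e e)" for s
        using mono[OF e(1), of s] by (simp add: hnorm_def)
      from lift_Suc_mono_le[of "\<lambda>s. Re (hs s e e)", OF this le0]
      show "Re (hs 0 e e) \<le> Re (hs s e e)" .
    qed
    finally show ?thesis .
  qed
  ultimately show ?thesis
    using sesq unfolding pos_def_at_def hermitian_at_def by blast
qed

theorem proposition2p3:
  fixes A :: "('m::{t2_space,second_countable_topology}, 'n::finite) chart set"
    and E :: "('e, 'm, 'r::finite) vbundle"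
    and S :: "'m set"
    and Mj :: "nat \<Rightarrow> 'm set"
    and h :: "'e \<Rightarrow> 'e \<Rightarrow> complex"
    and hs :: "nat \<Rightarrow> nat \<Rightarrow> 'e \<Rightarrow> 'e \<Rightarrow> complex"
    and \<omega> :: "'m \<times> (('m, 'n) chart \<Rightarrow> complex^'n) \<Rightarrow> 'm \<times> (('m, 'n) chart \<Rightarrow> complex^'n) \<Rightarrow> complex"
  assumes "complex_manifold A"
    and "holomorphic_vector_bundle A E"
    and "hermitian_metric_on_manifold A \<omega>"
    and "singular_hermitian_metric A E S Mj h hs"
    and "singular_nakano_semipositive A E Mj hs \<omega>"
  shows "griffiths_semipositive_off A E S h"
proof -
  note A = assms(1) and E = assms(2)
  note sing = assms(4)[unfolded singular_hermitian_metric_def]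
  have meas: "measurable_metric A E h" using sing by (elim conjE)
  have S0: "measure_zero A S" using sing by (elim conjE)
  have M: "\<forall>j. open (Mj j) \<and> compact (closure (Mj j)) \<and> closure (Mj j) \<subseteq> Mj (Suc j)"
    using sing by (elim conjE)
  have UM: "(\<Union>j. Mj j) = UNIV" using sing by (elim conjE)
  have C2: "\<forall>j s. Ck_metric 2 A E (Mj j) (hs j s)" using sing by (elim conjE)
  have lim: "\<forall>j. \<forall>x\<in>Mj j - S. \<forall>e\<in>fibre E x. \<forall>f\<in>fibre E x. (\<lambda>s. hs j s e f) \<longlonglongrightarrow> h e f"
    using sing by (elim conjE)
  have openM: "open (Mj j)" and incM: "Mj j \<subseteq> Mj (Suc j)" for j
    using M closure_subset[of "Mj j"] by blast+
  note nak = assms(5)[unfolded singular_nakano_semipositive_def, rule_format]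
  have mono: "hnorm (hs j s) e \<le> hnorm (hs j (Suc s)) e" if "x \<in> Mj j" "e \<in> fibre E x" for j s x e
    using nak[of j] that by blast
  have pd: "pos_def_at E x (hs j s)" if "x \<in> Mj j" for j s x
    using C2 that unfolding Ck_metric_def by blast
  have triv: "\<exists>\<tau>. fibre_coordinates E x \<tau>" for x
  proof -
    obtain W \<tau> where "(W, \<tau>) \<in> trivs E" "open W" "x \<in> W"
      using bundle_trivialisation_around[OF E, of x] .
    then show ?thesis using bundle_fibre_coordinates[OF E] by blast
  qed
  have pdh: "pos_def_at E x h" if x: "x \<notin> S" for x
  proof -
    obtain j where j: "x \<in> Mj j" using UM by blast
    have "sesquilinear_at E x h" using meas unfolding measurable_metric_def by blast
    then show ?thesis
      by (rule pos_def_limit[where hs = "hs j", OF _ pd[OF j] mono[OF j]]) (use lim j x in blast)+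
  qed
  \<comment> \<open>At every point the completed dual form is the limit belonging to the first $M_j$ that contains the point.\<close>
  define J where "J x = (LEAST j. x \<in> Mj j)" for x
  have J: "x \<in> Mj (J x)" for x
  proof -
    obtain j where "x \<in> Mj j" using UM by blast
    then show ?thesis unfolding J_def by (rule LeastI)
  qed
  define g where "g p q = lim (\<lambda>s. dual_metric E (hs (J (fst p)) s) p q)" for p q
  have converge: "\<exists>K. adj K = K \<and> (\<forall>y. 0 \<le> Re (quad K y)) \<and>
    (\<forall>p\<in>fibre (dual_bundle E) x. \<forall>q\<in>fibre (dual_bundle E) x. (\<lambda>s. dual_metric E (hs j s) p q)
       \<longlonglongrightarrow> (adj (column_matrix (dual_coords E \<tau> q)) ** K ** column_matrix (dual_coords E \<tau> p)) $ 1 $ 1)"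
    if co: "fibre_coordinates E x \<tau>" and x: "x \<in> Mj j" for x \<tau> j
    by (rule increasing_metrics_dual_converge[where hs = "hs j", OF co pd[OF x] mono[OF x]])
  have conv: "convergent (\<lambda>s. dual_metric E (hs j s) p q)"
    if "x \<in> Mj j" "p \<in> fibre (dual_bundle E) x" "q \<in> fibre (dual_bundle E) x" for j x p q
  proof -
    obtain \<tau> where "fibre_coordinates E x \<tau>" using triv by blast
    from converge[OF this that(1)] obtain K where
      K: "\<forall>p\<in>fibre (dual_bundle E) x. \<forall>q\<in>fibre (dual_bundle E) x. (\<lambda>s. dual_metric E (hs j s) p q)
       \<longlonglongrightarrow> (adj (column_matrix (dual_coords E \<tau> q)) ** K ** column_matrix (dual_coords E \<tau> p)) $ 1 $ 1"
      by (elim exE conjE)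
    from bspec[OF bspec[OF K that(2)] that(3)] show ?thesis by (rule convergentI)
  qed
  have g_semidef: "pos_semidef_at (dual_bundle E) x g" for x
  proof -
    obtain \<tau> where co: "fibre_coordinates E x \<tau>" using triv by blast
    from converge[OF this J] obtain K where K: "adj K = K" "\<forall>y. 0 \<le> Re (quad K y)"
      "\<forall>p\<in>fibre (dual_bundle E) x. \<forall>q\<in>fibre (dual_bundle E) x. (\<lambda>s. dual_metric E (hs (J x) s) p q)
       \<longlonglongrightarrow> (adj (column_matrix (dual_coords E \<tau> q)) ** K ** column_matrix (dual_coords E \<tau> p)) $ 1 $ 1"
      by (elim exE conjE)
    show ?thesis
    proof (rule pos_semidef_dualI[OF co _ K(1)])
      fix p q assume pq: "p \<in> fibre (dual_bundle E) x" "q \<in> fibre (dual_bundle E) x"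
      show "g p q = (adj (column_matrix (dual_coords E \<tau> q)) ** K ** column_matrix (dual_coords E \<tau> p)) $ 1 $ 1"
        unfolding g_def dual_fibreD(1)[OF pq(1)] by (rule limI[OF bspec[OF bspec[OF K(3) pq(1)] pq(2)]])
    qed (use K(2) in blast)
  qed
  have off_S: "(\<lambda>s. dual_metric E (hs j s) p q) \<longlonglongrightarrow> dual_metric E h p q"
    if "x \<in> Mj j" "x \<notin> S" "p \<in> fibre (dual_bundle E) x" "q \<in> fibre (dual_bundle E) x" for j x p q
  proof -
    obtain \<tau> where co: "fibre_coordinates E x \<tau>" using triv by blast
    show ?thesis
      by (rule dual_metric_tendsto[where hs = "hs j", OF co pd[OF that(1)] pdh[OF that(2)] _ that(3,4)]) (use lim that in blast)
  qed
  have g_off: "g p q = dual_metric E h p q"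
    if "x \<notin> S" "p \<in> fibre (dual_bundle E) x" "q \<in> fibre (dual_bundle E) x" for x p q
    unfolding g_def dual_fibreD(1)[OF that(2)] by (rule limI[OF off_S[OF J that]])
  \<comment> \<open>The squared norm obtained from $M_j$; gluing amounts to its independence of $j$.\<close>
  define N where "N j p = lim (\<lambda>s. Re (dual_metric E (hs j s) p p))" for j p
  have N: "(\<lambda>s. Re (dual_metric E (hs j s) p p)) \<longlonglongrightarrow> N j p"
    if "x \<in> Mj j" "p \<in> fibre (dual_bundle E) x" for j x p
    using tendsto_Re[OF conv[OF that(1,2,2), unfolded convergent_LIMSEQ_iff]] unfolding N_def
    by (simp add: limI)
  have N_psh: "psh_on (\<phi> ` (U \<inter> V)) ((\<lambda>x. N j (u x)) \<circ> inv_into V \<phi>)"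
    if U: "open U" "U \<subseteq> Mj j" and u: "dual_section A E U u" and c: "(V, \<phi>) \<in> A" for U u V \<phi> j
  proof -
    from nak[of j] obtain ls l where
      l: "\<forall>s. continuous_on (closure (Mj j)) (ls s)" "continuous_on (closure (Mj j)) l"
        "\<forall>s. nakano_ge A E (Mj j) (hs j s) (\<lambda>x. - ls s x) \<omega>"
        "measure_zero A {x \<in> Mj j. \<not> (\<lambda>s. ls s x) \<longlonglongrightarrow> 0}"
        "\<forall>x\<in>Mj j. \<forall>s. 0 \<le> ls s x \<and> ls s x \<le> l x"
      by (elim exE conjE)
    show ?thesis
    proof (rule nakano_approximants_psh[where M = "Mj j" and hs = "hs j" and ls = ls and l = l])
      show "continuous_on (Mj j) (ls s)" for s
        using l(1) closure_subset by (blast intro: continuous_on_subset)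
      show "continuous_on (Mj j) l"
        using l(2) closure_subset by (rule continuous_on_subset)
      show "nakano_ge A E (Mj j) (hs j s) (\<lambda>x. - ls s x) \<omega>" for s using l(3) by (rule spec)
      fix x s assume x: "x \<in> Mj j"
      show "0 \<le> ls s x" "ls s x \<le> l x" using l(5) x by blast+
      show "hnorm (hs j s) e \<le> hnorm (hs j (Suc s)) e" if "e \<in> fibre E x" for e
        by (rule mono[OF x that])
    next
      fix x assume x: "x \<in> U"
      have "u x \<in> fibre (dual_bundle E) x" using u x unfolding dual_section_def by blast
      with x U(2) show "(\<lambda>s. Re (dual_metric E (hs j s) (u x) (u x))) \<longlonglongrightarrow> N j (u x)"
        by (intro N) auto
    next
      show "Ck_metric 2 A E (Mj j) (hs j s)" for s using C2 by blast
    qed (rule A E assms(3) l(4) U u c)+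
  qed
  have N_indep_le: "N i p \<le> N j p"
    if x: "x \<in> Mj i" "x \<in> Mj j" and p: "p \<in> fibre (dual_bundle E) x" for i j x p
  proof -
    obtain U u where U: "open U" "x \<in> U" "dual_section A E U u" "u x = p"
      using exists_dual_section_through[OF A E p] .
    have "(\<Union>(V, \<phi>)\<in>A. V) = UNIV" using A unfolding complex_manifold_def by (elim conjE)
    then have "x \<in> (\<Union>(V, \<phi>)\<in>A. V)" by simp
    then obtain V \<phi> where c: "(V, \<phi>) \<in> A" "x \<in> V" by auto
    define U' where "U' = U \<inter> (Mj i \<inter> Mj j)"
    have U': "open U'" "U' \<subseteq> Mj i" "U' \<subseteq> Mj j" "U' \<subseteq> U" "x \<in> U'"
      unfolding U'_def using U openM x by auto
    have u: "dual_section A E U' u" by (rule dual_section_subset[OF U(3) U'(4)])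
    have neg: "negligible (\<phi> ` (S \<inter> V))" using bspec[OF S0[unfolded measure_zero_def] c(1)] by simp
    have "((\<lambda>x. N i (u x)) \<circ> inv_into V \<phi>) (\<phi> x) \<le> ((\<lambda>x. N j (u x)) \<circ> inv_into V \<phi>) (\<phi> x)"
    proof (rule psh_on_le_off_null_set[OF open_chart_image[OF A c(1) U'(1)]
          N_psh[OF U'(1,2) u c(1)] N_psh[OF U'(1,3) u c(1)] neg])
      show "\<phi> x \<in> \<phi> ` (U' \<inter> V)" using U'(5) c(2) by blast
      fix z assume z: "z \<in> \<phi> ` (U' \<inter> V) - \<phi> ` (S \<inter> V)"
      then obtain y where y: "y \<in> U'" "y \<in> V" "z = \<phi> y" "y \<notin> S" by blast
      have uy: "u y \<in> fibre (dual_bundle E) y" using u y(1) unfolding dual_section_def by blast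
      have lim_h: "N k (u y) = Re (dual_metric E h (u y) (u y))" if "y \<in> Mj k" for k
        unfolding N_def by (rule limI[OF tendsto_Re[OF off_S[OF that y(4) uy uy]]])
      have "y \<in> Mj i" "y \<in> Mj j" using y(1) U'(2,3) by blast+
      then have "N i (u y) = N j (u y)" by (simp only: lim_h)
      then show "((\<lambda>x. N i (u x)) \<circ> inv_into V \<phi>) z = ((\<lambda>x. N j (u x)) \<circ> inv_into V \<phi>) z"
        by (simp add: y(3) chart_inverse[OF A c(1) y(2)])
    qed
    then show ?thesis by (simp add: chart_inverse[OF A c] U(4))
  qed
  have g_norm: "(hnorm g p)\<^sup>2 = N j p" if x: "x \<in> Mj j" and p: "p \<in> fibre (dual_bundle E) x" for j x p
  proof -
    have "0 \<le> Re (g p p)" using g_semidef[of x] p unfolding pos_semidef_at_def by blast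
    then have "(hnorm g p)\<^sup>2 = Re (g p p)" by (simp add: hnorm_def)
    also have "\<dots> = N (J x) p"
      using tendsto_Re[OF conv[OF J p p, unfolded convergent_LIMSEQ_iff]]
      unfolding N_def g_def dual_fibreD(1)[OF p] by (simp add: limI)
    also have "\<dots> = N j p" using N_indep_le[OF J x p] N_indep_le[OF x J p] by simp
    finally show ?thesis .
  qed
  have "singular_griffiths_seminegative A (dual_bundle E) g"
    unfolding singular_griffiths_seminegative_def psh_on_mfd_def
  proof (intro allI impI ballI, clarify)
    fix U u V \<phi>
    assume U: "open U" and sec: "holomorphic_section A (dual_bundle E) U u" and c: "(V, \<phi>) \<in> A"
    have u: "dual_section A E U u" by (rule holomorphic_section_dual_section[OF E sec])
    let ?F = "(\<lambda>x. (hnorm g (u x))\<^sup>2) \<circ> inv_into V \<phi>"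
    let ?\<Omega> = "\<lambda>j. \<phi> ` ((U \<inter> Mj j) \<inter> V)"
    have "psh_on (?\<Omega> j) ?F" for j
    proof (rule psh_on_cong_imp)
      have sub: "dual_section A E (U \<inter> Mj j) u" by (rule dual_section_subset[OF u Int_lower1])
      show "psh_on (?\<Omega> j) ((\<lambda>x. N j (u x)) \<circ> inv_into V \<phi>)"
        by (rule N_psh[OF open_Int[OF U openM] Int_lower2 sub c])
      fix z assume "z \<in> ?\<Omega> j"
      then obtain y where y: "y \<in> U" "y \<in> Mj j" "y \<in> V" "z = \<phi> y" by blast
      have uy: "u y \<in> fibre (dual_bundle E) y" using u y(1) unfolding dual_section_def by blast
      show "((\<lambda>x. N j (u x)) \<circ> inv_into V \<phi>) z = ?F z"
        by (simp add: y(4) chart_inverse[OF A c y(3)] g_norm[OF y(2) uy])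
    qed
    moreover have "?\<Omega> j \<subseteq> ?\<Omega> (Suc j)" for j using incM[of j] by blast
    moreover have "open (?\<Omega> j)" for j by (rule open_chart_image[OF A c open_Int[OF U openM]])
    ultimately have "psh_on (\<Union>j. ?\<Omega> j) ?F" by (intro psh_on_open_exhaustion)
    moreover have "(\<Union>j. ?\<Omega> j) = \<phi> ` (U \<inter> V)" using UM by blast
    ultimately show "psh_on (\<phi> ` (U \<inter> V)) ?F" by simp
  qed
  with g_semidef g_off meas S0 pdh show ?thesis
    unfolding griffiths_semipositive_off_def by blast
qed

end
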